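(* Let $X\subset\mathbb P^6$ be an irreducible cubic hypersurface with vanishing hessian, not a cone, such that $\dim(Z^* )=1$, where $Z^*\subset\mathbb P^6$ is the dual of the polar image $Z$ of $X$. Then $X$ is a Special Perazzo Cubic Hypersurface projectively equivalent to $$V(x_0x_5^2+2x_1x_5x_6+x_2x_6^2+D(x_3,x_4,x_5,x_6)),$$ where $D$ is a cubic form in the variables $x_3,x_4,x_5,x_6$. Furthermore, the surface $V(D,x_0,x_1,x_2)\subset V(x_0,x_1,x_2)=\mathbb P^3$ is not singular along the line $T=V(x_0,x_1,x_2,x_5,x_6)$ (i.e. $T$ is not contained in the singular locus of this surface).
   Context: The ground field $\mathbb K$ is algebraically closed of characteristic zero; hypersurfaces $X=V(f)\subset\mathbb P^N$ are reduced. $X$ has vanishing hessian if $\det\left[\frac{\partial^2f}{\partial x_i\partial x_j}\right]\equiv0$. $X$ is a cone if there is $p\in X$ with $\langle p,q\rangle\subset X$ for all $q\in X$, $q\ne p$. The polar map is $\Phi_X:\mathbb P^N\dashrightarrow(\mathbb P^N)^*$, $p\mapsto(\frac{\partial f}{\partial x_0}(p):\dots:\frac{\partial f}{\partial x_N}(p))$, and the polar image is $Z=\overline{\Phi_X(\mathbb P^N)}\subsetneq(\mathbb P^N)^*$. For a linear space $\Lambda\subset(\mathbb P^N)^*$, $\Lambda^*\subset\mathbb P^N$ is the linear space of points corresponding to hyperplanes of $(\mathbb P^N)^*$ containing $\Lambda$. $T_zZ$ is the projective tangent space at a smooth point $z$, $Z_{\rm reg}$ is the smooth locus, and $Z^*=\overline{\bigcup_{z\in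 Z_{\rm reg}}(T_zZ)^*}\subset\mathbb P^N$. The Perazzo map is $\mathcal P_X:\mathbb P^N\dashrightarrow\mathbb G(\operatorname{codim}(Z)-1,N)$, $p\mapsto(T_{\Phi_X(p)}Z)^*$, with $\mu$ the dimension of (the closure of) its image. For cubics the closure of a general fiber of $\mathcal P_X$ is a linear space of dimension $N-\mu$. A Special Perazzo Cubic Hypersurface is an irreducible cubic hypersurface with vanishing hessian, not a cone, such that the closures of the general fibers of $\mathcal P_X$ all contain one fixed linear space of dimension $N-\mu-1$. *)

theory Defs
  imports
    "HOL-Analysis.Analysis"
    "HOL-Library.Poly_Mapping"
    "HOL-Library.Numeral_Type"
    "HOL-Combinatorics.Permutations"
    "HOL-Computational_Algebra.Computational_Algebra"
begin

section \<open>Polynomials\<close>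

text \<open>Polynomials in the variables $x_i$, $i$ ranging over a finite type \<open>'n\<close>: a monomial is its
  exponent vector, a polynomial is a finitely supported family of coefficients. Multiplication is
  the convolution product of \<open>poly_mapping\<close>.\<close>

type_synonym ('n, 'k) mpoly = "('n \<Rightarrow>\<^sub>0 nat) \<Rightarrow>\<^sub>0 'k"

definition Var :: "'n \<Rightarrow> ('n, 'k::comm_semiring_1) mpoly" where
  "Var i = Poly_Mapping.single (Poly_Mapping.single i 1) 1"

definition mon_eval :: "('n::finite \<Rightarrow>\<^sub>0 nat) \<Rightarrow> 'k::comm_semiring_1 ^ 'n \<Rightarrow> 'k" where
  "mon_eval m x = (\<Prod>i\<in>UNIV. (x $ i) ^ Poly_Mapping.lookup m i)"

definition peval :: "('n::finite, 'k::comm_semiring_1) mpoly \<Rightarrow> 'k ^ 'n \<Rightarrow> 'k" where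
  "peval F x = (\<Sum>m\<in>Poly_Mapping.keys F. Poly_Mapping.lookup F m * mon_eval m x)"

text \<open>If $x_i$ does not occur in the monomial \<open>m\<close>, the truncated exponent is harmless because the
  coefficient is \<open>0\<close>.\<close>

definition pdiff :: "'n \<Rightarrow> ('n, 'k::comm_semiring_1) mpoly \<Rightarrow> ('n, 'k) mpoly" where
  "pdiff i F = (\<Sum>m\<in>Poly_Mapping.keys F.
     Poly_Mapping.single (m - Poly_Mapping.single i 1)
       (of_nat (Poly_Mapping.lookup m i) * Poly_Mapping.lookup F m))"

definition mon_deg :: "('n::finite \<Rightarrow>\<^sub>0 nat) \<Rightarrow> nat" where
  "mon_deg m = (\<Sum>i\<in>UNIV. Poly_Mapping.lookup m i)"

definition form :: "nat \<Rightarrow> ('n::finite, 'k::zero) mpoly \<Rightarrow> bool" where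
  "form d F \<longleftrightarrow> (\<forall>m\<in>Poly_Mapping.keys F. mon_deg m = d)"

definition pvars :: "('n, 'k::zero) mpoly \<Rightarrow> 'n set" where
  "pvars F = (\<Union>m\<in>Poly_Mapping.keys F. Poly_Mapping.keys m)"

definition grad :: "('n::finite, 'k::comm_semiring_1) mpoly \<Rightarrow> 'k ^ 'n \<Rightarrow> 'k ^ 'n" where
  "grad F x = (\<chi> i. peval (pdiff i F) x)"

definition hessian :: "('n::finite, 'k::comm_semiring_1) mpoly \<Rightarrow> ('n, 'k) mpoly ^ 'n ^ 'n" where
  "hessian F = (\<chi> i j. pdiff i (pdiff j F))"

section \<open>The Zariski topology on projective space\<close>

text \<open>A point of the projective space with homogeneous coordinates indexed by \<open>'n\<close> (so of dimension
  $N$ with $N + 1 =$ \<open>CARD('n)\<close>) is represented by its nonzero coordinate vectors. A subset is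
  represented by the set of all coordinate vectors of its points, i.e. by the punctured affine cone
  over it. Inclusions, closures and chains of closed sets are the same as in the quotient by
  scalars. The dual space is represented in the same way, the vector \<open>a\<close> being the
  hyperplane $\sum_i a_i x_i = 0$. A projective linear space is represented by a vector subspace
  (including \<open>0\<close>), of vector space dimension one more than its projective dimension.\<close>

definition proj_zeros :: "('n::finite, 'k::comm_semiring_1) mpoly set \<Rightarrow> ('k ^ 'n) set" where
  "proj_zeros S = {x. x \<noteq> 0 \<and> (\<forall>F\<in>S. peval F x = 0)}"

definition zariski_open :: "('k::field ^ 'n::finite) set \<Rightarrow> bool" where
  "zariski_open U \<longleftrightarrow> (\<exists>S. (\<forall>F\<in>S. \<exists>d. form d F) \<and> U = - {0} - proj_zeros S)"

definition zariski :: "('k::field ^ 'n::finite) topology" where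
  "zariski = topology zariski_open"

lemma mon_eval_add: "mon_eval (m + n) x = mon_eval m x * mon_eval n x"
  by (simp add: mon_eval_def lookup_add power_add prod.distrib)

lemma peval_superset:
  assumes "finite A" "Poly_Mapping.keys F \<subseteq> A"
  shows "peval F x = (\<Sum>m\<in>A. Poly_Mapping.lookup F m * mon_eval m x)"
  unfolding peval_def using assms
  by (intro sum.mono_neutral_left) (auto simp: in_keys_iff)

lemma peval_add: "peval (F + G) x = peval F x + peval G x"
proof -
  let ?A = "Poly_Mapping.keys F \<union> Poly_Mapping.keys G"
  have "peval (F + G) x = (\<Sum>m\<in>?A. Poly_Mapping.lookup (F + G) m * mon_eval m x)"
    by (rule peval_superset) (auto simp: Poly_Mapping.keys_add)
  also have "\<dots> = (\<Sum>m\<in>?A. Poly_Mapping.lookup F m * mon_eval m x)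
      + (\<Sum>m\<in>?A. Poly_Mapping.lookup G m * mon_eval m x)"
    by (simp add: lookup_add distrib_right sum.distrib)
  also have "\<dots> = peval F x + peval G x"
    by (subst (1 2) peval_superset[of ?A]) auto
  finally show ?thesis .
qed

lemma peval_0 [simp]: "peval 0 x = 0"
  by (simp add: peval_def)

lemma peval_sum: "peval (sum f A) x = (\<Sum>a\<in>A. peval (f a) x)"
  by (induction A rule: infinite_finite_induct) (auto simp: peval_add)

lemma peval_single [simp]: "peval (Poly_Mapping.single m c) x = c * mon_eval m x"
  by (simp add: peval_def)

lemma mpoly_expand:
  "(F::('n, 'k::comm_semiring_1) mpoly) =
     (\<Sum>m\<in>Poly_Mapping.keys F. Poly_Mapping.single m (Poly_Mapping.lookup F m))"
  by (rule poly_mapping_eqI)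
    (auto simp: lookup_sum lookup_single when_def in_keys_iff sum.If_cases)

lemma mult_expand:
  "(F::('n, 'k::comm_semiring_1) mpoly) * G =
     (\<Sum>m\<in>Poly_Mapping.keys F. \<Sum>n\<in>Poly_Mapping.keys G.
        Poly_Mapping.single (m + n) (Poly_Mapping.lookup F m * Poly_Mapping.lookup G n))"
  by (subst mpoly_expand[of F], subst mpoly_expand[of G])
    (simp add: sum_product mult_single)

lemma peval_mult: "peval (F * G) x = peval F x * peval G x"
proof -
  have "peval (F * G) x = (\<Sum>m\<in>Poly_Mapping.keys F. \<Sum>n\<in>Poly_Mapping.keys G.
      Poly_Mapping.lookup F m * Poly_Mapping.lookup G n * mon_eval (m + n) x)"
    by (subst mult_expand) (simp add: peval_sum)
  also have "\<dots> = peval F x * peval G x"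
    by (simp add: mon_eval_add peval_def sum_product ac_simps)
  finally show ?thesis .
qed

lemma form_mult:
  assumes "form d F" "form e (G :: ('n::finite, 'k::comm_semiring_1) mpoly)"
  shows "form (d + e) (F * G)"
proof -
  have "Poly_Mapping.keys (F * G) \<subseteq> {m + n |m n. m \<in> Poly_Mapping.keys F \<and> n \<in> Poly_Mapping.keys G}"
    by (rule keys_mult)
  then show ?thesis
    using assms unfolding form_def mon_deg_def
    by (fastforce simp: lookup_add sum.distrib)
qed

lemma istopology_zariski: "istopology zariski_open"
  unfolding istopology_def
proof (intro conjI allI impI)
  fix U V :: "('k::field ^ 'n::finite) set"
  assume "zariski_open U" "zariski_open V"
  then obtain S T where S: "\<forall>F\<in>S. \<exists>d. form d F" "U = - {0} - proj_zeros S"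
    and T: "\<forall>F\<in>T. \<exists>d. form d F" "V = - {0} - proj_zeros T"
    unfolding zariski_open_def by blast
  let ?P = "{F * G |F G. F \<in> S \<and> G \<in> T}"
  have "\<forall>F\<in>?P. \<exists>d. form d F"
    using S(1) T(1) form_mult by blast
  moreover have "U \<inter> V = - {0} - proj_zeros ?P"
    unfolding S(2) T(2) proj_zeros_def by (auto simp: peval_mult) (metis mult_eq_0_iff peval_mult)
  ultimately show "zariski_open (U \<inter> V)"
    unfolding zariski_open_def by blast
next
  fix \<U> :: "('k::field ^ 'n::finite) set set"
  assume "\<forall>U\<in>\<U>. zariski_open U"
  then obtain S where S: "\<And>U. U \<in> \<U> \<Longrightarrow> (\<forall>F\<in>S U. \<exists>d. form d F) \<and> U = - {0} - proj_zeros (S U)"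
    unfolding zariski_open_def by metis
  have "\<Union>\<U> = (\<Union>U\<in>\<U>. - {0} - proj_zeros (S U))"
    using S by auto
  also have "\<dots> = - {0} - proj_zeros (\<Union>U\<in>\<U>. S U)"
    by (auto simp: proj_zeros_def)
  finally have "\<Union>\<U> = - {0} - proj_zeros (\<Union>U\<in>\<U>. S U)" .
  moreover have "\<forall>F\<in>(\<Union>U\<in>\<U>. S U). \<exists>d. form d F"
    using S by blast
  ultimately show "zariski_open (\<Union>\<U>)"
    unfolding zariski_open_def by blast
qed

lemma openin_zariski: "openin zariski U \<longleftrightarrow> zariski_open U"
  by (simp add: zariski_def istopology_zariski)

definition irreducible_closed :: "('k::field ^ 'n::finite) set \<Rightarrow> bool" where
  "irreducible_closed C \<longleftrightarrow> closedin zariski C \<and> C \<noteq> {} \<and>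
     (\<forall>A B. closedin zariski A \<and> closedin zariski B \<and> C = A \<union> B \<longrightarrow> C = A \<or> C = B)"

text \<open>The Krull dimension of a nonempty closed subset of projective space
  (the supremum is \<open>0\<close> for the empty set).\<close>

definition zdim :: "('k::field ^ 'n::finite) set \<Rightarrow> enat" where
  "zdim Z = Sup {enat d |d. \<exists>C. (\<forall>i\<le>d. irreducible_closed (C i) \<and> C i \<subseteq> Z) \<and>
                               (\<forall>i<d. C i \<subset> C (Suc i))}"

definition proj_equivalent :: "('k::field ^ 'n::finite) set \<Rightarrow> ('k ^ 'n) set \<Rightarrow> bool" where
  "proj_equivalent X Y \<longleftrightarrow> (\<exists>A :: 'k ^ 'n ^ 'n. invertible A \<and> X = (\<lambda>x. A *v x) ` Y)"

section \<open>Tangent spaces and duals\<close>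

definition vanishing_forms :: "('k::field ^ 'n::finite) set \<Rightarrow> ('n, 'k) mpoly set" where
  "vanishing_forms Z = {F. (\<exists>d. form d F) \<and> (\<forall>z\<in>Z. peval F z = 0)}"

definition tangent_space :: "('k::field ^ 'n::finite) set \<Rightarrow> 'k ^ 'n \<Rightarrow> ('k ^ 'n) set" where
  "tangent_space Z z = {v. \<forall>F\<in>vanishing_forms Z. (\<Sum>i\<in>UNIV. grad F z $ i * v $ i) = 0}"

text \<open>To be used for irreducible \<open>Z\<close>, where the local dimension is the same at all points.\<close>

definition reg_locus :: "('k::field ^ 'n::finite) set \<Rightarrow> ('k ^ 'n) set" where
  "reg_locus Z = {z \<in> Z. enat (vec.dim (tangent_space Z z)) = zdim Z + 1}"

definition dual_space :: "('k::field ^ 'n::finite) set \<Rightarrow> ('k ^ 'n) set" where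
  "dual_space L = {p. \<forall>a\<in>L. (\<Sum>i\<in>UNIV. a $ i * p $ i) = 0}"

definition dual_variety :: "('k::field ^ 'n::finite) set \<Rightarrow> ('k ^ 'n) set" where
  "dual_variety Z = zariski closure_of ((\<Union>z\<in>reg_locus Z. dual_space (tangent_space Z z)) - {0})"

text \<open>Jacobian criterion for the subscheme cut out by the forms in the finite set \<open>S\<close>, assumed to
  have codimension \<open>card S\<close>. The scheme structure counts: a multiple component of $V(S)$ is
  singular.\<close>

definition singular_locus :: "('n::finite, 'k::field) mpoly set \<Rightarrow> ('k ^ 'n) set" where
  "singular_locus S = {p \<in> proj_zeros S. vec.dim ((\<lambda>F. grad F p) ` S) < card S}"

section \<open>Hypersurfaces with vanishing hessian\<close>

definition hypersurface :: "('n::finite, 'k::field) mpoly \<Rightarrow> ('k ^ 'n) set" where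
  "hypersurface f = proj_zeros {f}"

definition irreducible_cubic :: "('n::finite, 'k::field) mpoly \<Rightarrow> bool" where
  "irreducible_cubic f \<longleftrightarrow> form 3 f \<and> irreducible f"

definition vanishing_hessian :: "('n::finite, 'k::field) mpoly \<Rightarrow> bool" where
  "vanishing_hessian f \<longleftrightarrow> det (hessian f) = 0"

text \<open>For \<open>q\<close> and \<open>p\<close> representing the same point the condition on the span is void.\<close>

definition is_cone :: "('k::field ^ 'n::finite) set \<Rightarrow> bool" where
  "is_cone X \<longleftrightarrow> (\<exists>p\<in>X. \<forall>q\<in>X. vec.span {p, q} - {0} \<subseteq> X)"

text \<open>The polar map sends \<open>p\<close> to \<open>grad f p\<close> and is defined where this is nonzero. The scalar \<open>c\<close>
  makes the image a union of punctured lines.\<close>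

definition polar_image :: "('n::finite, 'k::field) mpoly \<Rightarrow> ('k ^ 'n) set" where
  "polar_image f = zariski closure_of {c *s grad f p |c p. p \<noteq> 0 \<and> c \<noteq> 0 \<and> grad f p \<noteq> 0}"

definition perazzo_domain :: "('n::finite, 'k::field) mpoly \<Rightarrow> ('k ^ 'n) set" where
  "perazzo_domain f = {p. p \<noteq> 0 \<and> grad f p \<noteq> 0 \<and> grad f p \<in> reg_locus (polar_image f)}"

definition perazzo_map :: "('n::finite, 'k::field) mpoly \<Rightarrow> 'k ^ 'n \<Rightarrow> ('k ^ 'n) set" where
  "perazzo_map f p = dual_space (tangent_space (polar_image f) (grad f p))"

definition perazzo_fiber :: "('n::finite, 'k::field) mpoly \<Rightarrow> 'k ^ 'n \<Rightarrow> ('k ^ 'n) set" where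
  "perazzo_fiber f p = {q \<in> perazzo_domain f. perazzo_map f q = perazzo_map f p}"

text \<open>Pluecker coordinates of the span of a list of $r$ vectors: for each index set of size $r$
  the corresponding maximal minor. The coordinates for index sets of other sizes are set to
  \<open>0\<close>, which places the Grassmannian in a linear subspace of the projective space with
  coordinates indexed by all sets.\<close>

definition pluecker :: "('k::field ^ 'n::{finite,linorder}) list \<Rightarrow> 'k ^ ('n set)" where
  "pluecker ws = (\<chi> I. if card I = length ws
     then \<Sum>\<sigma> | \<sigma> permutes {..<length ws}.
            of_int (sign \<sigma>) * (\<Prod>j<length ws. (ws ! j) $ (sorted_list_of_set I ! \<sigma> j))
     else 0)"

text \<open>All coordinate vectors of the Pluecker point of a subspace \<open>W\<close>, one for each ordered basis.\<close>

definition pluecker_point :: "('k::field ^ 'n::{finite,linorder}) set \<Rightarrow> ('k ^ ('n set)) set" where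
  "pluecker_point W =
     {pluecker ws |ws. distinct ws \<and> vec.independent (set ws) \<and> vec.span (set ws) = W}"

definition perazzo_rank :: "('n::{finite,linorder}, 'k::field) mpoly \<Rightarrow> enat" where
  "perazzo_rank f =
     zdim (zariski closure_of (\<Union>p\<in>perazzo_domain f. pluecker_point (perazzo_map f p)))"

text \<open>General fibers are the fibers through the points of a nonempty Zariski open set \<open>U\<close>. The
  fixed linear space \<open>L\<close> has projective dimension $N - \mu - 1$, hence vector space dimension
  $N - \mu$, where $N =$ \<open>CARD('n) - 1\<close>.\<close>

definition special_perazzo_cubic :: "('n::{finite,linorder}, 'k::field) mpoly \<Rightarrow> bool" where
  "special_perazzo_cubic f \<longleftrightarrow>
     irreducible_cubic f \<and> vanishing_hessian f \<and> \<not> is_cone (hypersurface f) \<and>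
     (\<exists>L. vec.subspace L \<and> enat (vec.dim L) + perazzo_rank f = enat (CARD('n) - 1) \<and>
        (\<exists>U. openin zariski U \<and> U \<noteq> {} \<and>
           (\<forall>p \<in> U \<inter> perazzo_domain f. L - {0} \<subseteq> zariski closure_of (perazzo_fiber f p))))"

end

theory Submission
  imports Defs "HOL-Library.Function_Algebras"
begin

text \<open>Write \<open>H x\<close> for the hessian matrix of the cubic \<open>f\<close> at \<open>x\<close>; it is linear in \<open>x\<close>, the form
  \<open>dotp (H x *v y) z\<close> is trilinear and symmetric, and \<open>2 grad f x = H x *v x\<close>. Since \<open>f\<close> is not a
  cone, \<open>H v = 0\<close> only for \<open>v = 0\<close>. Let \<open>r\<close> be the maximal rank of \<open>H x\<close>; a point is called general
  if the rank is \<open>r\<close> there. By Cramer's rule a kernel vector of \<open>H p\<close> at a general point \<open>p\<close>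
  extends to a polynomial map \<open>\<psi>\<close> with \<open>H x *v \<psi> x = 0\<close> for all \<open>x\<close>
  (\<open>kernel_parametrization\<close>), and kernels at general points are totally isotropic
  (\<open>kernel_isotropic\<close>).

  The first task is to identify the dual of the polar image \<open>Z\<close> without a general dimension theory.
  The polar map is constant along \<open>p + ker (H p)\<close>, so \<open>Z\<close> is parametrized by a linear space of
  dimension \<open>r\<close>. A chain of \<open>d + 1\<close> irreducible closed sets in \<open>Z\<close> yields \<open>d + 1\<close> algebraically
  independent functions on \<open>Z\<close> (\<open>algindep_chain\<close>), and counting monomials gives \<open>d + 1 \<le> r\<close>
  (\<open>zdim_polar_image_le\<close>). The tangent space of \<open>Z\<close> at a general gradient contains the image of
  \<open>H p\<close>, which has dimension \<open>r\<close>. As the dual of \<open>Z\<close> has positive dimension, \<open>Z\<close> has a regular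
  point, and semicontinuity forces equality. Hence \<open>ker (H p)\<close> lies in the dual of \<open>Z\<close>
  for general \<open>p\<close> (\<open>generic_regular\<close>).

  The hypothesis that the dual is a curve enters through \<open>kernel_map_rank_one\<close>: if \<open>H (\<psi> p)\<close> had
  rank at least two, then a point, the closure of \<open>\<psi>\<close> on a suitable line and the closure of all
  values of \<open>\<psi>\<close> would be a chain of length two in the dual. Therefore \<open>H (\<psi> x)\<close> is the square of a
  linear form. Sums of squares of two independent forms are no squares, so the kernels are
  one-dimensional. Any two values of \<open>\<psi>\<close> are orthogonal for every \<open>H z\<close>, hence killed by all these
  forms, and a count of dimensions in seven variables shows that the forms span a space of dimension two
  (\<open>kernel_map_two_forms\<close>). Their squares span the three-dimensional space of quadratic forms
  in \<open>l1\<close>, \<open>l2\<close>, which gives three vectors \<open>e0\<close>, \<open>e1\<close>, \<open>e2\<close> and the normal form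
  (\<open>conic_structure\<close>, \<open>normal_form\<close>). If \<open>D\<close> were singular along the line \<open>T\<close>, a change of
  the coordinates \<open>x\<^sub>0\<close>, \<open>x\<^sub>1\<close>, \<open>x\<^sub>2\<close> would remove a variable and \<open>f\<close> would be a cone. The
  closure of a general fiber of the Perazzo map contains the common zeros of \<open>l1\<close> and \<open>l2\<close>, which form
  the fixed linear space (\<open>generic_perazzo_fiber\<close>).\<close>

text \<open>The symbol \<open>$\<close> is reserved for the components of vectors.\<close>

no_notation fps_nth (infixl \<open>$\<close> 75)

section \<open>Calculus of formal partial derivatives\<close>

lemma pdiff_superset:
  assumes "finite A" "Poly_Mapping.keys F \<subseteq> A"
  shows "pdiff i F = (\<Sum>m\<in>A. Poly_Mapping.single (m - Poly_Mapping.single i 1)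
       (of_nat (Poly_Mapping.lookup m i) * Poly_Mapping.lookup F m))"
  unfolding pdiff_def using assms
  by (intro sum.mono_neutral_left) (auto simp: in_keys_iff)

lemma pdiff_0 [simp]: "pdiff i 0 = 0"
  by (simp add: pdiff_def)

lemma pdiff_add: "pdiff i (F + G) = pdiff i F + pdiff i G"
proof -
  let ?A = "Poly_Mapping.keys F \<union> Poly_Mapping.keys G"
  let ?t = "\<lambda>F m. Poly_Mapping.single (m - Poly_Mapping.single i 1)
       (of_nat (Poly_Mapping.lookup m i) * Poly_Mapping.lookup F m)"
  have "pdiff i (F + G) = (\<Sum>m\<in>?A. ?t (F + G) m)"
    by (rule pdiff_superset) (auto simp: Poly_Mapping.keys_add)
  also have "\<dots> = (\<Sum>m\<in>?A. ?t F m) + (\<Sum>m\<in>?A. ?t G m)"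
    by (simp add: lookup_add distrib_left sum.distrib single_add)
  also have "\<dots> = pdiff i F + pdiff i G"
    by (subst (1 2) pdiff_superset[of ?A]) auto
  finally show ?thesis .
qed

lemma pdiff_sum: "pdiff i (sum f A) = (\<Sum>a\<in>A. pdiff i (f a))"
  by (induction A rule: infinite_finite_induct) (auto simp: pdiff_add)

lemma pdiff_single: "pdiff i (Poly_Mapping.single m c) =
    Poly_Mapping.single (m - Poly_Mapping.single i 1) (of_nat (Poly_Mapping.lookup m i) * c)"
  by (cases "c = 0") (simp_all add: pdiff_def)

lemma pdiff_commute: "pdiff i (pdiff j F) = pdiff j (pdiff i F)"
proof -
  have eq: "m - Poly_Mapping.single i 1 - Poly_Mapping.single j 1
      = m - Poly_Mapping.single j 1 - Poly_Mapping.single i (1::nat)" for m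
    by (rule poly_mapping_eqI) (simp add: lookup_minus)
  have "pdiff i (pdiff j (Poly_Mapping.single m c)) = pdiff j (pdiff i (Poly_Mapping.single m c))"
    for m :: "'a \<Rightarrow>\<^sub>0 nat" and c :: 'b
    by (cases "i = j") (simp_all add: pdiff_single eq[simplified] lookup_minus lookup_single mult.left_commute)
  then show ?thesis
    by (subst (1 2) mpoly_expand[of F]) (simp add: pdiff_sum)
qed

lemma mon_deg_minus_single:
  assumes "Poly_Mapping.lookup m i > 0"
  shows "mon_deg (m - Poly_Mapping.single i 1) = mon_deg m - 1"
proof -
  have "mon_deg m = Poly_Mapping.lookup m i + (\<Sum>j\<in>UNIV - {i}. Poly_Mapping.lookup m j)"
    unfolding mon_deg_def by (simp add: sum.remove[of UNIV i])
  moreover have "mon_deg (m - Poly_Mapping.single i 1)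
      = Poly_Mapping.lookup m i - 1 + (\<Sum>j\<in>UNIV - {i}. Poly_Mapping.lookup m j)"
    unfolding mon_deg_def
    by (subst sum.remove[of UNIV i]) (auto simp: lookup_minus lookup_single when_def intro!: sum.cong)
  ultimately show ?thesis
    using assms by simp
qed

lemma form_0 [simp]: "form d 0"
  by (simp add: form_def)

lemma form_add: "form d F \<Longrightarrow> form d G \<Longrightarrow> form d (F + G)"
  for F :: "('n::finite, 'k::comm_semiring_1) mpoly"
  unfolding form_def using Poly_Mapping.keys_add[of F G] by blast

lemma form_sum: "(\<And>a. a \<in> A \<Longrightarrow> form d (F a)) \<Longrightarrow> form d (sum F A)"
  for F :: "_ \<Rightarrow> ('n::finite, 'k::comm_semiring_1) mpoly"
  by (induction A rule: infinite_finite_induct) (auto simp: form_add)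

lemma form_single: "mon_deg m = d \<Longrightarrow> form d (Poly_Mapping.single m c)"
  by (simp add: form_def)

lemma form_pdiff:
  fixes F :: "('n::finite, 'k::comm_semiring_1) mpoly"
  assumes "form d F" shows "form (d - 1) (pdiff i F)"
  unfolding pdiff_def
proof (rule form_sum)
  fix m assume m: "m \<in> Poly_Mapping.keys F"
  show "form (d - 1) (Poly_Mapping.single (m - Poly_Mapping.single i 1)
     (of_nat (Poly_Mapping.lookup m i) * Poly_Mapping.lookup F m))"
  proof (cases "Poly_Mapping.lookup m i = 0")
    case False
    then show ?thesis
      using assms m mon_deg_minus_single[of m i] by (intro form_single) (auto simp: form_def)
  qed simp
qed

lemma mon_eval_single: "mon_eval (Poly_Mapping.single i a) x = (x $ i) ^ a"
proof -
  have "mon_eval (Poly_Mapping.single i a) x = (\<Prod>j\<in>UNIV. if j = i then (x $ i) ^ a else 1)"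
    unfolding mon_eval_def by (rule prod.cong) (auto simp: lookup_single when_def)
  then show ?thesis
    by (simp add: prod.delta)
qed

lemma mon_eval_minus_single:
  assumes "Poly_Mapping.lookup m i > 0"
  shows "x $ i * mon_eval (m - Poly_Mapping.single i 1) x = mon_eval m x"
proof -
  have "m = Poly_Mapping.single i 1 + (m - Poly_Mapping.single i 1)"
    using assms by (intro poly_mapping_eqI) (auto simp: lookup_add lookup_minus lookup_single when_def)
  then show ?thesis
    by (metis mon_eval_add mon_eval_single power_one_right)
qed

lemma euler:
  fixes F :: "('n::finite, 'k::comm_semiring_1) mpoly"
  assumes "form d F"
  shows "(\<Sum>i\<in>UNIV. x $ i * peval (pdiff i F) x) = of_nat d * peval F x"
proof -
  have 1: "x $ i * (of_nat (Poly_Mapping.lookup m i) * c * mon_eval (m - Poly_Mapping.single i 1) x)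
      = of_nat (Poly_Mapping.lookup m i) * c * mon_eval m x" for i m and c :: 'k
  proof (cases "Poly_Mapping.lookup m i = 0")
    case False
    then have "x $ i * mon_eval (m - Poly_Mapping.single i 1) x = mon_eval m x"
      by (intro mon_eval_minus_single) simp
    then show ?thesis
      by (simp only: mult.left_commute[of "x $ i"])
  qed simp
  have "(\<Sum>i\<in>UNIV. x $ i * peval (pdiff i F) x) =
     (\<Sum>i\<in>UNIV. \<Sum>m\<in>Poly_Mapping.keys F. of_nat (Poly_Mapping.lookup m i) * Poly_Mapping.lookup F m * mon_eval m x)"
    unfolding pdiff_def by (simp add: peval_sum sum_distrib_left 1[simplified])
  also have "\<dots> = (\<Sum>m\<in>Poly_Mapping.keys F. of_nat (mon_deg m) * (Poly_Mapping.lookup F m * mon_eval m x))"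
    by (subst sum.swap) (simp add: mon_deg_def sum_distrib_right mult.assoc)
  also have "\<dots> = of_nat d * peval F x"
    using assms by (simp add: form_def peval_def sum_distrib_left)
  finally show ?thesis .
qed

lemma peval_form_scale:
  fixes F :: "('n::finite, 'k::comm_semiring_1) mpoly"
  assumes "form d F" shows "peval F (c *s x) = c ^ d * peval F x"
proof -
  have "mon_eval m (c *s x) = c ^ mon_deg m * mon_eval m x" for m
    by (simp add: mon_eval_def mon_deg_def power_mult_distrib prod.distrib power_sum)
  then show ?thesis
    using assms by (simp add: peval_def form_def sum_distrib_left mult.left_commute)
qed

text \<open>The chain rule along a polynomial curve.\<close>

lemma peval_curve:
  fixes F :: "('n::finite, 'k::field_char_0) mpoly" and q :: "'n \<Rightarrow> 'k poly"
  obtains P where "\<And>t. poly P t = peval F (\<chi> i. poly (q i) t)"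
    "\<And>t. poly (pderiv P) t = (\<Sum>i\<in>UNIV. peval (pdiff i F) (\<chi> i. poly (q i) t) * poly (pderiv (q i)) t)"
proof -
  let ?x = "\<lambda>t. (\<chi> i. poly (q i) t) :: 'k ^ 'n"
  let ?M = "\<lambda>m. \<Prod>i\<in>UNIV. q i ^ Poly_Mapping.lookup m i"
  let ?P = "\<Sum>m\<in>Poly_Mapping.keys F. smult (Poly_Mapping.lookup F m) (?M m)"
  have M: "poly (?M m) t = mon_eval m (?x t)" for m t
    by (simp add: mon_eval_def poly_prod)
  have dM: "poly (pderiv (?M m)) t = (\<Sum>i\<in>UNIV. of_nat (Poly_Mapping.lookup m i) *
      mon_eval (m - Poly_Mapping.single i 1) (?x t) * poly (pderiv (q i)) t)" for m t
  proof -
    have "(\<Prod>j\<in>UNIV - {i}. poly (q j) t ^ Poly_Mapping.lookup m j) *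
        (of_nat (Poly_Mapping.lookup m i) * (poly (q i) t ^ (Poly_Mapping.lookup m i - 1) * poly (pderiv (q i)) t))
      = of_nat (Poly_Mapping.lookup m i) *
      mon_eval (m - Poly_Mapping.single i 1) (?x t) * poly (pderiv (q i)) t" for i
    proof -
      have "mon_eval (m - Poly_Mapping.single i 1) (?x t) =
        poly (q i) t ^ (Poly_Mapping.lookup m i - 1) * (\<Prod>j\<in>UNIV - {i}. poly (q j) t ^ Poly_Mapping.lookup m j)"
        unfolding mon_eval_def
        by (subst prod.remove[of UNIV i]) (auto simp: lookup_minus lookup_single when_def intro!: prod.cong)
      then show ?thesis by (simp add: ac_simps)
    qed
    then have "(\<Sum>i\<in>UNIV. (\<Prod>j\<in>UNIV - {i}. poly (q j) t ^ Poly_Mapping.lookup m j) *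
        (of_nat (Poly_Mapping.lookup m i) * (poly (q i) t ^ (Poly_Mapping.lookup m i - 1) * poly (pderiv (q i)) t)))
      = (\<Sum>i\<in>UNIV. of_nat (Poly_Mapping.lookup m i) *
      mon_eval (m - Poly_Mapping.single i 1) (?x t) * poly (pderiv (q i)) t)"
      by (intro sum.cong refl)
    then show ?thesis
      by (simp add: pderiv_prod poly_sum poly_prod pderiv_power poly_mult ac_simps)
  qed
  show thesis
  proof
    show "poly ?P t = peval F (?x t)" for t
      by (simp add: poly_sum M peval_def)
    show "poly (pderiv ?P) t = (\<Sum>i\<in>UNIV. peval (pdiff i F) (?x t) * poly (pderiv (q i)) t)" for t
    proof -
      have "poly (pderiv ?P) t = (\<Sum>m\<in>Poly_Mapping.keys F. \<Sum>i\<in>UNIV. Poly_Mapping.lookup F m *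
        (of_nat (Poly_Mapping.lookup m i) * mon_eval (m - Poly_Mapping.single i 1) (?x t) * poly (pderiv (q i)) t))"
        by (simp add: higher_pderiv_sum[of 1, simplified] pderiv_smult poly_sum dM sum_distrib_left)
      also have "\<dots> = (\<Sum>i\<in>UNIV. \<Sum>m\<in>Poly_Mapping.keys F. of_nat (Poly_Mapping.lookup m i) *
        Poly_Mapping.lookup F m * mon_eval (m - Poly_Mapping.single i 1) (?x t) * poly (pderiv (q i)) t)"
        by (subst sum.swap) (intro sum.cong refl, simp only: ac_simps)
      also have "\<dots> = (\<Sum>i\<in>UNIV. peval (pdiff i F) (?x t) * poly (pderiv (q i)) t)"
        unfolding pdiff_def by (simp add: peval_sum sum_distrib_right)
      finally show ?thesis .
    qed
  qed
qed

section \<open>Polynomial functions\<close>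

text \<open>Functions on affine space given by polynomials that need not be homogeneous, and maps with
  such components. Arguments about general points only use the functions, not the polynomials.\<close>

definition polyfun :: "('k::comm_semiring_1 ^ 'n::finite \<Rightarrow> 'k) \<Rightarrow> bool" where
  "polyfun g \<longleftrightarrow> (\<exists>F. g = peval F)"

definition polymap :: "('k::comm_semiring_1 ^ 'n::finite \<Rightarrow> 'k ^ 'm::finite) \<Rightarrow> bool" where
  "polymap h \<longleftrightarrow> (\<forall>i. polyfun (\<lambda>x. h x $ i))"

lemma polyfun_peval [intro, simp]: "polyfun (peval F)"
  by (auto simp: polyfun_def)

lemma peval_Var [simp]: "peval (Var i) x = x $ i"
  by (simp add: Var_def mon_eval_single)

lemma mon_eval_0 [simp]: "mon_eval 0 x = 1"
  by (simp add: mon_eval_def)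

lemma peval_1 [simp]: "peval 1 x = 1"
  using peval_single[of 0 1 x] by simp

lemma polyfun_const [intro, simp]: "polyfun (\<lambda>x. c)"
  unfolding polyfun_def by (rule exI[of _ "Poly_Mapping.single 0 c"]) auto

lemma polyfun_nth [intro, simp]: "polyfun (\<lambda>x. x $ i)"
  unfolding polyfun_def by (rule exI[of _ "Var i"]) auto

lemma polyfun_add [intro]:
  assumes "polyfun g" "polyfun h" shows "polyfun (\<lambda>x. g x + h x)"
proof -
  obtain F G where "g = peval F" "h = peval G"
    using assms unfolding polyfun_def by auto
  then show ?thesis
    unfolding polyfun_def by (intro exI[of _ "F + G"]) (simp add: peval_add fun_eq_iff)
qed

lemma polyfun_mult [intro]:
  assumes "polyfun g" "polyfun h" shows "polyfun (\<lambda>x. g x * h x)"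
proof -
  obtain F G where "g = peval F" "h = peval G"
    using assms unfolding polyfun_def by auto
  then show ?thesis
    unfolding polyfun_def by (intro exI[of _ "F * G"]) (simp add: peval_mult fun_eq_iff)
qed

lemma polyfun_minus [intro]:
  fixes g :: "'k::comm_ring_1 ^ 'n::finite \<Rightarrow> 'k"
  assumes "polyfun g" shows "polyfun (\<lambda>x. - g x)"
  using polyfun_mult[OF polyfun_const[of "- 1"] assms] by simp

lemma polyfun_sub [intro]:
  fixes g h :: "'k::comm_ring_1 ^ 'n::finite \<Rightarrow> 'k"
  assumes "polyfun g" "polyfun h" shows "polyfun (\<lambda>x. g x - h x)"
  using polyfun_add[OF assms(1) polyfun_minus[OF assms(2)]] by simp

lemma polyfun_sum [intro]: "(\<And>a. a \<in> A \<Longrightarrow> polyfun (g a)) \<Longrightarrow> polyfun (\<lambda>x. \<Sum>a\<in>A. g a x)"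
  by (induction A rule: infinite_finite_induct) auto

lemma polyfun_prod [intro]: "(\<And>a. a \<in> A \<Longrightarrow> polyfun (g a)) \<Longrightarrow> polyfun (\<lambda>x. \<Prod>a\<in>A. g a x)"
  by (induction A rule: infinite_finite_induct) auto

lemma polyfun_power [intro]: "polyfun g \<Longrightarrow> polyfun (\<lambda>x. g x ^ n)"
  by (induction n) auto

lemma polyfun_compose:
  assumes "polyfun g" "polymap h" shows "polyfun (\<lambda>x. g (h x))"
proof -
  obtain F where F: "g = peval F"
    using assms(1) unfolding polyfun_def by auto
  have "polyfun (\<lambda>x. (h x $ i) ^ n)" for i n
    using assms(2) unfolding polymap_def by (simp add: polyfun_power)
  then have "polyfun (\<lambda>x. mon_eval m (h x))" for m
    unfolding mon_eval_def by (simp add: polyfun_prod)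
  then show ?thesis
    unfolding F peval_def by (simp add: polyfun_sum polyfun_mult)
qed

lemma polyfun_det:
  fixes A :: "'k::comm_ring_1 ^ 'n::finite \<Rightarrow> 'k ^ 'm ^ 'm::finite"
  assumes "\<And>i j. polyfun (\<lambda>x. A x $ i $ j)"
  shows "polyfun (\<lambda>x. det (A x))"
proof -
  have "polyfun (\<lambda>x. \<Prod>i\<in>UNIV. A x $ i $ p i)" for p
    using assms by (simp add: polyfun_prod)
  then show ?thesis
    unfolding det_def by (simp add: polyfun_sum polyfun_mult)
qed

lemma polyfun_line:
  fixes x y :: "'k::comm_ring_1 ^ 'n::finite"
  assumes "polyfun g" obtains p where "\<And>t. g (x + t *s y) = poly p t"
proof -
  obtain F where F: "g = peval F" using assms polyfun_def by blast
  let ?p = "\<Sum>m\<in>Poly_Mapping.keys F. smult (Poly_Mapping.lookup F m)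
      (\<Prod>i\<in>UNIV. [:x $ i, y $ i:] ^ Poly_Mapping.lookup m i)"
  have "g (x + t *s y) = poly ?p t" for t
    by (simp add: F peval_def mon_eval_def poly_sum poly_prod)
  then show thesis by (rule that)
qed

lemma poly_zero_cofinite:
  fixes p :: "'k::{idom, ring_char_0} poly"
  assumes "finite S" "\<And>t. t \<notin> S \<Longrightarrow> poly p t = 0"
  shows "p = 0"
proof (rule ccontr)
  assume "p \<noteq> 0"
  then have "finite {t. poly p t = 0}" by (rule poly_roots_finite)
  moreover have "UNIV = S \<union> {t. poly p t = 0}" using assms(2) by blast
  ultimately have "finite (UNIV :: 'k set)"
    using assms(1) by (metis finite_Un)
  then show False by (simp add: infinite_UNIV_char_0)
qed

text \<open>The affine space is irreducible: the loci where finitely many polynomial functions do not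
  vanish have a common point as soon as each is nonempty.\<close>

lemma polyfun_common_nonzero:
  fixes g h :: "'k::{idom, ring_char_0} ^ 'n::finite \<Rightarrow> 'k"
  assumes "polyfun g" "polyfun h" "g a \<noteq> 0" "h b \<noteq> 0"
  shows "\<exists>z. g z \<noteq> 0 \<and> h z \<noteq> 0"
proof (rule ccontr)
  assume *: "\<not> ?thesis"
  obtain p where p: "\<And>t. g (a + t *s (b - a)) = poly p t"
    using polyfun_line[OF assms(1)] by blast
  obtain q where q: "\<And>t. h (a + t *s (b - a)) = poly q t"
    using polyfun_line[OF assms(2)] by blast
  have "poly (p * q) t = 0" for t
    using * by (metis p q poly_mult mult_eq_0_iff)
  then have "p = 0 \<or> q = 0"
    using poly_zero_cofinite[of "{}" "p * q"] by auto
  then show False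
    using p[of 0] q[of 1] assms(3,4) by auto
qed

lemma polyfun_zero_generic:
  fixes g h :: "'k::{idom, ring_char_0} ^ 'n::finite \<Rightarrow> 'k"
  assumes "polyfun g" "polyfun h" "h b \<noteq> 0" "\<And>x. h x \<noteq> 0 \<Longrightarrow> g x = 0"
  shows "g x = 0"
  using polyfun_common_nonzero[OF assms(1,2) _ assms(3)] assms(4) by blast

text \<open>The part of degree \<open>e\<close> of a polynomial.\<close>

definition hpart :: "nat \<Rightarrow> ('n::finite, 'k::comm_semiring_1) mpoly \<Rightarrow> ('n, 'k) mpoly" where
  "hpart e F = (\<Sum>m | m \<in> Poly_Mapping.keys F \<and> mon_deg m = e. Poly_Mapping.single m (Poly_Mapping.lookup F m))"

lemma form_hpart: "form e (hpart e F)"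
  unfolding hpart_def by (intro form_sum form_single) auto

lemma hpart_expand:
  obtains n where "d \<le> n" "\<And>x. peval F x = (\<Sum>e\<le>n. peval (hpart e F) x)"
proof -
  let ?n = "max d (Max (mon_deg ` Poly_Mapping.keys F))"
  have "peval F x = (\<Sum>e\<le>?n. peval (hpart e F) x)" for x
  proof -
    have "(\<Sum>e\<le>?n. peval (hpart e F) x) =
      (\<Sum>e\<le>?n. \<Sum>m | m \<in> Poly_Mapping.keys F \<and> mon_deg m = e. Poly_Mapping.lookup F m * mon_eval m x)"
      by (simp add: hpart_def peval_sum)
    also have "\<dots> = peval F x"
      unfolding peval_def by (rule sum.group) (auto simp: le_max_iff_disj)
    finally show ?thesis by simp
  qed
  with that[of ?n] show thesis by simp
qed

lemma poly_sum_powers: "poly (\<Sum>e\<le>n. monom (c e) e) t = (\<Sum>e\<le>n. t ^ e * c e)"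
  for t :: "'k::comm_semiring_1"
  by (simp add: poly_sum poly_monom mult.commute)

lemma coeff_sum_powers: "e \<le> n \<Longrightarrow> coeff (\<Sum>e\<le>n. monom (c e) e) e = c e"
  by (simp add: coeff_sum coeff_monom)

text \<open>A homogeneous polynomial function is given by a form. This spares the explicit construction
  of forms by substitution.\<close>

lemma homogeneous_polyfun_form:
  fixes g :: "'k::{idom, ring_char_0} ^ 'n::finite \<Rightarrow> 'k"
  assumes "polyfun g" "\<And>t x. g (t *s x) = t ^ d * g x"
  obtains G where "form d G" "peval G = g"
proof -
  obtain F where F: "g = peval F" using assms(1) polyfun_def by blast
  obtain n where n: "d \<le> n" "\<And>x. peval F x = (\<Sum>e\<le>n. peval (hpart e F) x)"
    using hpart_expand by blast
  have "peval (hpart d F) x = g x" for x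
  proof -
    let ?p = "\<Sum>e\<le>n. monom (peval (hpart e F) x) e"
    have "poly ?p t = poly (monom (g x) d) t" for t
      using assms(2)[of t x]
      by (simp add: poly_sum_powers poly_monom F n(2) peval_form_scale[OF form_hpart] mult.commute)
    then have "?p = monom (g x) d"
      using poly_zero_cofinite[of "{}" "?p - monom (g x) d"] by simp
    then show ?thesis
      using coeff_sum_powers[OF n(1), of "\<lambda>e. peval (hpart e F) x"] by simp
  qed
  then have "peval (hpart d F) = g" by blast
  then show thesis
    using that[OF form_hpart] by blast
qed


section \<open>Closed and irreducible sets\<close>

lemma topspace_zariski [simp]: "topspace zariski = (- {0} :: ('k::field ^ 'n::finite) set)"
proof -
  have "zariski_open (- {0} :: ('k ^ 'n) set)"
    unfolding zariski_open_def
    by (rule exI[of _ "{1}"]) (auto simp: proj_zeros_def form_def mon_deg_def)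
  then have "- {0} \<subseteq> topspace (zariski :: ('k ^ 'n) topology)"
    using openin_subset openin_zariski by blast
  moreover have "topspace (zariski :: ('k ^ 'n) topology) \<subseteq> - {0}"
    using openin_topspace[of "zariski :: ('k ^ 'n) topology"]
    unfolding openin_zariski zariski_open_def by auto
  ultimately show ?thesis by blast
qed

lemma closedin_zariski:
  "closedin zariski C \<longleftrightarrow> (\<exists>S. (\<forall>F\<in>S. \<exists>d. form d F) \<and> C = proj_zeros S)"
proof
  assume "closedin zariski C"
  then obtain S where C: "C \<subseteq> - {0}" and S: "\<forall>F\<in>S. \<exists>d. form d F" "- {0} - C = - {0} - proj_zeros S"
    unfolding closedin_def openin_zariski zariski_open_def by auto
  moreover have "proj_zeros S \<subseteq> - {0}" by (auto simp: proj_zeros_def)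
  ultimately have "C = proj_zeros S" by blast
  with S show "\<exists>S. (\<forall>F\<in>S. \<exists>d. form d F) \<and> C = proj_zeros S" by blast
next
  assume "\<exists>S. (\<forall>F\<in>S. \<exists>d. form d F) \<and> C = proj_zeros S"
  then show "closedin zariski C"
    unfolding closedin_def openin_zariski zariski_open_def by (auto simp: proj_zeros_def)
qed

lemma closedin_zariski_nonzero: "closedin zariski C \<Longrightarrow> x \<in> C \<Longrightarrow> x \<noteq> 0"
  using closedin_subset[of zariski C] by auto

lemma closedin_zariski_scale:
  assumes "closedin zariski C" "x \<in> C" "t \<noteq> 0" shows "t *s x \<in> C"
proof -
  obtain S where S: "\<forall>F\<in>S. \<exists>d. form d F" "C = proj_zeros S"
    using assms(1) closedin_zariski by blast
  show ?thesis
    using assms(2,3) S peval_form_scale by (fastforce simp: proj_zeros_def)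
qed

lemma closedin_zariski_separate:
  assumes "closedin zariski C" "x \<notin> C" "x \<noteq> 0"
  obtains d F where "form d F" "\<And>y. y \<in> C \<Longrightarrow> peval F y = 0" "peval F x \<noteq> 0"
  using assms unfolding closedin_zariski proj_zeros_def by blast

lemma zariski_closure:
  "zariski closure_of S =
     {x. x \<noteq> 0 \<and> (\<forall>d F. form d F \<longrightarrow> (\<forall>y\<in>S - {0}. peval F y = 0) \<longrightarrow> peval F x = 0)}"
  (is "_ = ?R")
proof (rule subset_antisym)
  let ?T = "{F. (\<exists>d. form d F) \<and> (\<forall>y\<in>S - {0}. peval F y = 0)}"
  have R: "?R = proj_zeros ?T"
    unfolding proj_zeros_def by (rule Collect_cong) blast
  have "closedin zariski (proj_zeros ?T)"
    unfolding closedin_zariski by (rule exI[of _ ?T]) simp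
  moreover have "topspace zariski \<inter> S \<subseteq> proj_zeros ?T"
    by (auto simp: proj_zeros_def)
  ultimately have "zariski closure_of (topspace zariski \<inter> S) \<subseteq> proj_zeros ?T"
    by (intro closure_of_minimal)
  then show "zariski closure_of S \<subseteq> ?R"
    unfolding R by (subst closure_of_restrict)
next
  obtain T where T: "\<forall>F\<in>T. \<exists>d. form d F" "zariski closure_of S = proj_zeros T"
    using closedin_zariski[THEN iffD1, OF closedin_closure_of[of zariski S]] by (elim exE conjE)
  have sub: "topspace zariski \<inter> S \<subseteq> proj_zeros T"
    using closure_of_subset_Int[of zariski S] unfolding T(2) .
  have van: "peval F y = 0" if "F \<in> T" "y \<in> S - {0}" for F y
  proof -
    have "y \<in> proj_zeros T" using that(2) by (intro subsetD[OF sub]) simp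
    then show ?thesis using that(1) unfolding proj_zeros_def by blast
  qed
  show "?R \<subseteq> zariski closure_of S"
  proof
    fix x assume x: "x \<in> ?R"
    have "peval F x = 0" if F: "F \<in> T" for F
    proof -
      obtain d where d: "form d F" using T(1) F by blast
      have "form d F \<longrightarrow> (\<forall>y\<in>S - {0}. peval F y = 0) \<longrightarrow> peval F x = 0"
        using x by blast
      then show ?thesis using d van[OF F] by blast
    qed
    then show "x \<in> zariski closure_of S"
      unfolding T(2) proj_zeros_def using x by blast
  qed
qed

lemma zariski_closure_superset: "x \<in> S \<Longrightarrow> x \<noteq> 0 \<Longrightarrow> x \<in> zariski closure_of S"
  unfolding zariski_closure by simp

text \<open>Closed sets are cones, so a polynomial can be replaced by its homogeneous parts: these vanish at
  \<open>x\<close> iff the polynomial vanishes at all nonzero multiples of \<open>x\<close>.\<close>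

lemma closedin_zeros_on_cone:
  fixes C :: "('k::{field_char_0} ^ 'n::finite) set"
  assumes "closedin zariski C" "polyfun P"
  shows "closedin zariski {x \<in> C. \<forall>t. t \<noteq> 0 \<longrightarrow> P (t *s x) = 0}"
proof -
  obtain F where F: "P = peval F" using assms(2) unfolding polyfun_def by auto
  obtain S where S: "\<forall>F\<in>S. \<exists>d. form d F" "C = proj_zeros S"
    using assms(1) closedin_zariski by blast
  have "(\<forall>t. t \<noteq> 0 \<longrightarrow> P (t *s x) = 0) \<longleftrightarrow> (\<forall>e. peval (hpart e F) x = 0)" for x
  proof
    assume *: "\<forall>t. t \<noteq> 0 \<longrightarrow> P (t *s x) = 0"
    show "\<forall>e. peval (hpart e F) x = 0"
    proof
      fix d
      obtain n where n: "d \<le> n" "\<And>x. peval F x = (\<Sum>e\<le>n. peval (hpart e F) x)"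
        using hpart_expand by blast
      let ?p = "\<Sum>e\<le>n. monom (peval (hpart e F) x) e"
      have "poly ?p t = P (t *s x)" for t
        by (simp add: poly_sum_powers n(2) F peval_form_scale[OF form_hpart])
      then have "?p = 0"
        by (intro poly_zero_cofinite[of "{0}"]) (use * in auto)
      then show "peval (hpart d F) x = 0"
        using coeff_sum_powers[OF n(1), of "\<lambda>e. peval (hpart e F) x"] by simp
    qed
  next
    assume "\<forall>e. peval (hpart e F) x = 0"
    moreover obtain n where "\<And>x. peval F x = (\<Sum>e\<le>n. peval (hpart e F) x)"
      using hpart_expand by blast
    ultimately show "\<forall>t. t \<noteq> 0 \<longrightarrow> P (t *s x) = 0"
      by (simp add: F peval_form_scale[OF form_hpart])
  qed
  then have "{x \<in> C. \<forall>t. t \<noteq> 0 \<longrightarrow> P (t *s x) = 0} = proj_zeros (S \<union> range (\<lambda>e. hpart e F))"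
    by (auto simp: S(2) proj_zeros_def)
  moreover have "\<forall>G\<in>S \<union> range (\<lambda>e. hpart e F). \<exists>d. form d G"
    using S(1) form_hpart by blast
  ultimately show ?thesis
    unfolding closedin_zariski by blast
qed

text \<open>The ideal of an irreducible closed set is prime, also for polynomials that are not
  homogeneous.\<close>

lemma irreducible_closed_prime:
  fixes C :: "('k::{field_char_0} ^ 'n::finite) set"
  assumes "irreducible_closed C" "polyfun P" "polyfun Q" "\<And>x. x \<in> C \<Longrightarrow> P x * Q x = 0"
  shows "(\<forall>x\<in>C. P x = 0) \<or> (\<forall>x\<in>C. Q x = 0)"
proof -
  let ?V = "\<lambda>R. {x \<in> C. \<forall>t. t \<noteq> 0 \<longrightarrow> R (t *s x) = 0}"
  have C: "closedin zariski C" using assms(1) irreducible_closed_def by blast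
  have "x \<in> ?V P \<union> ?V Q" if x: "x \<in> C" for x
  proof -
    obtain p where p: "\<And>t. P (0 + t *s x) = poly p t" using polyfun_line[OF assms(2)] by blast
    obtain q where q: "\<And>t. Q (0 + t *s x) = poly q t" using polyfun_line[OF assms(3)] by blast
    have "poly (p * q) t = 0" if "t \<notin> {0}" for t
      using assms(4) closedin_zariski_scale[OF C x] p q that by (simp add: poly_mult flip: p q)
    then have "p * q = 0"
      by (intro poly_zero_cofinite[of "{0}"]) auto
    then have "p = 0 \<or> q = 0" by simp
    then show ?thesis using p q x by auto
  qed
  then have "C = ?V P \<union> ?V Q" by blast
  then have "C = ?V P \<or> C = ?V Q"
    using assms(1) closedin_zeros_on_cone[OF C assms(2)] closedin_zeros_on_cone[OF C assms(3)]
    unfolding irreducible_closed_def by blast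
  then show ?thesis
  proof
    assume CP: "C = ?V P"
    have "P x = 0" if "x \<in> C" for x
    proof -
      have "\<forall>t. t \<noteq> 0 \<longrightarrow> P (t *s x) = 0" using CP that by blast
      then show ?thesis by (metis one_neq_zero vec.scale_one)
    qed
    then show ?thesis by blast
  next
    assume CQ: "C = ?V Q"
    have "Q x = 0" if "x \<in> C" for x
    proof -
      have "\<forall>t. t \<noteq> 0 \<longrightarrow> Q (t *s x) = 0" using CQ that by blast
      then show ?thesis by (metis one_neq_zero vec.scale_one)
    qed
    then show ?thesis by blast
  qed
qed

lemma irreducible_closed_image:
  fixes g :: "'k::field_char_0 ^ 'm::finite \<Rightarrow> 'k ^ 'n::finite"
  assumes "polymap g" "g a \<noteq> 0"
  shows "irreducible_closed (zariski closure_of range g)"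
  unfolding irreducible_closed_def
proof (intro conjI allI impI)
  let ?C = "zariski closure_of range g"
  show "closedin zariski ?C" by simp
  show "?C \<noteq> {}"
    using zariski_closure_superset[of "g a" "range g"] assms(2) by blast
  fix A B assume "closedin zariski A \<and> closedin zariski B \<and> ?C = A \<union> B"
  then have A: "closedin zariski A" and B: "closedin zariski B" and C: "?C = A \<union> B" by auto
  have sep: "\<exists>h b. polyfun h \<and> h (g b) \<noteq> 0 \<and> (\<forall>y\<in>A. h y = 0)"
    if A: "closedin zariski A" "?C \<noteq> A" "A \<subseteq> ?C" for A
  proof -
    have "\<not> ?C \<subseteq> A" using that by blast
    then have "\<not> topspace zariski \<inter> range g \<subseteq> A"
      using closure_of_minimal[OF _ A(1), of "topspace zariski \<inter> range g"]
      by (subst (asm) closure_of_restrict) blast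
    then obtain b where b: "g b \<noteq> 0" "g b \<notin> A" by auto
    obtain d F where F: "form d F" "\<And>y. y \<in> A \<Longrightarrow> peval F y = 0" "peval F (g b) \<noteq> 0"
      using closedin_zariski_separate[OF A(1) b(2,1)] by blast
    then show ?thesis by (intro exI[of _ "peval F"] exI[of _ b]) auto
  qed
  show "?C = A \<or> ?C = B"
  proof (rule ccontr)
    assume "\<not> (?C = A \<or> ?C = B)"
    then obtain h b h' b' where h: "polyfun h" "h (g b) \<noteq> 0" "\<forall>y\<in>A. h y = 0"
      and h': "polyfun h'" "h' (g b') \<noteq> 0" "\<forall>y\<in>B. h' y = 0"
      using sep[OF A] sep[OF B] C by blast
    obtain i where i: "g a $ i \<noteq> 0" using assms(2) by (auto simp: vec_eq_iff)
    have pf: "polyfun (\<lambda>x. h (g x))" "polyfun (\<lambda>x. h' (g x))" "polyfun (\<lambda>x. g x $ i)"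
      using h(1) h'(1) assms(1) by (auto intro: polyfun_compose simp: polymap_def)
    obtain z where z: "h (g z) \<noteq> 0 \<and> h' (g z) \<noteq> 0"
      using polyfun_common_nonzero[OF pf(1,2) h(2) h'(2)] by blast
    then have "\<exists>z. h (g z) * h' (g z) \<noteq> 0 \<and> g z $ i \<noteq> 0"
      by (intro polyfun_common_nonzero[OF polyfun_mult[OF pf(1,2)] pf(3) _ i]) auto
    then obtain w where w: "h (g w) \<noteq> 0" "h' (g w) \<noteq> 0" "g w $ i \<noteq> 0" by auto
    then have "g w \<in> ?C" by (intro zariski_closure_superset) auto
    then show False using C h(3) h'(3) w by blast
  qed
qed

lemma zdim_ge:
  assumes "\<And>i. i \<le> d \<Longrightarrow> irreducible_closed (C i) \<and> C i \<subseteq> Z" "\<And>i. i < d \<Longrightarrow> C i \<subset> C (Suc i)"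
  shows "enat d \<le> zdim Z"
  unfolding zdim_def by (rule Sup_upper) (use assms in blast)

lemma zdim_le:
  assumes "\<And>d C. (\<And>i. i \<le> d \<Longrightarrow> irreducible_closed (C i) \<and> C i \<subseteq> Z) \<Longrightarrow>
      (\<And>i. i < d \<Longrightarrow> C i \<subset> C (Suc i)) \<Longrightarrow> enat d \<le> e"
  shows "zdim Z \<le> e"
  unfolding zdim_def by (rule Sup_least) (use assms in blast)

lemma zdim_empty [simp]: "zdim {} = 0"
proof -
  have "zdim ({} :: ('k::field ^ 'n::finite) set) \<le> 0"
  proof (rule zdim_le)
    fix d and C :: "nat \<Rightarrow> ('k ^ 'n) set"
    assume *: "\<And>i. i \<le> d \<Longrightarrow> irreducible_closed (C i) \<and> C i \<subseteq> {}"
    show "enat d \<le> 0" using *[of 0] by (auto simp: irreducible_closed_def)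
  qed
  then show ?thesis by (simp add: zero_enat_def[symmetric] flip: zero_enat_def)
qed

section \<open>Algebraic independence along chains of irreducible closed sets\<close>

text \<open>The functions \<open>g 0, \<dots>, g (k - 1)\<close> are algebraically independent on \<open>C\<close>: no nonzero polynomial
  in them, here given by its coefficients on a box of exponents, vanishes on \<open>C\<close>.\<close>

definition algindep :: "'x set \<Rightarrow> (nat \<Rightarrow> 'x \<Rightarrow> 'k::comm_ring_1) \<Rightarrow> nat \<Rightarrow> bool" where
  "algindep C g k \<longleftrightarrow> (\<forall>n c. (\<forall>x\<in>C. (\<Sum>\<alpha>\<in>PiE {..<k} (\<lambda>_. {..<n}). c \<alpha> * (\<Prod>i<k. g i x ^ \<alpha> i)) = 0) \<longrightarrow>
     (\<forall>\<alpha>\<in>PiE {..<k} (\<lambda>_. {..<n}). c \<alpha> = 0))"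

lemma algindepD:
  assumes "algindep C g k"
    and "\<And>x. x \<in> C \<Longrightarrow> (\<Sum>\<alpha>\<in>PiE {..<k} (\<lambda>_. {..<n}). c \<alpha> * (\<Prod>i<k. g i x ^ \<alpha> i)) = 0"
    and "\<alpha> \<in> PiE {..<k} (\<lambda>_. {..<n})"
  shows "c \<alpha> = 0"
  using assms(1)[unfolded algindep_def, THEN spec[of _ n], THEN spec[of _ c]] assms(2,3) by blast

lemma sum_PiE_Suc:
  "(\<Sum>\<beta>\<in>PiE {..<Suc k} (\<lambda>_. {..<n::nat}). F \<beta>) =
     (\<Sum>j<n. \<Sum>\<alpha>\<in>PiE {..<k} (\<lambda>_. {..<n}). F (\<alpha>(k := j)))"
proof -
  have inj: "inj_on (\<lambda>(y, g). g(k := y)) ({..<n} \<times> PiE {..<k} (\<lambda>_. {..<n}))"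
    by (rule inj_combinator) simp
  have "(\<Sum>\<beta>\<in>PiE {..<Suc k} (\<lambda>_. {..<n}). F \<beta>) =
      sum F ((\<lambda>(y, g). g(k := y)) ` ({..<n} \<times> PiE {..<k} (\<lambda>_. {..<n})))"
    by (simp add: lessThan_Suc PiE_insert_eq)
  also have "\<dots> = (\<Sum>(j, \<alpha>)\<in>{..<n} \<times> PiE {..<k} (\<lambda>_. {..<n}). F (\<alpha>(k := j)))"
    by (subst sum.reindex[OF inj]) (simp add: split_def o_def)
  finally show ?thesis
    by (simp add: sum.cartesian_product)
qed

text \<open>A function \<open>h\<close> that vanishes on \<open>C'\<close> but not on \<open>C\<close> extends a family that is independent on \<open>C'\<close>
  to one that is independent on \<open>C\<close>: in a relation on \<open>C\<close> the lowest power of \<open>h\<close> can be cancelled, since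
  the ideal of \<open>C\<close> is prime, and restriction to \<open>C'\<close> kills all higher powers.\<close>

lemma algindep_extend:
  fixes g :: "nat \<Rightarrow> 'k::field_char_0 ^ 'n::finite \<Rightarrow> 'k"
  assumes ind: "algindep C' g k" and pf: "\<And>i. polyfun (g i)" "polyfun h"
    and h: "\<And>x. x \<in> C' \<Longrightarrow> h x = 0" "y \<in> C" "h y \<noteq> 0"
    and sub: "\<And>Q. polyfun Q \<Longrightarrow> \<forall>x\<in>C. Q x = 0 \<Longrightarrow> \<forall>x\<in>C'. Q x = 0"
    and prime: "\<And>P Q. polyfun P \<Longrightarrow> polyfun Q \<Longrightarrow> (\<forall>x\<in>C. P x * Q x = 0) \<Longrightarrow>
        (\<forall>x\<in>C. P x = 0) \<or> (\<forall>x\<in>C. Q x = 0)"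
  shows "algindep C (g(k := h)) (Suc k)"
  unfolding algindep_def
proof (intro allI impI)
  fix n :: nat and c :: "(nat \<Rightarrow> nat) \<Rightarrow> 'k"
  let ?A = "PiE {..<k} (\<lambda>_. {..<n})"
  assume rel: "\<forall>x\<in>C. (\<Sum>\<alpha>\<in>PiE {..<Suc k} (\<lambda>_. {..<n}). c \<alpha> * (\<Prod>i<Suc k. (g(k := h)) i x ^ \<alpha> i)) = 0"
  define P where "P j x = (\<Sum>\<alpha>\<in>?A. c (\<alpha>(k := j)) * (\<Prod>i<k. g i x ^ \<alpha> i))" for j x
  have polyP: "polyfun (P j)" for j
    unfolding P_def by (intro polyfun_sum polyfun_mult polyfun_const polyfun_prod polyfun_power pf)
  have rel': "(\<Sum>j<n. P j x * h x ^ j) = 0" if "x \<in> C" for x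
  proof -
    have "(\<Prod>i<k. (g(k := h)) i x ^ (\<alpha>(k := j)) i) = (\<Prod>i<k. g i x ^ \<alpha> i)" for \<alpha> j
      by (rule prod.cong) auto
    then show ?thesis
      using rel that by (simp add: sum_PiE_Suc P_def sum_distrib_right mult.assoc)
  qed
  have zero: "j < n \<Longrightarrow> \<forall>\<alpha>\<in>?A. c (\<alpha>(k := j)) = 0" for j
  proof (induction j rule: less_induct)
    case (less j)
    define Q where "Q x = (\<Sum>i<n - j. P (i + j) x * h x ^ i)" for x
    have polyQ: "polyfun Q"
      unfolding Q_def by (intro polyfun_sum polyfun_mult polyP polyfun_power pf)
    have "h x ^ j * Q x = 0" if "x \<in> C" for x
    proof -
      have "P i x = 0" if "i < j" for i
        unfolding P_def
      proof (intro sum.neutral ballI)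
        fix \<alpha> assume "\<alpha> \<in> ?A"
        then have "c (\<alpha>(k := i)) = 0"
          using less.IH[OF that] less.prems that by (meson order.strict_trans)
        then show "c (\<alpha>(k := i)) * (\<Prod>i<k. g i x ^ \<alpha> i) = 0" by (simp only: mult_zero_left)
      qed
      then have "(\<Sum>i<j. P i x * h x ^ i) = 0"
        by (intro sum.neutral) auto
      moreover have "(\<Sum>i<m + j. f i) = (\<Sum>i<j. f i) + (\<Sum>i<m. f (i + j))" for m and f :: "nat \<Rightarrow> 'k"
        by (induction m) (auto simp: add.assoc)
      from this[of "\<lambda>i. P i x * h x ^ i" "n - j"]
      have "(\<Sum>i<n. P i x * h x ^ i) = (\<Sum>i<j. P i x * h x ^ i) + (\<Sum>i<n - j. P (i + j) x * h x ^ (i + j))"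
        using less.prems by simp
      moreover have "(\<Sum>i<n - j. P (i + j) x * h x ^ (i + j)) = h x ^ j * Q x"
        unfolding Q_def sum_distrib_left
        by (intro sum.cong refl) (simp only: power_add mult_ac)
      ultimately show ?thesis using rel'[OF that] by simp
    qed
    then have "(\<forall>x\<in>C. h x ^ j = 0) \<or> (\<forall>x\<in>C. Q x = 0)"
      by (intro prime polyfun_power pf polyQ) auto
    then have "\<forall>x\<in>C. Q x = 0" using h(2,3) by auto
    then have Q0: "\<forall>x\<in>C'. Q x = 0" by (rule sub[OF polyQ])
    have "P j x = 0" if "x \<in> C'" for x
    proof -
      have "Q x = (\<Sum>i<n - j. if i = 0 then P j x else 0)"
        unfolding Q_def using h(1)[OF that] by (intro sum.cong) auto
      then show ?thesis using Q0 that less.prems by simp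
    qed
    then have "(\<Sum>\<alpha>\<in>?A. c (\<alpha>(k := j)) * (\<Prod>i<k. g i x ^ \<alpha> i)) = 0" if "x \<in> C'" for x
      using that unfolding P_def by simp
    then show ?case
      using algindepD[OF ind, where n = n and c = "\<lambda>\<alpha>. c (\<alpha>(k := j))"] by blast
  qed
  show "\<forall>\<alpha>\<in>PiE {..<Suc k} (\<lambda>_. {..<n}). c \<alpha> = 0"
    unfolding lessThan_Suc PiE_insert_eq using zero by force
qed

lemma algindep_chain:
  fixes C :: "nat \<Rightarrow> ('k::field_char_0 ^ 'n::finite) set"
  assumes "\<And>i. i \<le> d \<Longrightarrow> irreducible_closed (C i)" "\<And>i. i < d \<Longrightarrow> C i \<subset> C (Suc i)"
  shows "\<exists>g. (\<forall>i. polyfun (g i)) \<and> algindep (C d) g (Suc d)"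
  using assms
proof (induction d)
  case 0
  have irr: "irreducible_closed (C 0)" using 0 by simp
  then have cl: "closedin zariski (C 0)" and "C 0 \<noteq> {}"
    by (auto simp: irreducible_closed_def)
  then obtain y where y: "y \<in> C 0" "y \<noteq> 0" using closedin_zariski_nonzero by blast
  then obtain i where i: "y $ i \<noteq> 0" by (auto simp: vec_eq_iff)
  \<comment> \<open>The origin plays the role of the predecessor of a point in the chain.\<close>
  have "algindep (C 0) ((\<lambda>_ _. 0)(0 := \<lambda>x. x $ i)) (Suc 0)"
  proof (rule algindep_extend[where C' = "{0}"])
    show "algindep {0 :: 'k ^ 'n} (\<lambda>_ _. 0) 0" by (simp add: algindep_def)
    fix Q :: "'k ^ 'n \<Rightarrow> 'k" assume Q: "polyfun Q" "\<forall>x\<in>C 0. Q x = 0"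
    obtain q where q: "\<And>t. Q (0 + t *s y) = poly q t" using polyfun_line[OF Q(1)] by blast
    have "poly q t = 0" if "t \<notin> {0}" for t
      using Q(2) closedin_zariski_scale[OF cl y(1), of t] that by (simp flip: q)
    then have "q = 0" by (intro poly_zero_cofinite[of "{0}"]) auto
    then show "\<forall>x\<in>{0}. Q x = 0" using q[of 0] by simp
  next
    fix P Q :: "'k ^ 'n \<Rightarrow> 'k" assume "polyfun P" "polyfun Q" "\<forall>x\<in>C 0. P x * Q x = 0"
    then show "(\<forall>x\<in>C 0. P x = 0) \<or> (\<forall>x\<in>C 0. Q x = 0)"
      using irreducible_closed_prime[OF irr] by blast
  qed (use y i in auto)
  moreover have "polyfun (((\<lambda>_ _. 0)(0 := \<lambda>x. x $ i)) j)" for j :: nat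
    by simp
  ultimately show ?case by blast
next
  case (Suc d)
  then obtain g where g: "\<forall>i. polyfun (g i)" "algindep (C d) g (Suc d)" by auto
  have irr: "irreducible_closed (C (Suc d))" using Suc.prems by simp
  obtain y where y: "y \<in> C (Suc d)" "y \<notin> C d" using Suc.prems(2)[of d] by auto
  have "closedin zariski (C d)" "closedin zariski (C (Suc d))"
    using Suc.prems(1)[of d] irr by (auto simp: irreducible_closed_def)
  then obtain e F where F: "form e F" "\<And>x. x \<in> C d \<Longrightarrow> peval F x = 0" "peval F y \<noteq> 0"
    using closedin_zariski_separate[of "C d" y] y closedin_zariski_nonzero by blast
  have "algindep (C (Suc d)) (g(Suc d := peval F)) (Suc (Suc d))"
  proof (rule algindep_extend[OF g(2)])
    fix Q :: "'k ^ 'n \<Rightarrow> 'k" assume Q: "polyfun Q" "\<forall>x\<in>C (Suc d). Q x = 0"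
    then show "\<forall>x\<in>C d. Q x = 0" using Suc.prems(2)[of d] by auto
  next
    fix P Q :: "'k ^ 'n \<Rightarrow> 'k" assume "polyfun P" "polyfun Q" "\<forall>x\<in>C (Suc d). P x * Q x = 0"
    then show "(\<forall>x\<in>C (Suc d). P x = 0) \<or> (\<forall>x\<in>C (Suc d). Q x = 0)"
      using irreducible_closed_prime[OF irr] by blast
  qed (use y F g in auto)
  moreover have "polyfun ((g(Suc d := peval F)) j)" for j
    using g(1) by simp
  ultimately show ?case by blast
qed

section \<open>More polynomials than parameters are algebraically dependent\<close>

global_interpretation fv: vector_space "\<lambda>(c::'k::field) (f::'s \<Rightarrow> 'k) s. c * f s"
  by unfold_locales (auto simp: fun_eq_iff algebra_simps)

lemma sum_fun_apply: "(\<Sum>x\<in>A. f x) s = (\<Sum>x\<in>A. f x s)"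
  by (induction A rule: infinite_finite_induct) auto

text \<open>The monomial with exponents \<open>\<beta>\<close> in the parameters \<open>s 0, \<dots>, s (r - 1)\<close>.\<close>

definition monf :: "nat \<Rightarrow> (nat \<Rightarrow> nat) \<Rightarrow> (nat \<Rightarrow> 'k::field) \<Rightarrow> 'k" where
  "monf r \<beta> s = (\<Prod>j<r. s j ^ \<beta> j)"

text \<open>Polynomial functions of the parameters \<open>s 0, \<dots>, s (r - 1)\<close> of degree at most \<open>e\<close> in each.\<close>

definition pspace :: "nat \<Rightarrow> nat \<Rightarrow> ((nat \<Rightarrow> 'k::field) \<Rightarrow> 'k) set" where
  "pspace r e = fv.span (monf r ` PiE {..<r} (\<lambda>_. {..e}))"

lemma monf_in_pspace: "(\<And>j. j < r \<Longrightarrow> \<beta> j \<le> e) \<Longrightarrow> monf r \<beta> \<in> pspace r e"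
proof -
  assume *: "\<And>j. j < r \<Longrightarrow> \<beta> j \<le> e"
  have "monf r \<beta> = (monf r (restrict \<beta> {..<r}) :: (nat \<Rightarrow> 'k::field) \<Rightarrow> 'k)"
    by (auto simp: monf_def fun_eq_iff intro!: prod.cong)
  moreover have "restrict \<beta> {..<r} \<in> PiE {..<r} (\<lambda>_. {..e})" using * by auto
  ultimately show ?thesis unfolding pspace_def by (metis fv.span_base imageI)
qed

lemma pspace_mono: "a \<le> b \<Longrightarrow> pspace r a \<subseteq> pspace r b"
  unfolding pspace_def by (intro fv.span_mono image_mono PiE_mono) auto

lemma pspace_add: "f \<in> pspace r e \<Longrightarrow> g \<in> pspace r e \<Longrightarrow> (\<lambda>s. f s + g s) \<in> pspace r e"
  using fv.span_add[of f _ g] unfolding pspace_def by (simp add: plus_fun_def)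

lemma pspace_scale: "f \<in> pspace r e \<Longrightarrow> (\<lambda>s. c * f s) \<in> pspace r e"
  unfolding pspace_def by (rule fv.span_scale)

lemma pspace_subspace: "fv.subspace (pspace r e)"
  unfolding pspace_def by simp

lemma pspace_zero: "(\<lambda>s. 0) \<in> pspace r e"
  using fv.subspace_0[OF pspace_subspace[of r e]] by (simp add: zero_fun_def)

lemma pspace_mult:
  fixes f g :: "(nat \<Rightarrow> 'k::field) \<Rightarrow> 'k"
  assumes f: "f \<in> pspace r a" and g: "g \<in> pspace r b"
  shows "(\<lambda>s. f s * g s) \<in> pspace r (a + b)"
proof -
  have mono: "(\<lambda>s. monf r \<beta> s * g s) \<in> pspace r (a + b)" if \<beta>: "\<beta> \<in> PiE {..<r} (\<lambda>_. {..a})" for \<beta>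
  proof -
    have sub: "fv.subspace {g :: (nat \<Rightarrow> 'k) \<Rightarrow> 'k. (\<lambda>s. monf r \<beta> s * g s) \<in> pspace r (a + b)}"
    proof (rule fv.subspaceI)
      show "0 \<in> {g. (\<lambda>s. monf r \<beta> s * g s) \<in> pspace r (a + b)}"
        using pspace_zero by simp
    next
      fix x y :: "(nat \<Rightarrow> 'k) \<Rightarrow> 'k" assume "x \<in> {g. (\<lambda>s. monf r \<beta> s * g s) \<in> pspace r (a + b)}"
        "y \<in> {g. (\<lambda>s. monf r \<beta> s * g s) \<in> pspace r (a + b)}"
      then have "(\<lambda>s. monf r \<beta> s * x s + monf r \<beta> s * y s) \<in> pspace r (a + b)"
        by (simp add: pspace_add)
      then show "x + y \<in> {g. (\<lambda>s. monf r \<beta> s * g s) \<in> pspace r (a + b)}"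
        by (simp add: distrib_left)
    next
      fix c and x :: "(nat \<Rightarrow> 'k) \<Rightarrow> 'k" assume "x \<in> {g. (\<lambda>s. monf r \<beta> s * g s) \<in> pspace r (a + b)}"
      then have "(\<lambda>s. c * (monf r \<beta> s * x s)) \<in> pspace r (a + b)"
        by (simp add: pspace_scale)
      then show "(\<lambda>s. c * x s) \<in> {g. (\<lambda>s. monf r \<beta> s * g s) \<in> pspace r (a + b)}"
        by (simp add: mult.left_commute)
    qed
    have "(\<lambda>s :: nat \<Rightarrow> 'k. monf r \<beta> s * monf r \<gamma> s) \<in> pspace r (a + b)" if "\<gamma> \<in> PiE {..<r} (\<lambda>_. {..b})" for \<gamma>
    proof -
      have "(monf r (\<lambda>j. \<beta> j + \<gamma> j) :: (nat \<Rightarrow> 'k) \<Rightarrow> 'k) \<in> pspace r (a + b)"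
        using \<beta> that by (intro monf_in_pspace add_mono) (auto simp: PiE_iff)
      then show ?thesis
        unfolding monf_def by (simp add: power_add prod.distrib)
    qed
    then have "pspace r b \<subseteq> {g :: (nat \<Rightarrow> 'k) \<Rightarrow> 'k. (\<lambda>s. monf r \<beta> s * g s) \<in> pspace r (a + b)}"
      unfolding pspace_def[of r b] by (intro fv.span_minimal sub) auto
    then show ?thesis using g by blast
  qed
  have sub: "fv.subspace {f :: (nat \<Rightarrow> 'k) \<Rightarrow> 'k. (\<lambda>s. f s * g s) \<in> pspace r (a + b)}"
  proof (rule fv.subspaceI)
    show "0 \<in> {f. (\<lambda>s. f s * g s) \<in> pspace r (a + b)}"
      using pspace_zero by simp
  next
    fix x y :: "(nat \<Rightarrow> 'k) \<Rightarrow> 'k" assume "x \<in> {f. (\<lambda>s. f s * g s) \<in> pspace r (a + b)}"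
      "y \<in> {f. (\<lambda>s. f s * g s) \<in> pspace r (a + b)}"
    then have "(\<lambda>s. x s * g s + y s * g s) \<in> pspace r (a + b)"
      by (simp add: pspace_add)
    then show "x + y \<in> {f. (\<lambda>s. f s * g s) \<in> pspace r (a + b)}"
      by (simp add: distrib_right)
  next
    fix c and x :: "(nat \<Rightarrow> 'k) \<Rightarrow> 'k" assume "x \<in> {f. (\<lambda>s. f s * g s) \<in> pspace r (a + b)}"
    then have "(\<lambda>s. c * (x s * g s)) \<in> pspace r (a + b)"
      by (simp add: pspace_scale)
    then show "(\<lambda>s. c * x s) \<in> {f. (\<lambda>s. f s * g s) \<in> pspace r (a + b)}"
      by (simp add: mult.assoc)
  qed
  have "pspace r a \<subseteq> {f :: (nat \<Rightarrow> 'k) \<Rightarrow> 'k. (\<lambda>s. f s * g s) \<in> pspace r (a + b)}"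
    unfolding pspace_def[of r a] using mono by (intro fv.span_minimal sub) auto
  then show ?thesis using f by blast
qed

lemma pspace_const: "(\<lambda>s. c) \<in> pspace r e"
proof -
  have "monf r (\<lambda>_. 0) \<in> pspace r e" by (rule monf_in_pspace) simp
  then have "(\<lambda>s. c * monf r (\<lambda>_. 0) s) \<in> pspace r e" by (rule pspace_scale)
  then show ?thesis by (simp add: monf_def)
qed

lemma pspace_power: "f \<in> pspace r e \<Longrightarrow> (\<lambda>s. f s ^ n) \<in> pspace r (n * e)"
proof (induction n)
  case 0
  then show ?case by (simp add: pspace_const)
next
  case (Suc n)
  from pspace_mult[OF Suc(2) Suc(1)[OF Suc(2)]] show ?case by simp
qed

lemma pspace_prod:
  assumes "\<And>i. i < k \<Longrightarrow> f i \<in> pspace r e" shows "(\<lambda>s. \<Prod>i<k. f i s) \<in> pspace r (k * e)"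
  using assms
proof (induction k)
  case (Suc k)
  then have "(\<lambda>s. (\<Prod>i<k. f i s) * f k s) \<in> pspace r (k * e + e)"
    by (intro pspace_mult) auto
  then show ?case by (simp add: add.commute)
qed (simp add: pspace_const)

lemma pspace_sum:
  assumes "\<And>i. i \<in> A \<Longrightarrow> f i \<in> pspace r e" shows "(\<lambda>s. \<Sum>i\<in>A. f i s) \<in> pspace r e"
  using assms
proof (induction A rule: infinite_finite_induct)
  case (insert i A)
  then have "(\<lambda>s. f i s + (\<Sum>i\<in>A. f i s)) \<in> pspace r e"
    by (intro pspace_add) auto
  then show ?case using insert by simp
qed (simp_all add: pspace_const)

lemma polyfun_in_pspace:
  fixes b :: "nat \<Rightarrow> 'k::field ^ 'n::finite"
  assumes "polyfun g" shows "\<exists>e. (\<lambda>s. g (\<Sum>j<r. s j *s b j)) \<in> pspace r e"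
proof -
  obtain F where F: "g = peval F" using assms unfolding polyfun_def by auto
  have var: "(\<lambda>s :: nat \<Rightarrow> 'k. s j) \<in> pspace r (Suc 0)" if "j < r" for j
  proof -
    have "(monf r (\<lambda>i. if i = j then 1 else 0) :: (nat \<Rightarrow> 'k) \<Rightarrow> 'k) \<in> pspace r (Suc 0)" by (rule monf_in_pspace) simp
    moreover have "monf r (\<lambda>i. if i = j then 1 else 0) = (\<lambda>s :: nat \<Rightarrow> 'k. s j)"
      using that by (auto simp: monf_def fun_eq_iff if_distrib[of "\<lambda>e. _ ^ e"] prod.delta cong: if_cong)
    ultimately show ?thesis by simp
  qed
  have lin: "(\<lambda>s. (\<Sum>j<r. s j *s b j) $ i) \<in> pspace r (Suc 0)" for i
  proof -
    have "(\<lambda>s. \<Sum>j<r. b j $ i * s j) \<in> pspace r (Suc 0)"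
      by (intro pspace_sum pspace_scale var) auto
    then show ?thesis by (simp add: mult.commute)
  qed
  have mon: "\<exists>e. (\<lambda>s. mon_eval m (\<Sum>j<r. s j *s b j)) \<in> pspace r e" for m
  proof -
    have "\<exists>e. (\<lambda>s. \<Prod>i\<in>I. ((\<Sum>j<r. s j *s b j) $ i) ^ Poly_Mapping.lookup m i) \<in> pspace r e" for I
    proof (induction I rule: infinite_finite_induct)
      case (insert i I)
      then obtain e where "(\<lambda>s. \<Prod>i\<in>I. ((\<Sum>j<r. s j *s b j) $ i) ^ Poly_Mapping.lookup m i) \<in> pspace r e" by auto
      from pspace_mult[OF pspace_power[OF lin[of i], of "Poly_Mapping.lookup m i"] this]
      show ?case using insert by auto
    qed (auto intro: pspace_const)
    then show ?thesis unfolding mon_eval_def .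
  qed
  have "\<exists>e. (\<lambda>s. \<Sum>m\<in>M. Poly_Mapping.lookup F m * mon_eval m (\<Sum>j<r. s j *s b j)) \<in> pspace r e" for M
  proof (induction M rule: infinite_finite_induct)
    case (insert m M)
    then obtain e where e: "(\<lambda>s. \<Sum>m\<in>M. Poly_Mapping.lookup F m * mon_eval m (\<Sum>j<r. s j *s b j)) \<in> pspace r e" by auto
    obtain e' where e': "(\<lambda>s. mon_eval m (\<Sum>j<r. s j *s b j)) \<in> pspace r e'" using mon by auto
    have "(\<lambda>s. Poly_Mapping.lookup F m * mon_eval m (\<Sum>j<r. s j *s b j)
       + (\<Sum>m\<in>M. Poly_Mapping.lookup F m * mon_eval m (\<Sum>j<r. s j *s b j))) \<in> pspace r (max e e')"
      using e e' pspace_mono[of e "max e e'" r] pspace_mono[of e' "max e e'" r]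
      by (intro pspace_add pspace_scale) auto
    then show ?case using insert by auto
  qed (auto intro: pspace_const)
  then show ?thesis unfolding F peval_def .
qed

text \<open>Counting: the $n^{r+1}$ monomials with exponents below \<open>n\<close> in the functions \<open>G i\<close> lie in a space
  of dimension $O(n^r)$.\<close>

lemma not_algindep_pspace:
  fixes G :: "nat \<Rightarrow> (nat \<Rightarrow> 'k::field) \<Rightarrow> 'k"
  assumes "\<And>i. i < k \<Longrightarrow> G i \<in> pspace r e" "r < k"
  shows "\<not> algindep UNIV G k"
proof
  assume ind: "algindep UNIV G k"
  define n where "n = (k * e + 1) ^ r + 1"
  let ?A = "PiE {..<k} (\<lambda>_. {..<n})" and ?B = "PiE {..<r} (\<lambda>_. {..k * (n * e)})"
  define \<phi> where "\<phi> \<alpha> s = (\<Prod>i<k. G i s ^ \<alpha> i)" for \<alpha> s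
  have fin: "finite ?A" "finite ?B" by (auto intro: finite_PiE)
  have zero: "\<forall>\<alpha>\<in>?A. c \<alpha> = 0" if "\<And>s. (\<Sum>\<alpha>\<in>?A. c \<alpha> * \<phi> \<alpha> s) = 0" for c
    using algindepD[OF ind, where n = n and c = c] that unfolding \<phi>_def by simp
  have in_span: "\<phi> \<alpha> \<in> fv.span (monf r ` ?B)" if "\<alpha> \<in> ?A" for \<alpha>
  proof -
    have "(\<lambda>s. G i s ^ \<alpha> i) \<in> pspace r (n * e)" if "i < k" for i
    proof -
      have "\<alpha> i \<le> n" using that \<open>\<alpha> \<in> ?A\<close> by (auto simp: PiE_iff intro: less_imp_le)
      then show ?thesis
        using pspace_power[OF assms(1)[OF that], of "\<alpha> i"] pspace_mono[of "\<alpha> i * e" "n * e" r] by auto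
    qed
    from pspace_prod[OF this] show ?thesis
      unfolding pspace_def \<phi>_def by auto
  qed
  have inj: "inj_on \<phi> ?A"
  proof (rule inj_onI, rule ccontr)
    fix \<alpha> \<beta> assume *: "\<alpha> \<in> ?A" "\<beta> \<in> ?A" "\<phi> \<alpha> = \<phi> \<beta>" "\<alpha> \<noteq> \<beta>"
    let ?c = "\<lambda>\<gamma>. (if \<gamma> = \<alpha> then 1 else 0) - (if \<gamma> = \<beta> then 1 else 0 :: 'k)"
    have "(\<Sum>\<gamma>\<in>?A. ?c \<gamma> * \<phi> \<gamma> s) = \<phi> \<alpha> s - \<phi> \<beta> s" for s
      using * fin by (simp add: left_diff_distrib sum_subtractf if_distrib[of "\<lambda>x. x * _"] sum.delta cong: if_cong)
    then have "\<forall>\<gamma>\<in>?A. ?c \<gamma> = 0" using *(3) by (intro zero) simp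
    then show False using * by auto
  qed
  have indep: "fv.independent (\<phi> ` ?A)"
  proof
    assume "fv.dependent (\<phi> ` ?A)"
    then obtain c x where x: "x \<in> \<phi> ` ?A" "c x \<noteq> 0"
      and *: "(\<Sum>x\<in>\<phi> ` ?A. (\<lambda>s. c x * x s)) = 0"
      using fv.dependent_finite[OF finite_imageI[OF fin(1), of \<phi>]] by auto
    have "(\<Sum>\<alpha>\<in>?A. c (\<phi> \<alpha>) * \<phi> \<alpha> s) = 0" for s
    proof -
      have "(\<Sum>\<alpha>\<in>?A. c (\<phi> \<alpha>) * \<phi> \<alpha> s) = (\<Sum>x\<in>\<phi> ` ?A. (\<lambda>s. c x * x s)) s"
        by (simp add: sum.reindex[OF inj] sum_fun_apply)
      then show ?thesis using * by simp
    qed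
    from zero[of "\<lambda>\<alpha>. c (\<phi> \<alpha>)", OF this] show False using x by blast
  qed
  have finB: "finite (monf r ` ?B :: ((nat \<Rightarrow> 'k) \<Rightarrow> 'k) set)"
    using fin(2) by (rule finite_imageI)
  have "\<phi> ` ?A \<subseteq> fv.span (monf r ` ?B)"
    by (rule image_subsetI) (rule in_span)
  then have "card (\<phi> ` ?A) \<le> card (monf r ` ?B :: ((nat \<Rightarrow> 'k) \<Rightarrow> 'k) set)"
    by (rule fv.independent_span_bound[OF finB indep, THEN conjunct2])
  also have "\<dots> \<le> card ?B" using fin(2) by (rule card_image_le)
  also have "\<dots> = (k * (n * e) + 1) ^ r" by (simp add: card_PiE)
  also have "\<dots> \<le> (n * (k * e + 1)) ^ r"
    by (intro power_mono) (auto simp: n_def algebra_simps)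
  also have "\<dots> = n ^ r * (k * e + 1) ^ r" by (rule power_mult_distrib)
  also have "\<dots> < n ^ r * n"
  proof (rule mult_strict_left_mono)
    show "(k * e + 1) ^ r < n" "0 < n ^ r" unfolding n_def by auto
  qed
  also have "\<dots> \<le> n ^ k"
    using assms(2) power_increasing[of "Suc r" k n] by (simp add: n_def mult.commute)
  finally show False
    using inj by (simp add: card_image card_PiE)
qed

text \<open>A set in which the image of a linear space with \<open>r\<close> parameters is dense has projective dimension
  at most \<open>r - 1\<close>.\<close>

lemma zdim_le_parameters:
  fixes Z :: "('k::field_char_0 ^ 'n::finite) set" and b :: "nat \<Rightarrow> 'k ^ 'm::finite"
  assumes "polymap h" "0 < r"
    and dense: "\<And>Q. polyfun Q \<Longrightarrow> (\<And>s. Q (h (\<Sum>j<r. s j *s b j)) = 0) \<Longrightarrow> \<forall>z\<in>Z. Q z = 0"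
  shows "zdim Z + 1 \<le> enat r"
proof -
  have "zdim Z \<le> enat (r - 1)"
  proof (rule zdim_le)
    fix d and C :: "nat \<Rightarrow> ('k ^ 'n) set"
    assume C: "\<And>i. i \<le> d \<Longrightarrow> irreducible_closed (C i) \<and> C i \<subseteq> Z"
      "\<And>i. i < d \<Longrightarrow> C i \<subset> C (Suc i)"
    then obtain g where g: "\<forall>i. polyfun (g i)" "algindep (C d) g (Suc d)"
      using algindep_chain[of d C] by blast
    define G where "G i s = g i (h (\<Sum>j<r. s j *s b j))" for i s
    have "algindep UNIV G (Suc d)"
      unfolding algindep_def
    proof (intro allI impI)
      fix n :: nat and c :: "(nat \<Rightarrow> nat) \<Rightarrow> 'k"
      let ?A = "PiE {..<Suc d} (\<lambda>_. {..<n})"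
      define Q where "Q z = (\<Sum>\<alpha>\<in>?A. c \<alpha> * (\<Prod>i<Suc d. g i z ^ \<alpha> i))" for z
      assume "\<forall>s\<in>UNIV. (\<Sum>\<alpha>\<in>?A. c \<alpha> * (\<Prod>i<Suc d. G i s ^ \<alpha> i)) = 0"
      then have "Q (h (\<Sum>j<r. s j *s b j)) = 0" for s by (simp add: Q_def G_def)
      moreover have "polyfun Q"
        unfolding Q_def using g(1) by (intro polyfun_sum polyfun_mult polyfun_const polyfun_prod polyfun_power) auto
      ultimately have "\<forall>z\<in>Z. Q z = 0" using dense by blast
      then have "\<forall>z\<in>C d. Q z = 0" using C(1)[of d] by auto
      then show "\<forall>\<alpha>\<in>?A. c \<alpha> = 0"
        using algindepD[OF g(2), where n = n and c = c] unfolding Q_def by simp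
    qed
    moreover have "\<exists>e. \<forall>i<Suc d. G i \<in> pspace r e"
    proof -
      have "\<forall>i. \<exists>e. G i \<in> pspace r e"
        unfolding G_def using polyfun_in_pspace[OF polyfun_compose[OF _ assms(1)]] g(1) by blast
      then obtain e where e: "\<And>i. G i \<in> pspace r (e i)" by metis
      have "G i \<in> pspace r (\<Sum>i<Suc d. e i)" if "i < Suc d" for i
        using e[of i] pspace_mono[of "e i" "\<Sum>i<Suc d. e i" r] that member_le_sum[of i "{..<Suc d}" e] by auto
      then show ?thesis by blast
    qed
    ultimately have "Suc d \<le> r"
      using not_algindep_pspace[of "Suc d" G r] by (meson not_le)
    then show "enat d \<le> enat (r - 1)" by simp
  qed
  then have "zdim Z + 1 \<le> enat (r - 1) + 1" by (rule add_right_mono)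
  also have "\<dots> = enat r" using assms(2) by (simp add: one_enat_def)
  finally show ?thesis .
qed


section \<open>Linear algebra\<close>

text \<open>The standard bilinear form.\<close>

definition dotp :: "'k::comm_ring_1 ^ 'n::finite \<Rightarrow> 'k ^ 'n \<Rightarrow> 'k" where
  "dotp a b = (\<Sum>i\<in>UNIV. a $ i * b $ i)"

lemma dotp_commute: "dotp a b = dotp b a"
  by (simp add: dotp_def mult.commute)

lemma dotp_add_left: "dotp (a + b) c = dotp a c + dotp b c"
  by (simp add: dotp_def distrib_right sum.distrib)

lemma dotp_add_right: "dotp a (b + c) = dotp a b + dotp a c"
  by (simp add: dotp_def distrib_left sum.distrib)

lemma dotp_scale_left: "dotp (t *s a) b = t * dotp a b"
  by (simp add: dotp_def sum_distrib_left mult.assoc)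

lemma dotp_scale_right: "dotp a (t *s b) = t * dotp a b"
  by (simp add: dotp_def sum_distrib_left mult.left_commute)

lemma dotp_minus_right: "dotp a (- b) = - dotp a b"
  by (simp add: dotp_def sum_negf)

lemma dotp_diff_right: "dotp a (b - c) = dotp a b - dotp a c"
  by (simp add: dotp_def right_diff_distrib sum_subtractf)

lemma dotp_diff_left: "dotp (a - b) c = dotp a c - dotp b c"
  by (simp add: dotp_def left_diff_distrib sum_subtractf)

lemma dotp_zero [simp]: "dotp 0 a = 0" "dotp a 0 = 0"
  by (simp_all add: dotp_def)

lemmas dotp_simps = dotp_add_left dotp_add_right dotp_scale_left dotp_scale_right dotp_diff_left dotp_diff_right dotp_minus_right

lemma dotp_axis: "dotp a (axis i 1) = a $ i"
  by (simp add: dotp_def axis_def if_distrib[of "\<lambda>x. _ * x"] cong: if_cong)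

lemma dotp_eq_0D: "(\<And>y. dotp a y = 0) \<Longrightarrow> a = 0"
  by (metis dotp_axis vec_eq_iff zero_index)

lemma dotp_parallel:
  fixes v w :: "'k::field ^ 'n::finite"
  assumes "v \<noteq> 0" "\<And>y. dotp v y = 0 \<Longrightarrow> dotp w y = 0"
  shows "\<exists>c. w = c *s v"
proof -
  obtain y where y: "dotp v y \<noteq> 0" using assms(1) dotp_eq_0D by blast
  have "w - (dotp w y / dotp v y) *s v = 0"
  proof (rule dotp_eq_0D)
    fix z
    have "dotp v (z - (dotp v z / dotp v y) *s y) = 0" using y by (simp add: dotp_simps)
    then have "dotp w (z - (dotp v z / dotp v y) *s y) = 0" by (rule assms(2))
    then show "dotp (w - (dotp w y / dotp v y) *s v) z = 0" by (simp add: dotp_simps)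
  qed
  then show ?thesis by auto
qed

lemma dotp_symmetric_matrix:
  fixes A :: "'k::comm_ring_1 ^ 'n::finite ^ 'n"
  assumes "\<And>i j. A $ i $ j = A $ j $ i"
  shows "dotp (A *v x) y = dotp (A *v y) x"
proof -
  have "dotp (A *v x) y = (\<Sum>i\<in>UNIV. \<Sum>j\<in>UNIV. A $ i $ j * x $ j * y $ i)"
    by (simp add: dotp_def matrix_vector_mult_def sum_distrib_right)
  also have "\<dots> = (\<Sum>i\<in>UNIV. \<Sum>j\<in>UNIV. A $ i $ j * x $ i * y $ j)"
    by (subst sum.swap) (simp add: assms mult.assoc)
  also have "\<dots> = dotp (A *v y) x"
    unfolding dotp_def matrix_vector_mult_def vec_lambda_beta sum_distrib_right
    by (intro sum.cong refl) (simp only: mult.assoc mult.commute[of "x $ _"])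
  finally show ?thesis .
qed

lemma polyfun_dotp: "polymap g \<Longrightarrow> polyfun (\<lambda>x. dotp a (g x))"
  unfolding dotp_def polymap_def by (intro polyfun_sum polyfun_mult) auto

text \<open>The rank of a matrix, as the dimension of its image.\<close>

definition mrank :: "'k::field ^ 'n ^ 'm::finite \<Rightarrow> nat" where
  "mrank A = vec.dim (range ((*v) A))"

text \<open>A linear right inverse on the image.\<close>

lemma section_of_range:
  fixes A :: "'k::field ^ 'n::finite ^ 'm::finite"
  obtains L :: "'k ^ 'm \<Rightarrow> 'k ^ 'n" where "Vector_Spaces.linear (*s) (*s) L" "\<And>y. y \<in> range ((*v) A) \<Longrightarrow> A *v L y = y"
proof -
  obtain C where C: "C \<subseteq> range ((*v) A)" "vec.independent C" "range ((*v) A) \<subseteq> vec.span C"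
    by (rule vec.basis_exists[of "range ((*v) A)"])
  have "\<forall>c\<in>C. \<exists>x. A *v x = c" using C(1) by blast
  from bchoice[OF this] obtain g where g: "\<forall>c\<in>C. A *v g c = c" by blast
  obtain L where L: "Vector_Spaces.linear (*s) (*s) L" "\<forall>c\<in>C. L c = g c"
    using vec.linear_independent_extend[OF C(2), of g] by blast
  have lin: "Vector_Spaces.linear (*s) (*s) (\<lambda>y. A *v L y)"
    using Vector_Spaces.linear_compose[OF L(1) matrix_vector_mul_linear_gen[of A]] by (simp add: o_def)
  have "A *v L y = y" if "y \<in> range ((*v) A)" for y
    using vec.linear_eq_on[OF lin vec.linear_ident, of y C] that C(3) L(2) g by (simp add: subset_iff)
  with L(1) show thesis by (rule that)
qed

lemma subspace_kernel: "vec.subspace {x. (A :: 'k::field ^ 'n::finite ^ 'm::finite) *v x = 0}"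
  by (auto simp: vec.subspace_def matrix_vector_right_distrib vector_scalar_commute)

lemma subspace_range: "vec.subspace (range ((*v) (A :: 'k::field ^ 'n::finite ^ 'm::finite)))"
  by (rule vec.linear_subspace_image[OF matrix_vector_mul_linear_gen vec.subspace_UNIV])

lemma span_range: "vec.span (range ((*v) A)) = range ((*v) (A :: 'k::field ^ 'n::finite ^ 'm::finite))"
  using subspace_range[of A] by (simp only: vec.span_eq_iff)

lemma rank_nullity:
  fixes A :: "'k::field ^ 'n::finite ^ 'm::finite"
  shows "vec.dim {x. A *v x = 0} + mrank A = CARD('n)"
proof -
  let ?K = "{x. A *v x = 0}" and ?R = "range ((*v) A)"
  obtain L where L: "Vector_Spaces.linear (*s) (*s) L" "\<And>y. y \<in> ?R \<Longrightarrow> A *v L y = y"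
    using section_of_range by blast
  interpret L: Vector_Spaces.linear "(*s)" "(*s)" L by (rule L(1))
  let ?S = "L ` ?R"
  have subS: "vec.subspace ?S"
    using vec.linear_subspace_image[OF L(1) subspace_range] .
  have "x \<in> {x + y |x y. x \<in> ?K \<and> y \<in> ?S}" for x
  proof -
    have "A *v (x - L (A *v x)) = 0" using L(2) by (simp add: matrix_vector_mult_diff_distrib)
    then show ?thesis by (intro CollectI exI[of _ "x - L (A *v x)"] exI[of _ "L (A *v x)"]) auto
  qed
  then have sum: "{x + y |x y. x \<in> ?K \<and> y \<in> ?S} = UNIV" by blast
  have "x = 0" if "x \<in> ?K \<inter> ?S" for x
    using that L(2) L.zero by auto
  then have int: "vec.dim (?K \<inter> ?S) = 0" by auto
  have inj: "inj_on L ?R" using L(2) by (metis inj_onI)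
  have "vec.dim ?S = vec.dim ?R"
    using vec.dim_image_eq[OF L(1), of ?R] inj span_range[of A] by simp
  then show ?thesis
    using vec.dim_sums_Int[OF subspace_kernel[of A] subS] sum int
    by (simp only: vec_dim_card mrank_def)
qed

text \<open>A square matrix can be made invertible by adding a matrix of complementary rank.\<close>

lemma border_exists:
  fixes A :: "'k::field ^ 'n::finite ^ 'n"
  obtains B where "det (A + B) \<noteq> 0" "mrank A + mrank B \<le> CARD('n)"
proof -
  let ?R = "range ((*v) A)"
  obtain L where L: "Vector_Spaces.linear (*s) (*s) L" "\<And>y. y \<in> ?R \<Longrightarrow> A *v L y = y"
    using section_of_range by blast
  have subS: "vec.subspace (L ` ?R)"
    using vec.linear_subspace_image[OF L(1) subspace_range] .
  obtain E where E: "E \<subseteq> L ` ?R" "vec.independent E" "L ` ?R \<subseteq> vec.span E" "card E = vec.dim (L ` ?R)"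
    by (rule vec.basis_exists)
  have inj: "inj_on L ?R" using L(2) by (metis inj_onI)
  have dimS: "vec.dim (L ` ?R) = mrank A"
    using vec.dim_image_eq[OF L(1), of ?R] inj span_range[of A] by (simp add: mrank_def)
  have spanE: "vec.span E = L ` ?R"
    using E subS by (simp add: subset_antisym vec.span_minimal)
  have injA: "inj_on ((*v) A) (L ` ?R)" using L(2) by (auto intro!: inj_onI)
  have indA: "vec.independent ((*v) A ` E)"
    using vec.independent_inj_on_image[OF E(2)] injA spanE by simp
  obtain g where g: "Vector_Spaces.linear (*s) (*s) g" "inj g" "\<And>x. x \<in> E \<Longrightarrow> g x = A *v x"
    using vec.linear_independent_extend_inj[OF E(2) indA] inj_on_subset[OF injA E(1)] by auto
  define B where "B = matrix g - A"
  have mg: "matrix g *v x = g x" for x using matrix_works[OF g(1)] .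
  have "inj ((*v) (matrix g))" using g(2) by (simp add: mg[abs_def])
  then have "det (matrix g) \<noteq> 0"
    using matrix_left_invertible_injective invertible_left_inverse invertible_det_nz by blast
  then have 1: "det (A + B) \<noteq> 0" by (simp add: B_def)
  have "E \<subseteq> {x. B *v x = 0}"
    using g(3) by (auto simp: B_def mg matrix_vector_mult_diff_rdistrib)
  then have "card E \<le> vec.dim {x. B *v x = 0}"
    using E(2) by (rule vec.independent_card_le_dim)
  then have 2: "mrank A + mrank B \<le> CARD('n)"
    using rank_nullity[of B] E(4) dimS by simp
  from 1 2 show thesis by (rule that)
qed

text \<open>If the ranks of \<open>A\<close> and \<open>B\<close> add up to at most the size of an invertible \<open>A + B\<close>, then the images of
  \<open>A\<close> and \<open>B\<close> are complementary.\<close>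

lemma invertible_sum_ranges:
  fixes A B :: "'k::field ^ 'n::finite ^ 'n"
  assumes "det (A + B) \<noteq> 0" "mrank A + mrank B \<le> CARD('n)"
  shows "mrank A + mrank B = CARD('n)" "A *v x = B *v y \<Longrightarrow> A *v x = 0"
proof -
  let ?RA = "range ((*v) A)" and ?RB = "range ((*v) B)"
  have "y \<in> {x + y |x y. x \<in> ?RA \<and> y \<in> ?RB}" for y
  proof -
    obtain C where "(A + B) ** C = mat 1"
      using assms(1) invertible_det_nz invertible_def by blast
    then have "A *v (C *v y) + B *v (C *v y) = y"
      by (metis matrix_vector_mul_assoc matrix_vector_mul_lid matrix_vector_mult_add_rdistrib)
    then show ?thesis by (metis (mono_tags, lifting) mem_Collect_eq rangeI)
  qed
  then have "{x + y |x y. x \<in> ?RA \<and> y \<in> ?RB} = UNIV" by blast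
  then have *: "CARD('n) + vec.dim (?RA \<inter> ?RB) = mrank A + mrank B"
    using vec.dim_sums_Int[OF subspace_range[of A] subspace_range[of B]]
    by (simp only: vec_dim_card mrank_def)
  then show "mrank A + mrank B = CARD('n)" using assms(2) by simp
  have "vec.dim (?RA \<inter> ?RB) = 0" using * assms(2) by linarith
  then have "?RA \<inter> ?RB \<subseteq> {0}" by (rule vec.dim_eq_0[THEN iffD1])
  moreover have "A *v x \<in> ?RA \<inter> ?RB" if "A *v x = B *v y" using that by (metis IntI rangeI)
  ultimately show "A *v x = B *v y \<Longrightarrow> A *v x = 0" by blast
qed

section \<open>Cubic forms through their hessian\<close>

text \<open>A cubic form is encoded by its hessian matrix \<open>H x\<close>, whose entries are linear in \<open>x\<close>. The
  form \<open>dotp (H x *v y) z\<close> is trilinear and symmetric.\<close>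

locale cubic_hessian =
  fixes H :: "'k::field_char_0 ^ 'n::finite \<Rightarrow> 'k ^ 'n ^ 'n"
  assumes H_add: "H (x + y) = H x + H y"
    and H_scale: "H (t *s x) = (\<chi> i j. t * H x $ i $ j)"
    and H_sym: "H x $ i $ j = H x $ j $ i"
    and H_swap: "H x *v y = H y *v x"
    and H_nondegenerate: "H x = 0 \<Longrightarrow> x = 0"
begin

lemma H_scale_v: "H (t *s x) *v y = t *s (H x *v y)"
  by (subst (1 2) H_swap) (simp add: vector_scalar_commute)

lemma H_zero [simp]: "H 0 = 0"
  using H_add[of 0 0] by simp

lemma H_add_v: "H (x + y) *v z = H x *v z + H y *v z"
  by (simp add: H_add matrix_vector_mult_add_rdistrib)

lemma H_minus_v: "H (- x) *v y = - (H x *v y)"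
  using H_scale_v[of "-1" x y] by simp

lemma H_diff_v: "H (x - y) *v z = H x *v z - H y *v z"
  using H_add_v[of x "- y" z] by (simp add: H_minus_v)

lemma H_eq_0_iff: "(\<forall>y. H x *v y = 0) \<longleftrightarrow> x = 0"
  by (metis H_nondegenerate H_zero matrix_eq matrix_vector_mult_0)

lemma T_sym: "dotp (H x *v y) z = dotp (H x *v z) y" "dotp (H x *v y) z = dotp (H y *v x) z"
  by (simp_all add: dotp_symmetric_matrix[OF H_sym] H_swap)

lemma polymap_H: "polyfun (\<lambda>x. H x $ i $ j)"
proof -
  have "H x $ i $ j = (\<Sum>k\<in>UNIV. H (axis j 1) $ i $ k * x $ k)" for x
  proof -
    have "H x $ i $ j = (H x *v axis j 1) $ i"
      by (simp add: matrix_vector_mult_def axis_def if_distrib[of "\<lambda>x. _ * x"] cong: if_cong)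
    also have "\<dots> = (H (axis j 1) *v x) $ i" by (simp add: H_swap)
    finally show ?thesis by (simp add: matrix_vector_mult_def)
  qed
  then show ?thesis by (simp add: polyfun_sum polyfun_mult)
qed

lemma polymap_Hv:
  assumes "polymap g" "polymap h" shows "polymap (\<lambda>x. H (g x) *v h x)"
  unfolding polymap_def matrix_vector_mult_def
  using assms by (auto simp: polymap_def intro!: polyfun_sum polyfun_mult polyfun_compose[OF polymap_H])

text \<open>The maximal rank of \<open>H x\<close>, attained on a nonempty open set.\<close>

definition generic_rank :: nat where
  "generic_rank = Max (range (\<lambda>x. mrank (H x)))"

lemma mrank_le: "mrank (A :: 'k ^ 'n ^ 'n) \<le> CARD('n)"
  using rank_nullity[of A] by simp

lemma finite_ranks: "finite (range (\<lambda>x. mrank (H x)))"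
  by (rule finite_subset[of _ "{..CARD('n)}"]) (auto simp: mrank_le)

lemma generic_rank_max: "mrank (H x) \<le> generic_rank"
  unfolding generic_rank_def using finite_ranks by (intro Max_ge) auto

lemma generic_rank_attained: obtains p where "mrank (H p) = generic_rank"
  using Max_in[OF finite_ranks] unfolding generic_rank_def by auto

lemma generic_rank_pos: "0 < generic_rank"
proof (rule ccontr)
  assume "\<not> 0 < generic_rank"
  then have "mrank (H x) = 0" for x using generic_rank_max[of x] by simp
  then have "H x *v y = 0" for x y
    unfolding mrank_def by (simp add: image_subset_iff)
  then have "x = 0" for x :: "'k ^ 'n" using H_eq_0_iff by blast
  from this[of "axis undefined 1"] show False by (simp add: axis_eq_0_iff)
qed

end

text \<open>The case of vanishing hessian: every matrix \<open>H x\<close> is singular.\<close>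

locale singular_cubic_hessian = cubic_hessian H for H :: "'k::field_char_0 ^ 'n::finite \<Rightarrow> 'k ^ 'n ^ 'n" +
  assumes det_H: "det (H x) = 0"
begin

lemma kernel_nonzero: obtains v where "v \<noteq> 0" "H x *v v = 0"
proof -
  have "\<not> inj ((*v) (H x))"
    using det_H[of x] matrix_left_invertible_injective invertible_left_inverse invertible_det_nz by metis
  then obtain a b where "a \<noteq> b" "H x *v a = H x *v b" by (auto simp: inj_def)
  then show thesis using that[of "a - b"] by (simp add: matrix_vector_mult_diff_distrib)
qed

lemma generic_rank_less: "generic_rank < CARD('n)"
proof -
  obtain p where p: "mrank (H p) = generic_rank" using generic_rank_attained by blast
  obtain v where "v \<noteq> 0" "H p *v v = 0" using kernel_nonzero by blast
  then have "\<not> {x. H p *v x = 0} \<subseteq> {0}" by blast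
  then have "vec.dim {x. H p *v x = 0} \<noteq> 0" by (simp only: vec.dim_eq_0 not_False_eq_True)
  then show ?thesis using rank_nullity[of "H p"] unfolding p by linarith
qed

text \<open>Near a point \<open>p\<close> of maximal rank the kernel of \<open>H x\<close> depends polynomially on \<open>x\<close>: with the linear
  form \<open>l\<close> and the matrix \<open>B\<close> completing \<open>H p\<close> to an invertible matrix, \<open>N x = H x + l x B\<close> is
  invertible for general \<open>x\<close>. The images of \<open>H x\<close> and \<open>B\<close> are then complementary, so Cramer's rule for
  \<open>N x u = l x B w\<close> solves \<open>H x u = 0\<close>, \<open>B u = B w\<close>.\<close>

lemma kernel_parametrization:
  assumes p: "mrank (H p) = generic_rank"
  obtains D B where "polyfun D" "\<And>t x. D (t *s x) = t ^ CARD('n) * D x" "D p \<noteq> 0"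
    "\<And>x. D x \<noteq> 0 \<Longrightarrow> mrank (H x) = generic_rank"
    "mrank (B :: 'k ^ 'n ^ 'n) = CARD('n) - generic_rank"
    "\<And>w. \<exists>\<psi>. polymap \<psi> \<and> (\<forall>x. H x *v \<psi> x = 0) \<and> (\<forall>x. D x \<noteq> 0 \<longrightarrow> B *v \<psi> x = D x *s (B *v w)) \<and>
       (H p *v w = 0 \<longrightarrow> \<psi> p = D p *s w)"
proof -
  have "H p \<noteq> 0"
  proof
    assume "H p = 0"
    then have "range ((*v) (H p)) = {0}" by auto
    then have "mrank (H p) = 0" unfolding mrank_def by (simp only: vec.dim_eq_0)
    then show False using p generic_rank_pos by simp
  qed
  then have "p \<noteq> 0" by auto
  then obtain i0 where i0: "p $ i0 \<noteq> 0" by (auto simp: vec_eq_iff)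
  define l where "l x = x $ i0 / p $ i0" for x :: "'k ^ 'n"
  obtain B where B: "det (H p + B) \<noteq> 0" "mrank (H p) + mrank B \<le> CARD('n)"
    using border_exists by blast
  define N where "N x = H x + (\<chi> i j. l x * B $ i $ j)" for x
  define D where "D x = det (N x)" for x
  have lp: "l p = 1" using i0 by (simp add: l_def)
  have Np: "N p = H p + B" by (simp add: N_def lp vec_eq_iff)
  have lB: "(\<chi> i j. l x * B $ i $ j) *v y = l x *s (B *v y)" for x y
    by (simp add: vec_eq_iff matrix_vector_mult_def sum_distrib_left mult.assoc)
  have Nv: "N x *v y = H x *v y + l x *s (B *v y)" for x y
    by (simp add: N_def matrix_vector_mult_add_rdistrib lB)
  have pl: "polyfun l"
    unfolding l_def divide_inverse by (intro polyfun_mult) auto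
  have pN: "polyfun (\<lambda>x. N x $ i $ j)" for i j
    unfolding N_def by (simp add: polyfun_add polyfun_mult polymap_H pl)
  have pD: "polyfun D" unfolding D_def by (intro polyfun_det pN)
  have hD: "D (t *s x) = t ^ CARD('n) * D x" for t x
  proof -
    have "N (t *s x) = (\<chi> i. t *s (N x $ i))"
      by (simp add: N_def H_scale l_def vec_eq_iff algebra_simps)
    then have "det (N (t *s x)) = (\<Prod>i\<in>(UNIV :: 'n set). t) * det (\<chi> i. N x $ i)"
      using det_rows_mul[of "\<lambda>_. t" "\<lambda>i. N x $ i"] by simp
    then show ?thesis by (simp add: D_def)
  qed
  have Dp: "D p \<noteq> 0" using B(1) by (simp add: D_def Np)
  have rl: "mrank (H x) + mrank (\<chi> i j. l x * B $ i $ j) \<le> CARD('n)" for x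
  proof -
    have "range ((*v) (\<chi> i j. l x * B $ i $ j)) \<subseteq> range ((*v) B)"
      by (auto simp: lB simp flip: vector_scalar_commute)
    then have "mrank (\<chi> i j. l x * B $ i $ j) \<le> mrank B"
      unfolding mrank_def by (rule vec.dim_subset)
    then show ?thesis using B(2) generic_rank_max[of x] p by simp
  qed
  have sumB: "generic_rank + mrank B = CARD('n)"
    using invertible_sum_ranges(1)[OF B] p by simp
  have rk: "mrank (H x) = generic_rank" if "D x \<noteq> 0" for x
  proof -
    have "mrank (\<chi> i j. l x * B $ i $ j) \<le> mrank B"
      unfolding mrank_def
      by (rule vec.dim_subset) (auto simp: lB simp flip: vector_scalar_commute)
    moreover have "mrank (H x) + mrank (\<chi> i j. l x * B $ i $ j) = CARD('n)"
      using invertible_sum_ranges(1)[OF _ rl[of x]] that unfolding D_def N_def .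
    ultimately show ?thesis using sumB generic_rank_max[of x] by simp
  qed
  have zero: "H x *v u = 0" if "D x \<noteq> 0" "H x *v u = l x *s (B *v y)" for x u y
    using invertible_sum_ranges(2)[OF _ rl[of x], of u y] that unfolding D_def N_def lB by simp
  have ker: "\<exists>\<psi>. polymap \<psi> \<and> (\<forall>x. H x *v \<psi> x = 0) \<and> (\<forall>x. D x \<noteq> 0 \<longrightarrow> B *v \<psi> x = D x *s (B *v w)) \<and>
       (H p *v w = 0 \<longrightarrow> \<psi> p = D p *s w)" for w
  proof -
    have l0: "l x \<noteq> 0" if "D x \<noteq> 0" for x
    proof
      assume "l x = 0"
      then have "mrank (\<chi> i j. l x * B $ i $ j) = 0"
        unfolding mrank_def vec.dim_eq_0 lB by (simp add: image_subset_iff)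
      then have "mrank (H x) = CARD('n)"
        using invertible_sum_ranges(1)[OF _ rl[of x]] that unfolding D_def N_def by simp
      then show False using rk[OF that] generic_rank_less by simp
    qed
    define \<psi> where "\<psi> x = (\<chi> k. det (\<chi> i j. if j = k then (l x *s (B *v w)) $ i else N x $ i $ j))" for x
    have pm: "polymap \<psi>"
      unfolding polymap_def
    proof
      fix k
      have "polyfun (\<lambda>x. det (\<chi> i j. if j = k then (l x *s (B *v w)) $ i else N x $ i $ j))"
      proof (rule polyfun_det)
        fix i j
        have "polyfun (\<lambda>x. if j = k then l x * (B *v w) $ i else N x $ i $ j)"
          using pN by (cases "j = k") (simp_all add: polyfun_mult pl)
        then show "polyfun (\<lambda>x. (\<chi> i j. if j = k then (l x *s (B *v w)) $ i else N x $ i $ j) $ i $ j)"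
          by (simp cong: if_cong)
      qed
      then show "polyfun (\<lambda>x. \<psi> x $ k)"
        unfolding \<psi>_def vec_lambda_beta .
    qed
    have sol: "N x *v \<psi> x = D x *s (l x *s (B *v w))" if D: "D x \<noteq> 0" for x
    proof -
      have "N x *v (\<chi> k. \<psi> x $ k / D x) = l x *s (B *v w)"
        using D unfolding D_def \<psi>_def vec_lambda_beta by (rule cramer[THEN iffD2]) (rule refl)
      moreover have "\<psi> x = D x *s (\<chi> k. \<psi> x $ k / D x)"
        using D by (simp add: vec_eq_iff)
      ultimately show ?thesis by (metis vector_scalar_commute)
    qed
    have both: "H x *v \<psi> x = 0 \<and> B *v \<psi> x = D x *s (B *v w)" if D: "D x \<noteq> 0" for x
    proof -
      have *: "H x *v \<psi> x + l x *s (B *v \<psi> x) = D x *s (l x *s (B *v w))"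
        using sol[OF D] Nv by simp
      then have "H x *v \<psi> x = l x *s (B *v (D x *s w - \<psi> x))"
        by (simp add: matrix_vector_mult_diff_distrib vector_scalar_commute algebra_simps vec.scale_left_commute)
      then have H0: "H x *v \<psi> x = 0" by (rule zero[OF D])
      then have "l x *s (B *v \<psi> x) = l x *s (D x *s (B *v w))"
        using * vec.scale_left_commute[of "D x" "l x" "B *v w"] by simp
      then show ?thesis using H0 vec.scale_left_imp_eq[OF l0[OF D]] by blast
    qed
    have "H x *v \<psi> x = 0" for x
    proof -
      have "(H x *v \<psi> x) $ i = 0" for i
      proof (rule polyfun_zero_generic[where g = "\<lambda>x. (H x *v \<psi> x) $ i", OF _ pD Dp])
        show "polyfun (\<lambda>x. (H x *v \<psi> x) $ i)"
          using polymap_Hv[of "\<lambda>x. x" \<psi>] pm by (simp add: polymap_def)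
        show "(H x *v \<psi> x) $ i = 0" if "D x \<noteq> 0" for x using both[OF that] by simp
      qed
      then show ?thesis by (simp add: vec_eq_iff)
    qed
    moreover have "\<psi> p = D p *s w" if w: "H p *v w = 0"
    proof -
      have "N p *v w = l p *s (B *v w)" by (simp add: Nv w)
      then have "w = (\<chi> k. \<psi> p $ k / D p)"
        using cramer[of "N p" w "l p *s (B *v w)"] Dp unfolding D_def \<psi>_def vec_lambda_beta by blast
      then show ?thesis using Dp by (simp add: vec_eq_iff)
    qed
    ultimately show ?thesis using pm both by blast
  qed
  show thesis
    by (rule that[OF pD hD Dp rk _ ker]) (use sumB in auto)
qed

lemma kernel_extends:
  assumes "mrank (H p) = generic_rank" "H p *v w = 0"
  obtains \<psi> where "polymap \<psi>" "\<And>x. H x *v \<psi> x = 0" "\<psi> p = w"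
proof -
  obtain D B where D: "D p \<noteq> (0 :: 'k)" and *: "\<And>w. \<exists>\<psi>. polymap \<psi> \<and> (\<forall>x. H x *v \<psi> x = 0)
      \<and> (\<forall>x. D x \<noteq> 0 \<longrightarrow> (B :: 'k ^ 'n ^ 'n) *v \<psi> x = D x *s (B *v w)) \<and> (H p *v w = 0 \<longrightarrow> \<psi> p = D p *s w)"
    by (rule kernel_parametrization[OF assms(1)]) (rule that)
  obtain \<psi> where \<psi>: "polymap \<psi>" "\<And>x. H x *v \<psi> x = 0" "\<psi> p = D p *s w"
    using *[of w] assms(2) by blast
  show thesis
  proof (rule that[of "\<lambda>x. inverse (D p) *s \<psi> x"])
    show "polymap (\<lambda>x. inverse (D p) *s \<psi> x)"
      using \<psi>(1) by (simp add: polymap_def polyfun_mult)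
  qed (use \<psi> D in \<open>simp_all add: vector_scalar_commute\<close>)
qed

lemma generic_rank_open:
  assumes "mrank (H p) = generic_rank"
  obtains D where "polyfun D" "\<And>t x. D (t *s x) = t ^ CARD('n) * D x" "D p \<noteq> 0"
    "\<And>x. D x \<noteq> 0 \<Longrightarrow> mrank (H x) = generic_rank"
  by (rule kernel_parametrization[OF assms]) (rule that)

text \<open>The kernel of \<open>H p\<close> at a point of maximal rank is totally isotropic.\<close>

lemma kernel_isotropic:
  assumes p: "mrank (H p) = generic_rank" and v: "H p *v v = 0" and w: "H p *v w = 0"
  shows "H v *v w = 0"
proof -
  obtain \<psi> where \<psi>: "polymap \<psi>" "\<And>x. H x *v \<psi> x = 0" "\<psi> p = v"
    using kernel_extends[OF p v] by blast
  have "dotp (H v *v w) y = 0" for y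
  proof -
    obtain q where q: "\<And>t. dotp (H y *v w) (\<psi> (p + t *s y)) = poly q t"
      using polyfun_line[OF polyfun_dotp[OF \<psi>(1)]] by blast
    have "poly q t = 0" if "t \<notin> {0}" for t
    proof -
      have "0 = dotp (H (p + t *s y) *v \<psi> (p + t *s y)) w" by (simp add: \<psi>(2))
      also have "\<dots> = dotp (H (p + t *s y) *v w) (\<psi> (p + t *s y))" by (rule T_sym)
      also have "\<dots> = t * poly q t"
        by (simp add: H_add_v H_scale_v w dotp_simps q)
      finally show ?thesis using that by simp
    qed
    then have "q = 0" by (intro poly_zero_cofinite[of "{0}"]) auto
    then have "dotp (H y *v w) v = 0" using q[of 0] by (simp add: \<psi>(3))
    then show ?thesis by (metis T_sym)
  qed
  then show ?thesis by (rule dotp_eq_0D)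
qed

end


section \<open>The hessian of a cubic form\<close>

text \<open>The hessian matrix at a point.\<close>

definition hess :: "('n::finite, 'k::comm_semiring_1) mpoly \<Rightarrow> 'k ^ 'n \<Rightarrow> 'k ^ 'n ^ 'n" where
  "hess f x = (\<chi> i j. peval (pdiff i (pdiff j f)) x)"

lemma peval_form_0: "form 0 G \<Longrightarrow> peval G x = peval G 0"
  using peval_form_scale[of 0 G 0 x] by simp

lemma hess_coordinates:
  assumes "form 3 f"
  obtains c where "\<And>x i j. hess f x $ i $ j = (\<Sum>k\<in>UNIV. x $ k * c k i j)"
    "\<And>i j k. c i j k = c j i k" "\<And>i j k. c i j k = c i k j"
proof -
  have 1: "form 1 (pdiff i (pdiff j f))" for i j
    using form_pdiff[OF form_pdiff[OF assms]] by simp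
  have 0: "form 0 (pdiff k (pdiff i (pdiff j f)))" for i j k
    using form_pdiff[OF 1] by simp
  have "hess f x $ i $ j = (\<Sum>k\<in>UNIV. x $ k * peval (pdiff k (pdiff i (pdiff j f))) 0)" for x i j
  proof -
    have "hess f x $ i $ j = (\<Sum>k\<in>UNIV. x $ k * peval (pdiff k (pdiff i (pdiff j f))) x)"
      using euler[OF 1, of x i j] by (simp add: hess_def)
    also have "\<dots> = (\<Sum>k\<in>UNIV. x $ k * peval (pdiff k (pdiff i (pdiff j f))) 0)"
      by (intro sum.cong refl arg_cong[of _ _ "\<lambda>a. _ * a"] peval_form_0 0)
    finally show ?thesis .
  qed
  then show thesis
    by (rule that) (simp_all add: pdiff_commute)
qed

lemma hess_v_grad:
  assumes "form 3 f" shows "hess f x *v x = 2 *s grad f x"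
proof -
  have "(hess f x *v x) $ j = 2 * grad f x $ j" for j
  proof -
    have "form 2 (pdiff j f)" using form_pdiff[OF assms] by simp
    from euler[OF this, of x] show ?thesis
      by (simp add: hess_def matrix_vector_mult_def grad_def pdiff_commute[of j] mult.commute)
  qed
  then show ?thesis by (simp add: vec_eq_iff)
qed

lemma peval_hess:
  assumes "form 3 f" shows "dotp (hess f x *v x) x = 6 * peval f x"
proof -
  have "dotp x (grad f x) = 3 * peval f x"
    using euler[OF assms, of x] by (simp add: dotp_def grad_def)
  then show ?thesis
    unfolding hess_v_grad[OF assms] dotp_scale_left by (simp add: dotp_commute)
qed

lemma hess_props:
  fixes f :: "('n::finite, 'k::field_char_0) mpoly"
  assumes "form 3 f"
  shows "hess f (x + y) = hess f x + hess f y"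
    "hess f (t *s x) = (\<chi> i j. t * hess f x $ i $ j)"
    "hess f x $ i $ j = hess f x $ j $ i"
    "hess f x *v y = hess f y *v x"
proof -
  obtain c where c: "\<And>x i j. hess f x $ i $ j = (\<Sum>k\<in>UNIV. x $ k * c k i j)"
    "\<And>i j k. c i j k = c j i k" "\<And>i j k. c i j k = c i k j"
    using hess_coordinates[OF assms] by blast
  show "hess f (x + y) = hess f x + hess f y"
    by (simp add: vec_eq_iff c(1) distrib_right sum.distrib)
  show "hess f (t *s x) = (\<chi> i j. t * hess f x $ i $ j)"
    by (simp add: vec_eq_iff c(1) sum_distrib_left mult.assoc)
  show "hess f x $ i $ j = hess f x $ j $ i"
    by (simp add: hess_def pdiff_commute)
  have "(hess f x *v y) $ i = (\<Sum>j\<in>UNIV. \<Sum>k\<in>UNIV. x $ k * y $ j * c k i j)" for x y i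
    unfolding matrix_vector_mult_def vec_lambda_beta c(1) sum_distrib_right
    by (intro sum.cong refl) (simp only: mult.assoc mult.commute[of "y $ _"])
  moreover have "(\<Sum>j\<in>UNIV. \<Sum>k\<in>UNIV. x $ k * y $ j * c k i j) = (\<Sum>j\<in>UNIV. \<Sum>k\<in>UNIV. y $ k * x $ j * c k i j)" for i
  proof -
    have "c j i k = c k i j" for j k using c(2,3) by metis
    then show ?thesis by (subst sum.swap) (simp add: mult.commute)
  qed
  ultimately show "hess f x *v y = hess f y *v x"
    by (simp add: vec_eq_iff)
qed

lemma peval_det:
  fixes A :: "('n::finite, 'k::comm_ring_1) mpoly ^ 'm::finite ^ 'm"
  shows "peval (det A) x = det (\<chi> i j. peval (A $ i $ j) x)"
proof -
  have prod: "peval (prod F I) x = (\<Prod>i\<in>I. peval (F i) x)" for F :: "'m \<Rightarrow> ('n, 'k) mpoly" and I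
    by (induction I rule: infinite_finite_induct) (auto simp: peval_mult)
  have "peval (of_int k :: ('n, 'k) mpoly) x = of_int k" for k
  proof -
    have nat: "peval (of_nat n :: ('n, 'k) mpoly) x = of_nat n" for n
      by (induction n) (auto simp: peval_add)
    have "peval (- F) x = - peval F x" for F :: "('n, 'k) mpoly"
      using peval_add[of F "- F" x] by (simp add: eq_neg_iff_add_eq_0 add.commute)
    then show ?thesis
      by (cases k rule: int_cases2) (auto simp: nat)
  qed
  then show ?thesis
    by (simp add: det_def peval_sum peval_mult prod)
qed

text \<open>A nonzero point with vanishing hessian matrix is a vertex of the hypersurface.\<close>

lemma not_cone_hess_nondegenerate:
  fixes f :: "('n::finite, 'k::field_char_0) mpoly"
  assumes "form 3 f" "\<not> is_cone (hypersurface f)" "hess f p = 0"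
  shows "p = 0"
proof (rule ccontr)
  assume p: "p \<noteq> 0"
  have p0: "hess f p *v y = 0" for y by (simp add: assms(3))
  have "peval f (a *s p + b *s q) = b ^ 3 * peval f q" for a b q
  proof -
    have H: "hess f (a *s p + b *s q) *v y = b *s (hess f q *v y)" for y
    proof -
      have "hess f (a *s p + b *s q) *v y = hess f y *v (a *s p + b *s q)"
        by (rule hess_props(4)[OF assms(1)])
      also have "\<dots> = a *s (hess f p *v y) + b *s (hess f q *v y)"
        by (simp add: matrix_vector_right_distrib vector_scalar_commute hess_props(4)[OF assms(1), of y])
      finally show ?thesis by (simp add: p0)
    qed
    have sym: "dotp (hess f q *v y) z = dotp (hess f q *v z) y" for y z
      by (rule dotp_symmetric_matrix) (rule hess_props(3)[OF assms(1)])
    have qp: "hess f q *v p = 0" using hess_props(4)[OF assms(1), of q p] p0 by simp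
    have "6 * peval f (a *s p + b *s q) = b ^ 3 * (6 * peval f q)"
      unfolding peval_hess[OF assms(1), symmetric] H
      by (simp add: matrix_vector_right_distrib vector_scalar_commute qp dotp_simps power3_eq_cube
        sym[of q p])
    then show ?thesis by simp
  qed
  note f = this
  have "peval f p = 0" using f[of 1 0 p] by simp
  then have "p \<in> hypersurface f" using p by (simp add: hypersurface_def proj_zeros_def)
  moreover have "vec.span {p, q} - {0} \<subseteq> hypersurface f" if q: "q \<in> hypersurface f" for q
  proof
    fix v assume v: "v \<in> vec.span {p, q} - {0}"
    then obtain a where "v - a *s p \<in> vec.span {q}" by (auto simp: vec.span_insert)
    then obtain b where "v - a *s p = b *s q" by (auto simp: vec.span_singleton)
    then have "v = a *s p + b *s q" by (simp add: algebra_simps)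
    then show "v \<in> hypersurface f"
      using q v f by (simp add: hypersurface_def proj_zeros_def)
  qed
  ultimately have "is_cone (hypersurface f)" unfolding is_cone_def by blast
  then show False using assms(2) by blast
qed

lemma singular_cubic_hessian_hess:
  fixes f :: "('n::finite, 'k::field_char_0) mpoly"
  assumes "form 3 f" "vanishing_hessian f" "\<not> is_cone (hypersurface f)"
  shows "singular_cubic_hessian (hess f)"
proof
  show "hess f (x + y) = hess f x + hess f y" for x y by (rule hess_props[OF assms(1)])
  show "hess f (t *s x) = (\<chi> i j. t * hess f x $ i $ j)" for x t by (rule hess_props[OF assms(1)])
  show "hess f x $ i $ j = hess f x $ j $ i" for x i j by (rule hess_props[OF assms(1)])
  show "hess f x *v y = hess f y *v x" for x y by (rule hess_props[OF assms(1)])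
  show "x = 0" if "hess f x = 0" for x by (rule not_cone_hess_nondegenerate[OF assms(1,3) that])
  show "det (hess f x) = 0" for x
    using peval_det[of "hessian f" x] assms(2)
    by (simp add: vanishing_hessian_def hess_def hessian_def)
qed

section \<open>The polar image and its tangent spaces\<close>

lemma sqrt_exists: "\<exists>s :: 'k::alg_closed_field. s ^ 2 = c"
  using nth_root_exists[of 2 c] by auto

text \<open>The setting: a cubic form with vanishing hessian that does not define a cone.\<close>

locale vanishing_hessian_cubic =
  fixes f :: "('n::finite, 'k::{alg_closed_field, field_char_0}) mpoly"
  assumes form3: "form 3 f" and vanishing: "vanishing_hessian f" and no_cone: "\<not> is_cone (hypersurface f)"
begin

abbreviation "H \<equiv> hess f"
abbreviation "Z \<equiv> polar_image f"

sublocale singular_cubic_hessian "hess f"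
  using form3 vanishing no_cone by (rule singular_cubic_hessian_hess)

lemma grad_hess: "grad f x = (1 / 2) *s (H x *v x)"
  by (simp add: hess_v_grad[OF form3] vec_eq_iff)

lemma polymap_grad: "polymap (grad f)"
  by (simp add: polymap_def grad_def)

lemma grad_scale: "grad f (t *s x) = t ^ 2 *s grad f x"
  by (simp add: grad_hess H_scale_v vector_scalar_commute power2_eq_square vec_eq_iff)

lemma grad_nonzero: obtains q i where "grad f q $ i \<noteq> 0"
proof -
  obtain x y where xy: "H x *v y \<noteq> 0"
    using generic_rank_pos generic_rank_attained H_eq_0_iff[of "axis undefined 1"]
    by (metis axis_eq_0_iff one_neq_zero)
  have "\<exists>q. grad f q \<noteq> 0"
  proof (rule ccontr)
    assume "\<not> ?thesis"
    then have sq: "H z *v z = 0" for z using hess_v_grad[OF form3, of z] by simp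
    have "H (x + y) *v (x + y) = 2 *s (H x *v y)"
      unfolding H_add_v matrix_vector_right_distrib sq H_swap[of y x]
      by (simp add: vec_eq_iff)
    then show False using sq[of "x + y"] xy by (simp add: vec_eq_iff)
  qed
  then show thesis using that by (auto simp: vec_eq_iff)
qed

text \<open>Over an algebraically closed field all multiples of gradients are gradients. So the homogeneous
  parts of \<open>Q\<close> vanish at the gradients as well, hence on the closure.\<close>

lemma polar_image_zero:
  assumes "polyfun Q" "\<And>x. Q (grad f x) = 0" "z \<in> Z"
  shows "Q z = 0"
proof -
  obtain F where F: "Q = peval F" using assms(1) unfolding polyfun_def by auto
  have ray: "peval F (t *s grad f p) = 0" for t p
  proof -
    obtain s where "s ^ 2 = t" using sqrt_exists by blast
    then show ?thesis using assms(2)[of "s *s p"] grad_scale[of s p] F by simp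
  qed
  obtain n where n: "\<And>x. peval F x = (\<Sum>e\<le>n. peval (hpart e F) x)"
    using hpart_expand by blast
  have "peval (hpart e F) z = 0" if e: "e \<le> n" for e
  proof -
    have "peval (hpart e F) (c *s grad f p) = 0" for c p
    proof -
      let ?p = "\<Sum>e\<le>n. monom (peval (hpart e F) (grad f p)) e"
      have "poly ?p t = peval F (t *s grad f p)" for t
        by (simp add: poly_sum_powers n peval_form_scale[OF form_hpart])
      then have "?p = 0"
        by (intro poly_zero_cofinite[of "{}"]) (simp_all add: ray)
      then have "peval (hpart e F) (grad f p) = 0"
        using coeff_sum_powers[OF e, of "\<lambda>e. peval (hpart e F) (grad f p)"] by simp
      then show ?thesis by (simp add: peval_form_scale[OF form_hpart])
    qed
    then have "\<forall>y\<in>{c *s grad f p |c p. p \<noteq> 0 \<and> c \<noteq> 0 \<and> grad f p \<noteq> 0} - {0}. peval (hpart e F) y = 0"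
      by blast
    then show ?thesis
      using assms(3) form_hpart unfolding polar_image_def zariski_closure by blast
  qed
  then show ?thesis by (simp add: F n)
qed

lemma grad_in_polar_image: "grad f x \<noteq> 0 \<Longrightarrow> grad f x \<in> Z"
proof -
  assume *: "grad f x \<noteq> 0"
  then have "x \<noteq> 0" using grad_scale[of 0 x] by auto
  then show ?thesis
    unfolding polar_image_def using *
    by (intro zariski_closure_superset CollectI exI[of _ 1] exI[of _ x]) auto
qed

lemma vanishing_form_grad:
  assumes "G \<in> vanishing_forms Z" shows "peval G (grad f x) = 0"
proof -
  obtain q i where q: "grad f q $ i \<noteq> 0" using grad_nonzero by blast
  have pG: "polyfun (\<lambda>x. peval G (grad f x))"
    by (rule polyfun_compose[OF polyfun_peval polymap_grad])
  have pi: "polyfun (\<lambda>x. grad f x $ i)"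
    using polymap_grad by (simp add: polymap_def)
  show ?thesis
  proof (rule polyfun_zero_generic[OF pG pi q])
    fix y assume "grad f y $ i \<noteq> 0"
    then have "grad f y \<in> Z" by (intro grad_in_polar_image) auto
    then show "peval G (grad f y) = 0" using assms by (simp add: vanishing_forms_def)
  qed
qed

lemma tangent_space_eq:
  "tangent_space Z z = {v. \<forall>G\<in>vanishing_forms Z. dotp (grad G z) v = 0}"
  by (simp add: tangent_space_def dotp_def)

lemma subspace_tangent_space: "vec.subspace (tangent_space Z z)"
  unfolding tangent_space_eq by (auto simp: vec.subspace_def dotp_simps)

text \<open>Differentiating \<open>G (grad f (p + t y)) = 0\<close> at \<open>t = 0\<close> for an equation \<open>G\<close> of the polar image.\<close>

lemma range_hess_tangent: "range ((*v) (H p)) \<subseteq> tangent_space Z (grad f p)"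
proof -
  have "dotp (grad G (grad f p)) (H p *v y) = 0" if G: "G \<in> vanishing_forms Z" for G y
  proof -
    define q where "q i = [:grad f p $ i, (H p *v y) $ i, grad f y $ i:]" for i
    have curve: "(\<chi> i. poly (q i) t) = grad f (p + t *s y)" for t
    proof -
      have "H (p + t *s y) *v (p + t *s y) = H p *v p + (2 * t) *s (H p *v y) + (t * t) *s (H y *v y)"
        unfolding H_add_v H_scale_v matrix_vector_right_distrib vector_scalar_commute H_swap[of y p]
        by (simp add: vec_eq_iff algebra_simps)
      then have g: "grad f (p + t *s y) = (1 / 2) *s (H p *v p + (2 * t) *s (H p *v y) + (t * t) *s (H y *v y))"
        by (simp only: grad_hess)
      show ?thesis
        unfolding g by (simp add: grad_hess q_def vec_eq_iff algebra_simps)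
    qed
    obtain P where P: "\<And>t. poly P t = peval G (\<chi> i. poly (q i) t)"
      "\<And>t. poly (pderiv P) t = (\<Sum>i\<in>UNIV. peval (pdiff i G) (\<chi> i. poly (q i) t) * poly (pderiv (q i)) t)"
      using peval_curve[where F = G and q = q] by blast
    have "P = 0"
      by (rule poly_zero_cofinite[of "{}"]) (simp_all add: P(1) curve vanishing_form_grad[OF G])
    then have "(\<Sum>i\<in>UNIV. peval (pdiff i G) (\<chi> i. poly (q i) 0) * poly (pderiv (q i)) 0) = 0"
      using P(2)[of 0] by simp
    then show ?thesis
      by (simp add: curve dotp_def grad_def[of G]) (simp add: q_def pderiv_pCons)
  qed
  then show ?thesis by (auto simp: tangent_space_eq)
qed

lemma mrank_le_tangent: "mrank (H p) \<le> vec.dim (tangent_space Z (grad f p))"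
  unfolding mrank_def by (rule vec.dim_subset[OF range_hess_tangent])

text \<open>The polar map is constant along the kernels of the hessian at general points, so the polar
  image is parametrized by a linear space of dimension \<open>generic_rank\<close>.\<close>

lemma zdim_polar_image_le: "zdim Z + 1 \<le> enat generic_rank"
proof -
  obtain p where p: "mrank (H p) = generic_rank" using generic_rank_attained by blast
  obtain D B where D: "polyfun D" "D p \<noteq> 0" "\<And>x. D x \<noteq> 0 \<Longrightarrow> mrank (H x) = generic_rank"
    and B: "mrank (B :: 'k ^ 'n ^ 'n) = CARD('n) - generic_rank"
    and \<psi>: "\<And>w. \<exists>\<psi>. polymap \<psi> \<and> (\<forall>x. H x *v \<psi> x = 0) \<and> (\<forall>x. D x \<noteq> 0 \<longrightarrow> B *v \<psi> x = D x *s (B *v w)) \<and>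
       (H p *v w = 0 \<longrightarrow> \<psi> p = D p *s w)"
    by (rule kernel_parametrization[OF p]) (rule that)
  have dimK: "vec.dim {x. B *v x = 0} = generic_rank"
    using rank_nullity[of B] B generic_rank_less by linarith
  obtain K where K: "K \<subseteq> {x. B *v x = 0}" "vec.independent K" "{x. B *v x = 0} \<subseteq> vec.span K"
    "card K = vec.dim {x. B *v x = 0}"
    by (rule vec.basis_exists)
  have finK: "finite K" using K(2) by (rule vec.finiteI_independent)
  obtain b where b: "bij_betw b {..<generic_rank} K"
    using ex_bij_betw_nat_finite[OF finK] unfolding K(4) dimK atLeast0LessThan by blast
  have span: "\<exists>s. e = (\<Sum>j<generic_rank. s j *s b j)" if e: "B *v e = 0" for e
  proof -
    have "e \<in> vec.span K" using K(3) e by blast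
    then obtain u where "e = (\<Sum>v\<in>K. u v *s v)"
      unfolding vec.span_finite[OF finK] by blast
    also have "\<dots> = (\<Sum>j<generic_rank. u (b j) *s b j)"
      by (rule sum.reindex_bij_betw[OF b, symmetric])
    finally show ?thesis by (rule exI[of _ "\<lambda>j. u (b j)"])
  qed
  \<comment> \<open>Moving \<open>x\<close> along the kernel of \<open>H x\<close> into the kernel of \<open>B\<close> does not change the gradient.\<close>
  have slice: "\<exists>e. B *v e = 0 \<and> grad f e = grad f x" if Dx: "D x \<noteq> 0" for x
  proof -
    obtain \<psi> where \<psi>: "H x *v \<psi> x = 0" "B *v \<psi> x = D x *s (B *v x)"
      using \<psi>[of x] Dx by blast
    define u where "u = inverse (D x) *s \<psi> x"
    have u: "H x *v u = 0" "B *v u = B *v x"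
      using \<psi> Dx by (simp_all add: u_def vector_scalar_commute)
    have uu: "H u *v u = 0" using kernel_isotropic[OF D(3)[OF Dx] u(1) u(1)] .
    have "H (x - u) *v (x - u) = H x *v x"
      unfolding H_diff_v matrix_vector_mult_diff_distrib uu u(1) H_swap[of u x] by simp
    then show ?thesis
      using u(2) by (intro exI[of _ "x - u"]) (simp add: grad_hess matrix_vector_mult_diff_distrib)
  qed
  show ?thesis
  proof (rule zdim_le_parameters[OF polymap_grad generic_rank_pos])
    fix Q :: "'k ^ 'n \<Rightarrow> 'k"
    assume Q: "polyfun Q" "\<And>s. Q (grad f (\<Sum>j<generic_rank. s j *s b j)) = 0"
    have "Q (grad f x) = 0" for x
    proof (rule polyfun_zero_generic[where g = "\<lambda>x. Q (grad f x)", OF _ D(1,2)])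
      show "polyfun (\<lambda>x. Q (grad f x))" using Q(1) polymap_grad by (rule polyfun_compose)
      fix y assume "D y \<noteq> 0"
      then obtain e where "B *v e = 0" "grad f e = grad f y" using slice by blast
      then show "Q (grad f y) = 0" using span[of e] Q(2) by metis
    qed
    then show "\<forall>z\<in>Z. Q z = 0" using polar_image_zero[OF Q(1)] by blast
  qed
qed

text \<open>The dimension of the tangent space is upper semicontinuous.\<close>

lemma tangent_dim_generic_le:
  assumes z0: "z0 \<in> Z"
  obtains R q where "polyfun R" "R q \<noteq> 0"
    "\<And>x. R x \<noteq> 0 \<Longrightarrow> vec.dim (tangent_space Z (grad f x)) \<le> vec.dim (tangent_space Z z0)"
proof -
  let ?S = "(\<lambda>G. grad G z0) ` vanishing_forms Z"
  obtain B0 where B0: "B0 \<subseteq> ?S" "vec.independent B0" "?S \<subseteq> vec.span B0"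
    by (rule vec.basis_exists[of ?S])
  obtain B1 where B1: "B0 \<subseteq> B1" "vec.independent B1" "UNIV \<subseteq> vec.span B1"
    using vec.maximal_independent_subset_extend[of B0 UNIV] B0(2) by auto
  have "card B1 = CARD('n)"
    using vec.basis_card_eq_dim[of B1 UNIV] B1 vec_dim_card[where 'a = 'k and 'n = 'n] by simp
  then obtain \<beta> where \<beta>: "bij_betw \<beta> (UNIV :: 'n set) B1"
    using finite_same_card_bij[of "UNIV :: 'n set" B1] vec.finiteI_independent[OF B1(2)] by auto
  have "\<forall>b\<in>B0. \<exists>G. G \<in> vanishing_forms Z \<and> grad G z0 = b" using B0(1) by blast
  from bchoice[OF this] obtain G where G: "\<forall>b\<in>B0. G b \<in> vanishing_forms Z \<and> grad (G b) z0 = b" by blast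
  \<comment> \<open>The gradients of finitely many equations that define the tangent space at \<open>z0\<close>, completed by constant
    rows to a matrix that is invertible at \<open>z0\<close>.\<close>
  define M where "M z = (\<chi> i. if \<beta> i \<in> B0 then grad (G (\<beta> i)) z else \<beta> i)" for z
  define W where "W = {w :: 'k ^ 'n. \<forall>i. \<beta> i \<in> B0 \<longrightarrow> w $ i = 0}"
  have polyM: "polyfun (\<lambda>z. det (M z))"
  proof (rule polyfun_det)
    fix i j show "polyfun (\<lambda>z. M z $ i $ j)"
      by (cases "\<beta> i \<in> B0") (simp_all add: M_def grad_def)
  qed
  have Mv: "(M z *v v) $ i = dotp (if \<beta> i \<in> B0 then grad (G (\<beta> i)) z else \<beta> i) v" for z v i
    by (simp add: matrix_vector_mult_def dotp_def M_def)
  have M0: "M z0 $ i = \<beta> i" for i using G by (simp add: M_def)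
  have "vec.span (rows (M z0)) = UNIV"
  proof -
    have "B1 = range \<beta>" using \<beta> by (auto simp: bij_betw_def)
    also have "\<dots> = rows (M z0)" by (auto simp: rows_def row_def M0)
    finally show ?thesis using B1(3) by auto
  qed
  then have inv0: "invertible (M z0)"
    using matrix_left_invertible_span_rows_gen[of "M z0"] by (simp add: invertible_left_inverse)
  then have det0: "det (M z0) \<noteq> 0" by (simp add: invertible_det_nz)
  have inj: "inj ((*v) A)" if "det A \<noteq> 0" for A :: "'k ^ 'n ^ 'n"
    using that matrix_left_invertible_injective invertible_left_inverse invertible_det_nz by metis
  have "vec.dim W \<le> vec.dim (tangent_space Z z0)"
  proof -
    have "W \<subseteq> (*v) (M z0) ` tangent_space Z z0"
    proof
      fix w assume w: "w \<in> W"
      obtain C where C: "M z0 ** C = mat 1" using inv0 unfolding invertible_def by blast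
      define v where "v = C *v w"
      have Mw: "M z0 *v v = w" by (simp add: v_def matrix_vector_mul_assoc C)
      have "dotp b v = 0" if b: "b \<in> B0" for b
      proof -
        obtain i where i: "\<beta> i = b" using \<beta> B1(1) b by (auto simp: bij_betw_def)
        have "(M z0 *v v) $ i = 0" using w b i by (simp add: Mw W_def)
        then show ?thesis using Mv[of z0 v i] i b G by simp
      qed
      then have "B0 \<subseteq> {b. dotp b v = 0}" by blast
      moreover have "vec.subspace {b. dotp b v = 0}"
        by (auto simp: vec.subspace_def dotp_simps)
      ultimately have "vec.span B0 \<subseteq> {b. dotp b v = 0}" by (rule vec.span_minimal)
      then have "v \<in> tangent_space Z z0" using B0(3) by (auto simp: tangent_space_eq)
      then show "w \<in> (*v) (M z0) ` tangent_space Z z0" using Mw by blast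
    qed
    then have "vec.dim W \<le> vec.dim ((*v) (M z0) ` tangent_space Z z0)" by (rule vec.dim_subset)
    also have "\<dots> \<le> vec.dim (tangent_space Z z0)"
      by (rule vec.dim_image_le) simp
    finally show ?thesis .
  qed
  moreover have "vec.dim (tangent_space Z (grad f x)) \<le> vec.dim W" if x: "det (M (grad f x)) \<noteq> 0" for x
  proof -
    have "vec.dim (tangent_space Z (grad f x)) = vec.dim ((*v) (M (grad f x)) ` tangent_space Z (grad f x))"
      by (rule vec.dim_image_eq[symmetric]) (use inj[OF x] in \<open>auto intro: inj_on_subset\<close>)
    also have "\<dots> \<le> vec.dim W"
    proof (rule vec.dim_subset, rule image_subsetI)
      fix v assume "v \<in> tangent_space Z (grad f x)"
      then show "M (grad f x) *v v \<in> W"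
        using G by (simp add: W_def Mv tangent_space_eq)
    qed
    finally show ?thesis .
  qed
  moreover have "\<exists>q. det (M (grad f q)) \<noteq> 0"
    using polar_image_zero[OF polyM _ z0] det0 by blast
  ultimately show thesis
    using that[OF polyfun_compose[OF polyM polymap_grad]] order_trans by blast
qed

lemma dual_space_range: "dual_space (range ((*v) (H p))) = {v. H p *v v = 0}"
proof -
  have "(\<forall>y. dotp (H p *v y) v = 0) \<longleftrightarrow> H p *v v = 0" for v
    using T_sym(1)[of p v] dotp_eq_0D[of "H p *v v"] by auto
  then show ?thesis by (auto simp: dual_space_def dotp_def)
qed

text \<open>As soon as the dual of the polar image has positive dimension, the polar image has the expected dimension
  and its tangent space at a general gradient is the image of the hessian matrix.\<close>

lemma generic_regular:
  assumes "zdim (dual_variety Z) \<noteq> 0"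
  shows "zdim Z + 1 = enat generic_rank"
    "\<exists>R q. polyfun R \<and> R q \<noteq> 0 \<and> (\<forall>x. R x \<noteq> 0 \<longrightarrow>
      mrank (H x) = generic_rank \<and> x \<in> perazzo_domain f \<and> {v. H x *v v = 0} - {0} \<subseteq> dual_variety Z)"
proof -
  have "dual_variety Z \<noteq> {}" using assms by auto
  then obtain z0 where z0: "z0 \<in> reg_locus Z" unfolding dual_variety_def by fastforce
  then have z0Z: "z0 \<in> Z" and d: "enat (vec.dim (tangent_space Z z0)) = zdim Z + 1"
    by (auto simp: reg_locus_def)
  have dr: "vec.dim (tangent_space Z z0) \<le> generic_rank"
    using zdim_polar_image_le d by (metis enat_ord_simps(1))
  obtain R1 q1 where R1: "polyfun R1" "R1 q1 \<noteq> 0"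
    "\<And>x. R1 x \<noteq> 0 \<Longrightarrow> vec.dim (tangent_space Z (grad f x)) \<le> vec.dim (tangent_space Z z0)"
    using tangent_dim_generic_le[OF z0Z] by blast
  obtain p where p: "mrank (H p) = generic_rank" using generic_rank_attained by blast
  obtain D where D: "polyfun D" "D p \<noteq> 0" "\<And>x. D x \<noteq> 0 \<Longrightarrow> mrank (H x) = generic_rank"
    by (rule generic_rank_open[OF p]) (rule that)
  obtain q2 i where q2: "grad f q2 $ i \<noteq> 0" using grad_nonzero by blast
  have pg: "polyfun (\<lambda>x. grad f x $ i)" using polymap_grad by (simp add: polymap_def)
  define R where "R x = R1 x * D x * grad f x $ i" for x
  have pR: "polyfun R" unfolding R_def by (intro polyfun_mult R1 D pg)
  obtain q3 where q3: "R1 q3 * D q3 \<noteq> 0"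
    using polyfun_common_nonzero[OF R1(1) D(1) R1(2) D(2)] by auto
  obtain q where q: "R q \<noteq> 0"
    using polyfun_common_nonzero[OF polyfun_mult[OF R1(1) D(1)] pg q3 q2] unfolding R_def by auto
  have eq: "vec.dim (tangent_space Z (grad f x)) = generic_rank \<and> vec.dim (tangent_space Z z0) = generic_rank"
    if "R x \<noteq> 0" for x
    using that R1(3)[of x] D(3)[of x] mrank_le_tangent[of x] dr by (simp add: R_def)
  show "zdim Z + 1 = enat generic_rank" using eq[OF q] d by simp
  have "mrank (H x) = generic_rank \<and> x \<in> perazzo_domain f \<and> {v. H x *v v = 0} - {0} \<subseteq> dual_variety Z"
    if x: "R x \<noteq> 0" for x
  proof -
    have "range ((*v) (H x)) = tangent_space Z (grad f x)"
      using vec.subspace_dim_equal[OF subspace_range subspace_tangent_space range_hess_tangent] eq[OF x] D(3)[of x] x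
      by (simp add: mrank_def R_def)
    then have ds: "dual_space (tangent_space Z (grad f x)) = {v. H x *v v = 0}"
      using dual_space_range[of x] by simp
    have gx: "grad f x \<noteq> 0" using x by (auto simp: R_def)
    then have reg: "grad f x \<in> reg_locus Z"
      using eq[OF x] d grad_in_polar_image[of x] by (simp add: reg_locus_def)
    have "{v. H x *v v = 0} - {0} \<subseteq> dual_variety Z"
    proof
      fix v assume v: "v \<in> {v. H x *v v = 0} - {0}"
      then have "v \<in> (\<Union>z\<in>reg_locus Z. dual_space (tangent_space Z z)) - {0}"
        using reg unfolding ds[symmetric] by blast
      then show "v \<in> dual_variety Z"
        unfolding dual_variety_def by (rule zariski_closure_superset) (use v in blast)
    qed
    moreover have "x \<in> perazzo_domain f"
      using gx reg grad_scale[of 0 x] by (auto simp: perazzo_domain_def)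
    ultimately show ?thesis using D(3)[of x] x by (simp add: R_def)
  qed
  then show "\<exists>R q. polyfun R \<and> R q \<noteq> 0 \<and> (\<forall>x. R x \<noteq> 0 \<longrightarrow>
      mrank (H x) = generic_rank \<and> x \<in> perazzo_domain f \<and> {v. H x *v v = 0} - {0} \<subseteq> dual_variety Z)"
    using pR q by blast
qed

end


section \<open>The dual of the polar image is a curve\<close>

text \<open>The additional hypothesis that the dual of the polar image is a curve.\<close>

locale curve_dual_cubic = vanishing_hessian_cubic f
  for f :: "('n::finite, 'k::{alg_closed_field, field_char_0}) mpoly" +
  assumes dual_curve: "zdim (dual_variety (polar_image f)) = 1"
begin

text \<open>Polynomial maps whose value at \<open>x\<close> lies in the kernel of \<open>H x\<close>.\<close>

definition kernel_map :: "('k ^ 'n \<Rightarrow> 'k ^ 'n) \<Rightarrow> bool" where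
  "kernel_map \<psi> \<longleftrightarrow> polymap \<psi> \<and> (\<forall>x. H x *v \<psi> x = 0)"

lemma kernel_mapD: "kernel_map \<psi> \<Longrightarrow> polymap \<psi>" "kernel_map \<psi> \<Longrightarrow> H x *v \<psi> x = 0"
  by (auto simp: kernel_map_def)

lemma kernel_map_nth: "kernel_map \<psi> \<Longrightarrow> polyfun (\<lambda>x. \<psi> x $ i)"
  by (simp add: kernel_map_def polymap_def)

lemma kernel_map_exists:
  assumes "mrank (H p) = generic_rank" "H p *v v = 0"
  obtains \<psi> where "kernel_map \<psi>" "\<psi> p = v"
proof -
  obtain \<psi> where "polymap \<psi>" "\<And>x. H x *v \<psi> x = 0" "\<psi> p = v"
    by (rule kernel_extends[OF assms]) (rule that)
  then show thesis using that[of \<psi>] by (simp add: kernel_map_def)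
qed

lemma polymap_const: "polymap (\<lambda>x. c)"
  by (simp add: polymap_def)

lemma polymap_id: "polymap (\<lambda>x. x)"
  by (simp add: polymap_def)

lemma polyfun_T:
  assumes "polymap g" "polymap h"
  shows "polyfun (\<lambda>x. dotp (H (g x) *v h x) z)"
  using polyfun_dotp[OF polymap_Hv[OF assms], of z] by (simp add: dotp_commute)

lemma regular_points:
  obtains R q where "polyfun R" "R q \<noteq> 0" "\<And>x. R x \<noteq> 0 \<Longrightarrow> mrank (H x) = generic_rank"
    "\<And>x. R x \<noteq> 0 \<Longrightarrow> x \<in> perazzo_domain f" "\<And>x. R x \<noteq> 0 \<Longrightarrow> {v. H x *v v = 0} - {0} \<subseteq> dual_variety Z"
proof -
  have "zdim (dual_variety Z) \<noteq> 0" by (simp add: dual_curve)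
  from generic_regular(2)[OF this] show thesis using that by blast
qed

lemma closedin_dual: "closedin zariski (dual_variety Z)"
  unfolding dual_variety_def by simp

lemma kernel_map_in_dual:
  assumes \<psi>: "kernel_map \<psi>" and a: "\<psi> a \<noteq> 0"
  shows "\<psi> a \<in> dual_variety Z"
proof (rule ccontr)
  assume "\<psi> a \<notin> dual_variety Z"
  then obtain d F where F: "form d F" "\<And>y. y \<in> dual_variety Z \<Longrightarrow> peval F y = 0" "peval F (\<psi> a) \<noteq> 0"
    using closedin_zariski_separate[OF closedin_dual _ a] by blast
  obtain i where i: "\<psi> a $ i \<noteq> 0" using a by (auto simp: vec_eq_iff)
  obtain R q where R: "polyfun R" "R q \<noteq> 0" "\<And>x. R x \<noteq> 0 \<Longrightarrow> {v. H x *v v = 0} - {0} \<subseteq> dual_variety Z"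
    by (rule regular_points) (rule that)
  have pf: "polyfun (\<lambda>x. peval F (\<psi> x) * \<psi> x $ i)"
    by (intro polyfun_mult polyfun_compose[OF polyfun_peval] kernel_map_nth \<psi> kernel_mapD)
  have "peval F (\<psi> a) * \<psi> a $ i = 0"
  proof (rule polyfun_zero_generic[OF pf R(1,2)])
    fix x assume "R x \<noteq> 0"
    then have "\<psi> x \<noteq> 0 \<Longrightarrow> \<psi> x \<in> dual_variety Z"
      using R(3) kernel_mapD(2)[OF \<psi>] by blast
    then show "peval F (\<psi> x) * \<psi> x $ i = 0" using F(2) by (cases "\<psi> x = 0") auto
  qed
  then show False using F(3) i by simp
qed

text \<open>If all values were proportional to \<open>\<psi> x\<close>, then \<open>\<psi> x\<close> would lie in every kernel, so \<open>H (\<psi> x) = 0\<close>.\<close>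

lemma kernel_map_not_parallel:
  fixes \<psi> :: "'k ^ 'n \<Rightarrow> 'k ^ 'n"
  assumes \<psi>: "kernel_map \<psi>" and x: "\<psi> x \<noteq> 0"
  obtains y i j where "\<psi> x $ i * \<psi> y $ j - \<psi> x $ j * \<psi> y $ i \<noteq> 0"
proof (rule ccontr)
  assume "\<not> thesis"
  then have par: "\<psi> x $ i * \<psi> y $ j = \<psi> x $ j * \<psi> y $ i" for y i j
    using that[of i y j] by fastforce
  obtain i where i: "\<psi> x $ i \<noteq> 0" using x by (auto simp: vec_eq_iff)
  have pH: "polyfun (\<lambda>y. (H y *v \<psi> x) $ j)" for j
    using polymap_Hv[OF polymap_id polymap_const] by (simp add: polymap_def)
  have "(H y *v \<psi> x) $ j = 0" for y j
  proof (rule polyfun_zero_generic[OF pH kernel_map_nth[OF \<psi>] i])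
    fix y assume y: "\<psi> y $ i \<noteq> 0"
    have "\<psi> x = (\<psi> x $ i / \<psi> y $ i) *s \<psi> y"
      using par[where i = i and y = y] y by (simp add: vec_eq_iff field_simps)
    then have "H y *v \<psi> x = (\<psi> x $ i / \<psi> y $ i) *s (H y *v \<psi> y)"
      by (metis vector_scalar_commute)
    then show "(H y *v \<psi> x) $ j = 0" by (simp add: kernel_mapD(2)[OF \<psi>])
  qed
  then have "H y *v \<psi> x = 0" for y by (simp add: vec_eq_iff)
  then have "\<psi> x = 0" using H_eq_0_iff[of "\<psi> x"] H_swap by metis
  then show False using x by blast
qed

text \<open>The matrix \<open>H (\<psi> p)\<close> has rank at most one. Otherwise the closures of a point, of the image of a line and of the whole image of \<open>\<psi>\<close> form a
  chain of length two: for \<open>v = \<psi> (x + t y)\<close> the vectors \<open>H v x\<close> and \<open>H v y\<close> are linearly dependent,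
  because \<open>H v (x + t y) = 0\<close>.\<close>

lemma kernel_map_rank_one:
  assumes \<psi>: "kernel_map \<psi>"
  shows "(H (\<psi> p) *v x) $ i * (H (\<psi> p) *v y) $ j = (H (\<psi> p) *v x) $ j * (H (\<psi> p) *v y) $ i"
proof (rule ccontr)
  define m where "m v x y = (H v *v x) $ i * (H v *v y) $ j - (H v *v x) $ j * (H v *v y) $ i" for v x y
  assume "\<not> ?thesis"
  then obtain x1 y1 where m1: "m (\<psi> p) x1 y1 \<noteq> 0" unfolding m_def by auto
  have "\<psi> p \<noteq> 0" using m1 by (auto simp: m_def)
  then obtain a where a: "\<psi> p $ a \<noteq> 0" by (auto simp: vec_eq_iff)
  have Hn: "polyfun (\<lambda>z. (H (g z) *v h z) $ k)" if "polymap g" "polymap h" for g h :: "'k ^ 'n \<Rightarrow> 'k ^ 'n" and k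
    using polymap_Hv[OF that] by (simp add: polymap_def)
  have pm: "polyfun (\<lambda>z. m (\<psi> p) z y1)" "\<And>x. polyfun (\<lambda>z. m (\<psi> p) x z)" "\<And>x y. polyfun (\<lambda>z. m z x y)"
    unfolding m_def by (intro polyfun_sub polyfun_mult Hn polymap_const polymap_id)+
  obtain x where x: "m (\<psi> p) x y1 \<noteq> 0" "\<psi> x $ a \<noteq> 0"
    using polyfun_common_nonzero[OF pm(1) kernel_map_nth[OF \<psi>] m1 a] by blast
  have x0: "\<psi> x \<noteq> 0" using x(2) by auto
  obtain y2 b c where y2: "\<psi> x $ b * \<psi> y2 $ c - \<psi> x $ c * \<psi> y2 $ b \<noteq> 0"
    using kernel_map_not_parallel[OF \<psi> x0] by blast
  have shift: "polymap (\<lambda>z. x + z)"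
    unfolding polymap_def by (simp add: polyfun_add)
  have pn: "polyfun (\<lambda>z. \<psi> x $ b * \<psi> (x + z) $ c - \<psi> x $ c * \<psi> (x + z) $ b)"
    by (intro polyfun_sub polyfun_mult polyfun_const polyfun_compose[OF kernel_map_nth[OF \<psi>] shift])
  have "\<psi> x $ b * \<psi> (x + (y2 - x)) $ c - \<psi> x $ c * \<psi> (x + (y2 - x)) $ b \<noteq> 0"
    using y2 by simp
  from polyfun_common_nonzero[OF pm(2) pn x(1) this]
  obtain y where y: "m (\<psi> p) x y \<noteq> 0" "\<psi> x $ b * \<psi> (x + y) $ c - \<psi> x $ c * \<psi> (x + y) $ b \<noteq> 0"
    by blast
  define line where "line z = x + z $ a *s y" for z :: "'k ^ 'n"
  have polyline: "polymap (\<lambda>z. \<psi> (line z))"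
    unfolding polymap_def line_def
    by (intro allI polyfun_compose[OF kernel_map_nth[OF \<psi>]])
      (simp add: polymap_def polyfun_add polyfun_mult)
  let ?C1 = "zariski closure_of range (\<lambda>z :: 'k ^ 'n. \<psi> x)"
  let ?C2 = "zariski closure_of range (\<lambda>z. \<psi> (line z))"
  let ?C3 = "zariski closure_of range \<psi>"
  have irr: "irreducible_closed ?C1" "irreducible_closed ?C2" "irreducible_closed ?C3"
    using irreducible_closed_image[OF polymap_const x0]
      irreducible_closed_image[OF polyline, of 0] x0
      irreducible_closed_image[OF kernel_mapD(1)[OF \<psi>] x0]
    by (auto simp: line_def)
  have "range (\<lambda>z :: 'k ^ 'n. \<psi> x) \<subseteq> range (\<lambda>z. \<psi> (line z))"
    using rangeI[of "\<lambda>z. \<psi> (line z)" 0] by (auto simp: line_def)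
  then have sub12: "?C1 \<subseteq> ?C2" by (rule closure_of_mono)
  have sub23: "?C2 \<subseteq> ?C3" by (rule closure_of_mono) auto
  have "range \<psi> - {0} \<subseteq> dual_variety Z"
    using kernel_map_in_dual[OF \<psi>] by auto
  then have "topspace zariski \<inter> range \<psi> \<subseteq> dual_variety Z" by auto
  then have sub3: "?C3 \<subseteq> dual_variety Z"
    unfolding closure_of_restrict[of zariski "range \<psi>"]
    using closedin_dual by (rule closure_of_minimal)
  have ne12: "?C1 \<noteq> ?C2"
  proof
    assume eq: "?C1 = ?C2"
    obtain G where G: "form 1 G" "peval G = (\<lambda>v. \<psi> x $ b * v $ c - \<psi> x $ c * v $ b)"
    proof (rule homogeneous_polyfun_form[where d = 1 and g = "\<lambda>v. \<psi> x $ b * v $ c - \<psi> x $ c * v $ b"])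
      show "polyfun (\<lambda>v. \<psi> x $ b * v $ c - \<psi> x $ c * v $ b)"
        by (intro polyfun_sub polyfun_mult polyfun_const polyfun_nth)
    qed (auto simp: algebra_simps)
    have "\<psi> (x + y) \<noteq> 0" using y(2) by auto
    moreover have "\<psi> (x + y) = \<psi> (line (axis a 1))" by (simp add: line_def)
    ultimately have "\<psi> (x + y) \<in> ?C2" by (intro zariski_closure_superset) auto
    then have "\<psi> (x + y) \<in> ?C1" using eq by simp
    moreover have "\<forall>v\<in>range (\<lambda>z :: 'k ^ 'n. \<psi> x) - {0}. peval G v = 0" by (simp add: G(2))
    ultimately have "peval G (\<psi> (x + y)) = 0"
      using G(1) unfolding zariski_closure by blast
    then show False using y(2) by (simp add: G(2))
  qed
  have ne23: "?C2 \<noteq> ?C3"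
  proof
    assume eq: "?C2 = ?C3"
    obtain G where G: "form 2 G" "peval G = (\<lambda>v. m v x y)"
    proof (rule homogeneous_polyfun_form[where d = 2 and g = "\<lambda>v. m v x y", OF pm(3)])
      show "m (t *s v) x y = t\<^sup>2 * m v x y" for t v
        by (simp add: m_def H_scale_v power2_eq_square algebra_simps)
    qed auto
    have "peval G (\<psi> (line z)) = 0" for z
    proof -
      have "H (\<psi> (line z)) *v line z = 0"
        using kernel_mapD(2)[OF \<psi>, of "line z"] H_swap by metis
      then have "H (\<psi> (line z)) *v x = - (z $ a) *s (H (\<psi> (line z)) *v y)"
        by (simp add: line_def matrix_vector_right_distrib vector_scalar_commute eq_neg_iff_add_eq_0)
      then show ?thesis by (simp add: G(2) m_def)
    qed
    then have "\<forall>v\<in>range (\<lambda>z. \<psi> (line z)) - {0}. peval G v = 0" by auto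
    moreover have "\<psi> p \<in> ?C2"
      unfolding eq using \<open>\<psi> p \<noteq> 0\<close> by (intro zariski_closure_superset) auto
    ultimately have "peval G (\<psi> p) = 0"
      using G(1) unfolding zariski_closure by blast
    then show False using y(1) by (simp add: G(2))
  qed
  define C where "C k = (if k = 0 then ?C1 else if k = 1 then ?C2 else ?C3)" for k :: nat
  have "enat 2 \<le> zdim (dual_variety Z)"
  proof (rule zdim_ge[of 2 C])
    show "irreducible_closed (C k) \<and> C k \<subseteq> dual_variety Z" for k
      using irr sub12 sub23 sub3 by (auto simp: C_def)
    show "C k \<subset> C (Suc k)" if "k < 2" for k
      using that ne12 ne23 sub12 sub23 by (auto simp: C_def less_2_cases_iff)
  qed
  then show False by (simp add: dual_curve one_enat_def)
qed

lemma kernel_map_square: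
  assumes \<psi>: "kernel_map \<psi>"
  obtains l where "\<And>y z. dotp (H (\<psi> p) *v y) z = dotp l y * dotp l z"
proof (cases "\<psi> p = 0")
  case True
  then show ?thesis using that[of 0] by simp
next
  case False
  then obtain x0 where x0: "H (\<psi> p) *v x0 \<noteq> 0" using H_eq_0_iff by blast
  define u where "u = H (\<psi> p) *v x0"
  obtain i where i: "u $ i \<noteq> 0" using x0 by (auto simp: u_def vec_eq_iff)
  have par: "H (\<psi> p) *v y = ((H (\<psi> p) *v y) $ i / u $ i) *s u" for y
    using kernel_map_rank_one[OF \<psi>, of p y i x0] i by (simp add: vec_eq_iff u_def field_simps)
  have c: "(H (\<psi> p) *v y) $ i / u $ i * dotp u x0 = dotp u y" for y
  proof -
    have "dotp u y = dotp (H (\<psi> p) *v y) x0" unfolding u_def by (rule T_sym)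
    then show ?thesis by (subst (asm) par) (simp add: dotp_scale_left)
  qed
  have k: "dotp u x0 \<noteq> 0"
  proof
    assume "dotp u x0 = 0"
    then have "dotp u y = 0" for y using c[of y] by simp
    then have "u = 0" by (rule dotp_eq_0D)
    then show False using i by simp
  qed
  obtain s where s: "s ^ 2 = dotp u x0" using sqrt_exists by blast
  then have s0: "s \<noteq> 0" using k by auto
  show ?thesis
  proof (rule that[of "inverse s *s u"])
    fix y z
    have "(H (\<psi> p) *v y) $ i / u $ i = dotp u y / s ^ 2"
      using c[of y] k s by (simp add: field_simps)
    then have "dotp (H (\<psi> p) *v y) z = dotp u y / s ^ 2 * dotp u z"
      by (subst par) (simp add: dotp_scale_left)
    then show "dotp (H (\<psi> p) *v y) z = dotp (inverse s *s u) y * dotp (inverse s *s u) z"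
      by (simp add: dotp_scale_left power2_eq_square field_simps)
  qed
qed

text \<open>Proportional linear forms come from proportional vectors.\<close>

lemma square_parallel:
  assumes v: "\<And>y z. dotp (H v *v y) z = dotp l y * dotp l z"
    and w: "\<And>y z. dotp (H w *v y) z = dotp m y * dotp m z"
    and lm: "\<And>y. dotp l y = 0 \<Longrightarrow> dotp m y = 0" and l: "l \<noteq> 0"
  shows "\<exists>c. w = c *s v"
proof -
  obtain c where "m = c *s l" using dotp_parallel[OF l lm] by blast
  then have m: "dotp m z = c * dotp l z" for z by (simp add: dotp_scale_left)
  have "H (w - c\<^sup>2 *s v) *v y = 0" for y
  proof (rule dotp_eq_0D)
    fix z
    have "dotp (H (w - c\<^sup>2 *s v) *v y) z = dotp (H w *v y) z - c\<^sup>2 * dotp (H v *v y) z"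
      unfolding H_diff_v H_scale_v dotp_diff_left dotp_scale_left ..
    then show "dotp (H (w - c\<^sup>2 *s v) *v y) z = 0"
      by (simp add: v w m power2_eq_square)
  qed
  then have "w - c\<^sup>2 *s v = 0" using H_eq_0_iff by blast
  then show ?thesis by auto
qed

lemma square_nonzero:
  assumes "\<And>y z. dotp (H v *v y) z = dotp l y * dotp l z" "v \<noteq> 0"
  shows "l \<noteq> 0"
proof
  assume "l = 0"
  then have "H v *v y = 0" for y using assms(1) by (intro dotp_eq_0D) simp
  then show False using assms(2) H_eq_0_iff by blast
qed

text \<open>Kernel vectors \<open>v\<close>, \<open>w\<close> have squares \<open>l\<^sup>2\<close>, \<open>m\<^sup>2\<close> as hessians, and so has \<open>v + w\<close>. If \<open>l\<close>, \<open>m\<close> were independent, the sum of two squares \<open>l\<^sup>2 + m\<^sup>2\<close> could not be a square.\<close>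

lemma kernel_one_dimensional:
  assumes p: "mrank (H p) = generic_rank" and v: "H p *v v = 0" "v \<noteq> 0" and w: "H p *v w = 0"
  shows "\<exists>c. w = c *s v"
proof -
  have sq: "\<exists>l. \<forall>y z. dotp (H u *v y) z = dotp l y * dotp l z" if u: "H p *v u = 0" for u
  proof -
    obtain \<psi> where \<psi>: "kernel_map \<psi>" "\<psi> p = u" using kernel_map_exists[OF p u] by blast
    obtain l where "\<And>y z. dotp (H (\<psi> p) *v y) z = dotp l y * dotp l z"
      using kernel_map_square[OF \<psi>(1)] by blast
    then show ?thesis using \<psi>(2) by blast
  qed
  obtain l where l: "\<And>y z. dotp (H v *v y) z = dotp l y * dotp l z" using sq[OF v(1)] by blast
  obtain m where m: "\<And>y z. dotp (H w *v y) z = dotp m y * dotp m z" using sq[OF w] by blast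
  have "H p *v (v + w) = 0" by (simp add: matrix_vector_right_distrib v w)
  then obtain k where k: "\<And>y z. dotp (H (v + w) *v y) z = dotp k y * dotp k z" using sq by blast
  have sum: "dotp l y * dotp l z + dotp m y * dotp m z = dotp k y * dotp k z" for y z
    using k[of y z] l[of y z] m[of y z] by (simp add: H_add_v dotp_add_left)
  have l0: "l \<noteq> 0" using l v(2) by (rule square_nonzero)
  have "dotp m y = 0" if y: "dotp l y = 0" for y
  proof (rule ccontr)
    assume my: "dotp m y \<noteq> 0"
    obtain z where z: "dotp l z \<noteq> 0" using l0 dotp_eq_0D by blast
    define z' where "z' = z - (dotp m z / dotp m y) *s y"
    have z': "dotp m z' = 0" "dotp l z' \<noteq> 0"
      using my z y by (simp_all add: z'_def dotp_simps)
    have "dotp k y * dotp k z' = 0" "dotp k y * dotp k y \<noteq> 0" "dotp k z' * dotp k z' \<noteq> 0"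
      using sum[of y z'] sum[of y y] sum[of z' z'] y my z' by auto
    then show False by simp
  qed
  then show ?thesis using square_parallel[OF l m _ l0] by blast
qed

lemma kernel_span:
  assumes p: "mrank (H p) = generic_rank" and v: "v \<noteq> 0" "H p *v v = 0"
  shows "{x. H p *v x = 0} = vec.span {v}"
  using kernel_one_dimensional[OF p v(2,1)] v
  by (auto simp: vec.span_singleton vector_scalar_commute)

lemma generic_rank_eq: "generic_rank + 1 = CARD('n)"
proof -
  obtain p where p: "mrank (H p) = generic_rank" using generic_rank_attained by blast
  obtain v where v: "v \<noteq> 0" "H p *v v = 0" using kernel_nonzero by blast
  have "{x. H p *v x = 0} = vec.span {v}" using p v by (rule kernel_span)
  then have "vec.dim {x. H p *v x = 0} = 1" using v by simp
  then show ?thesis using rank_nullity[of "H p"] p by simp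
qed

text \<open>At a general point \<open>x\<close> the vector \<open>\<psi> x\<close> is isotropic. For two values with forms \<open>l\<close>, \<open>m\<close> the symmetry
  of the trilinear form gives \<open>l (\<psi> y) l = m (\<psi> x) m\<close>, which vanishes at \<open>\<psi> y\<close>.\<close>

lemma kernel_map_isotropic:
  assumes \<psi>: "kernel_map \<psi>"
  shows "H (\<psi> x) *v \<psi> y = 0"
proof -
  obtain p where p: "mrank (H p) = generic_rank" using generic_rank_attained by blast
  obtain D where D: "polyfun D" "D p \<noteq> 0" "\<And>x. D x \<noteq> 0 \<Longrightarrow> mrank (H x) = generic_rank"
    by (rule generic_rank_open[OF p]) (rule that)
  have self: "H (\<psi> x) *v \<psi> x = 0" for x
  proof -
    have pH: "polyfun (\<lambda>x. (H (\<psi> x) *v \<psi> x) $ i)" for i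
      using polymap_Hv[OF kernel_mapD(1)[OF \<psi>] kernel_mapD(1)[OF \<psi>]] by (simp add: polymap_def)
    have "(H (\<psi> x) *v \<psi> x) $ i = 0" for i
    proof (rule polyfun_zero_generic[OF pH D(1,2)])
      fix x assume "D x \<noteq> 0"
      then show "(H (\<psi> x) *v \<psi> x) $ i = 0"
        using kernel_isotropic[OF D(3) kernel_mapD(2)[OF \<psi>] kernel_mapD(2)[OF \<psi>]] by simp
    qed
    then show ?thesis by (simp add: vec_eq_iff)
  qed
  obtain l where l: "\<And>y z. dotp (H (\<psi> x) *v y) z = dotp l y * dotp l z"
    using kernel_map_square[OF \<psi>] by blast
  obtain m where m: "\<And>x z. dotp (H (\<psi> y) *v x) z = dotp m x * dotp m z"
    using kernel_map_square[OF \<psi>] by blast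
  have m0: "dotp m (\<psi> y) = 0" using m[of "\<psi> y" "\<psi> y"] self[of y] by simp
  have eq: "dotp l (\<psi> y) * dotp l z = dotp m (\<psi> x) * dotp m z" for z
    using l[of "\<psi> y" z] m[of "\<psi> x" z] H_swap[of "\<psi> x" "\<psi> y"] by simp
  have "dotp l (\<psi> y) = 0" using eq[of "\<psi> y"] m0 by simp
  then show ?thesis using l by (intro dotp_eq_0D) simp
qed

lemma kernel_map_square_zero:
  assumes \<psi>: "kernel_map \<psi>" and l: "\<And>y z. dotp (H (\<psi> x) *v y) z = dotp l y * dotp l z" and u: "dotp l u \<noteq> 0"
  shows "dotp l (\<psi> x') = 0"
proof -
  have "dotp (H (\<psi> x) *v \<psi> x') u = 0" by (simp add: kernel_map_isotropic[OF \<psi>])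
  then show ?thesis using u by (simp add: l)
qed

text \<open>Three linearly independent forms \<open>l1\<close>, \<open>l2\<close>, \<open>l3\<close> would force all values of \<open>\<psi>\<close> into a space of
  dimension at most four, where two general values \<open>w4\<close>, \<open>w5\<close> satisfy a linear relation with
  the three values that belong to these forms. Evaluated off the diagonal, this relation makes \<open>l4\<close> and \<open>l5\<close> proportional.\<close>

lemma kernel_map_two_forms:
  assumes n: "CARD('n) \<le> 7" and \<psi>: "kernel_map \<psi>"
    and l1: "\<And>y z. dotp (H (\<psi> x1) *v y) z = dotp l1 y * dotp l1 z"
    and l2: "\<And>y z. dotp (H (\<psi> x2) *v y) z = dotp l2 y * dotp l2 z"
    and a: "dotp l1 a1 = 1" "dotp l2 a1 = 0" "dotp l1 a2 = 0" "dotp l2 a2 = 1"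
    and z: "dotp l1 z = 0" "dotp l2 z = 0"
  shows "H (\<psi> x) *v z = 0"
proof (rule ccontr)
  assume nz: "H (\<psi> x) *v z \<noteq> 0"
  obtain l3 where l3: "\<And>y z. dotp (H (\<psi> x) *v y) z = dotp l3 y * dotp l3 z"
    using kernel_map_square[OF \<psi>] by blast
  have l3z: "dotp l3 z \<noteq> 0"
  proof
    assume "dotp l3 z = 0"
    then have "H (\<psi> x) *v z = 0" using l3 by (intro dotp_eq_0D) simp
    then show False using nz by simp
  qed
  define u3 where "u3 = inverse (dotp l3 z) *s z"
  define u1 where "u1 = a1 - dotp l3 a1 *s u3"
  define u2 where "u2 = a2 - dotp l3 a2 *s u3"
  have u3: "dotp l1 u3 = 0" "dotp l2 u3 = 0" "dotp l3 u3 = 1"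
    using z l3z by (simp_all add: u3_def dotp_simps)
  have u1: "dotp l1 u1 = 1" "dotp l2 u1 = 0" "dotp l3 u1 = 0"
    using a u3 by (simp_all add: u1_def dotp_simps)
  have u2: "dotp l1 u2 = 0" "dotp l2 u2 = 1" "dotp l3 u2 = 0"
    using a u3 by (simp_all add: u2_def dotp_simps)
  have pT: "polyfun (\<lambda>x. dotp (H (\<psi> x) *v u) u)" for u
    by (rule polyfun_T[OF kernel_mapD(1)[OF \<psi>] polymap_const])
  define A where "A x = dotp (H (\<psi> x) *v u1) u1 * dotp (H (\<psi> x) *v u2) u2 * dotp (H (\<psi> x) *v u3) u3" for x
  have pA: "polyfun A" unfolding A_def by (intro polyfun_mult pT)
  have "dotp (H (\<psi> x1) *v u1) u1 \<noteq> 0" "dotp (H (\<psi> x2) *v u2) u2 \<noteq> 0" "dotp (H (\<psi> x) *v u3) u3 \<noteq> 0"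
    by (simp_all add: l1 l2 l3 u1 u2 u3)
  note nz3 = this
  obtain y12 where y12: "dotp (H (\<psi> y12) *v u1) u1 * dotp (H (\<psi> y12) *v u2) u2 \<noteq> 0"
    using polyfun_common_nonzero[OF pT pT nz3(1,2)] by auto
  obtain x4 where x4: "A x4 \<noteq> 0"
    using polyfun_common_nonzero[OF polyfun_mult[OF pT pT] pT y12 nz3(3)] unfolding A_def by auto
  have "\<psi> x4 \<noteq> 0" using x4 by (auto simp: A_def)
  then obtain y5 i j where y5: "\<psi> x4 $ i * \<psi> y5 $ j - \<psi> x4 $ j * \<psi> y5 $ i \<noteq> 0"
    using kernel_map_not_parallel[OF \<psi>] by blast
  have pn: "polyfun (\<lambda>y. \<psi> x4 $ i * \<psi> y $ j - \<psi> x4 $ j * \<psi> y $ i)"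
    by (intro polyfun_sub polyfun_mult polyfun_const kernel_map_nth[OF \<psi>])
  obtain x5 where x5: "A x5 \<noteq> 0" "\<psi> x4 $ i * \<psi> x5 $ j - \<psi> x4 $ j * \<psi> x5 $ i \<noteq> 0"
    using polyfun_common_nonzero[OF pA pn x4 y5] by blast
  have np: "\<psi> x4 \<noteq> c *s \<psi> x5" for c
    using x5(2) by auto
  obtain l4 where l4: "\<And>y z. dotp (H (\<psi> x4) *v y) z = dotp l4 y * dotp l4 z"
    using kernel_map_square[OF \<psi>] by blast
  obtain l5 where l5: "\<And>y z. dotp (H (\<psi> x5) *v y) z = dotp l5 y * dotp l5 z"
    using kernel_map_square[OF \<psi>] by blast
  have l4u: "dotp l4 u1 \<noteq> 0" "dotp l4 u2 \<noteq> 0" "dotp l4 u3 \<noteq> 0"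
    using x4 by (auto simp: A_def l4)
  have l5u: "dotp l5 u1 \<noteq> 0" "dotp l5 u2 \<noteq> 0" "dotp l5 u3 \<noteq> 0"
    using x5(1) by (auto simp: A_def l5)
  define L :: "'k ^ 'n ^ 3" where "L = vector [l1, l2, l3]"
  have Lv: "(L *v y) $ 1 = dotp l1 y" "(L *v y) $ 2 = dotp l2 y" "(L *v y) $ 3 = dotp l3 y" for y
    by (simp_all add: L_def matrix_vector_mult_def dotp_def)
  have sect: "L *v (w $ 1 *s u1 + w $ 2 *s u2 + w $ 3 *s u3) = w" for w
    by (simp add: vec_eq_iff forall_3 Lv dotp_simps u1 u2 u3)
  have "range ((*v) L) = UNIV"
    using sect by (rule surjI[where f = "\<lambda>w. w $ 1 *s u1 + w $ 2 *s u2 + w $ 3 *s u3"])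
  then have "mrank L = 3" unfolding mrank_def by (simp only: vec_dim_card) simp
  then have dimS: "vec.dim {y. L *v y = 0} \<le> 4"
    using rank_nullity[of L] n by simp
  have inS: "L *v \<psi> y = 0" for y
    using kernel_map_square_zero[OF \<psi> l1, of u1 y] kernel_map_square_zero[OF \<psi> l2, of u2 y]
      kernel_map_square_zero[OF \<psi> l3, of u3 y]
    by (simp add: vec_eq_iff forall_3 Lv u1 u2 u3)
  let ?W = "{\<psi> x1, \<psi> x2, \<psi> x, \<psi> x4, \<psi> x5}"
  have dist: "\<psi> x1 \<noteq> \<psi> x2" "\<psi> x1 \<noteq> \<psi> x" "\<psi> x2 \<noteq> \<psi> x" "\<psi> x1 \<noteq> \<psi> x4" "\<psi> x2 \<noteq> \<psi> x4" "\<psi> x \<noteq> \<psi> x4"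
    "\<psi> x1 \<noteq> \<psi> x5" "\<psi> x2 \<noteq> \<psi> x5" "\<psi> x \<noteq> \<psi> x5" "\<psi> x4 \<noteq> \<psi> x5"
    using l1[of u1 u1] l1[of u2 u2] l2[of u1 u1] l2[of u2 u2] l3[of u1 u1] l3[of u2 u2] l4[of u1 u1] l4[of u2 u2]
      l5[of u1 u1] l5[of u2 u2] u1 u2 l4u l5u np[of 1] by auto
  have card: "card ?W = 5" using dist by simp
  have dep: "vec.dependent ?W"
  proof (rule ccontr)
    assume "\<not> vec.dependent ?W"
    moreover have "?W \<subseteq> {y. L *v y = 0}" using inS by auto
    ultimately have "card ?W \<le> vec.dim {y. L *v y = 0}" by (intro vec.independent_card_le_dim)
    then show False using dimS card by simp
  qed
  have "finite ?W" by simp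
  from vec.dependent_finite[OF this, THEN iffD1, OF dep]
  obtain c where c: "\<exists>v\<in>?W. c v \<noteq> 0" "(\<Sum>v\<in>?W. c v *s v) = 0"
    by (elim exE conjE)
  define c1 c2 c3 c4 c5 where "c1 = c (\<psi> x1)" and "c2 = c (\<psi> x2)" and "c3 = c (\<psi> x)"
    and "c4 = c (\<psi> x4)" and "c5 = c (\<psi> x5)"
  have rel: "c1 *s \<psi> x1 + (c2 *s \<psi> x2 + (c3 *s \<psi> x + (c4 *s \<psi> x4 + c5 *s \<psi> x5))) = 0"
    using c(2) dist by (simp add: c1_def c2_def c3_def c4_def c5_def)
  have R: "c1 * (dotp l1 y * dotp l1 z) + (c2 * (dotp l2 y * dotp l2 z) + (c3 * (dotp l3 y * dotp l3 z)
      + (c4 * (dotp l4 y * dotp l4 z) + c5 * (dotp l5 y * dotp l5 z)))) = 0" for y z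
  proof -
    have "dotp (H (c1 *s \<psi> x1 + (c2 *s \<psi> x2 + (c3 *s \<psi> x + (c4 *s \<psi> x4 + c5 *s \<psi> x5)))) *v y) z = 0"
      unfolding rel by simp
    then show ?thesis
      unfolding H_add_v H_scale_v dotp_add_left dotp_scale_left l1 l2 l3 l4 l5 .
  qed
  have R1: "c4 * dotp l4 u1 * dotp l4 y = - (c5 * dotp l5 u1 * dotp l5 y)" if "dotp l1 y = 0" for y
    using R[of u1 y] that by (simp add: u1 eq_neg_iff_add_eq_0 mult.assoc)
  have R3: "c4 * dotp l4 u3 * dotp l4 y = - (c5 * dotp l5 u3 * dotp l5 y)" if "dotp l3 y = 0" for y
    using R[of u3 y] that by (simp add: u3 eq_neg_iff_add_eq_0 mult.assoc)
  have c4: "c4 \<noteq> 0"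
  proof
    assume 4: "c4 = 0"
    then have 5: "c5 = 0" using R1[of u2] l5u by (simp add: u2)
    have "c1 = 0" "c2 = 0" "c3 = 0"
      using R[of u1 u1] R[of u2 u2] R[of u3 u3] 4 5 by (simp_all add: u1 u2 u3)
    then show False using c(1) 4 5 by (simp add: c1_def c2_def c3_def c4_def c5_def)
  qed
  have P1: "dotp l4 y * dotp l5 u2 = dotp l5 y * dotp l4 u2" if y: "dotp l1 y = 0" for y
  proof -
    have "(c4 * dotp l4 u1) * (dotp l4 y * dotp l5 u2) = (c4 * dotp l4 u1) * (dotp l5 y * dotp l4 u2)"
      using arg_cong[OF R1[OF y], of "\<lambda>t. t * dotp l5 u2"] arg_cong[OF R1[OF u2(1)], of "\<lambda>t. t * dotp l5 y"]
      by (simp add: algebra_simps)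
    then show ?thesis using c4 l4u(1) by simp
  qed
  have P3: "dotp l4 y * dotp l5 u2 = dotp l5 y * dotp l4 u2" if y: "dotp l3 y = 0" for y
  proof -
    have "(c4 * dotp l4 u3) * (dotp l4 y * dotp l5 u2) = (c4 * dotp l4 u3) * (dotp l5 y * dotp l4 u2)"
      using arg_cong[OF R3[OF y], of "\<lambda>t. t * dotp l5 u2"] arg_cong[OF R3[OF u2(3)], of "\<lambda>t. t * dotp l5 y"]
      by (simp add: algebra_simps)
    then show ?thesis using c4 l4u(3) by simp
  qed
  have P: "dotp l4 y * dotp l5 u2 = dotp l5 y * dotp l4 u2" for y
  proof -
    have "dotp l1 (y - dotp l1 y *s u1) = 0" by (simp add: dotp_simps u1)
    from P1[OF this] P3[OF u1(3)] show ?thesis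
      by (simp add: dotp_simps algebra_simps)
  qed
  have l50: "l5 \<noteq> 0" using l5u by auto
  have "dotp l4 y = 0" if "dotp l5 y = 0" for y using P[of y] that l5u by simp
  from square_parallel[OF l5 l4 this l50] show False using np by blast
qed

text \<open>The squares \<open>l\<^sup>2\<close> of the forms attached to the values of \<open>\<psi>\<close> are the points of a conic in
  the space of quadratic forms in \<open>l1\<close>, \<open>l2\<close>. The vectors \<open>e0\<close>, \<open>e1\<close>, \<open>e2\<close> correspond to
  \<open>l1\<^sup>2\<close>, \<open>l1 l2\<close>, \<open>l2\<^sup>2\<close>.\<close>

lemma conic_structure:
  assumes n: "CARD('n) \<le> 7"
  obtains l1 l2 a1 a2 e0 e1 e2 where
    "dotp l1 a1 = 1" "dotp l2 a1 = 0" "dotp l1 a2 = 0" "dotp l2 a2 = 1"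
    "\<And>y z. dotp (H e0 *v y) z = dotp l1 y * dotp l1 z"
    "\<And>y z. dotp (H e1 *v y) z = (dotp l1 y * dotp l2 z + dotp l2 y * dotp l1 z) / 2"
    "\<And>y z. dotp (H e2 *v y) z = dotp l2 y * dotp l2 z"
    "dotp l1 e0 = 0" "dotp l1 e1 = 0" "dotp l1 e2 = 0" "dotp l2 e0 = 0" "dotp l2 e1 = 0" "dotp l2 e2 = 0"
    "\<And>p v z. mrank (H p) = generic_rank \<Longrightarrow> H p *v v = 0 \<Longrightarrow> dotp l1 z = 0 \<Longrightarrow> dotp l2 z = 0 \<Longrightarrow> H v *v z = 0"
proof -
  obtain x1 where x1: "mrank (H x1) = generic_rank" using generic_rank_attained by blast
  obtain v where v: "v \<noteq> 0" "H x1 *v v = 0" using kernel_nonzero by blast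
  obtain \<psi> where \<psi>: "kernel_map \<psi>" "\<psi> x1 = v" using kernel_map_exists[OF x1 v(2)] by blast
  have v1: "\<psi> x1 \<noteq> 0" using \<psi>(2) v(1) by simp
  obtain x2 i j where x2: "\<psi> x1 $ i * \<psi> x2 $ j - \<psi> x1 $ j * \<psi> x2 $ i \<noteq> 0"
    using kernel_map_not_parallel[OF \<psi>(1) v1] by blast
  have np: "\<psi> x1 \<noteq> c *s \<psi> x2" "\<psi> x2 \<noteq> c *s \<psi> x1" for c using x2 by auto
  have v2: "\<psi> x2 \<noteq> 0" using np(2)[of 0] by simp
  obtain l1 where l1: "\<And>y z. dotp (H (\<psi> x1) *v y) z = dotp l1 y * dotp l1 z"
    using kernel_map_square[OF \<psi>(1)] by blast
  obtain l2 where l2: "\<And>y z. dotp (H (\<psi> x2) *v y) z = dotp l2 y * dotp l2 z"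
    using kernel_map_square[OF \<psi>(1)] by blast
  have l0: "l1 \<noteq> 0" "l2 \<noteq> 0" using square_nonzero[OF l1 v1] square_nonzero[OF l2 v2] by auto
  obtain b1 where b1: "dotp l2 b1 = 0" "dotp l1 b1 \<noteq> 0"
    using square_parallel[OF l2 l1 _ l0(2)] np(1) by blast
  obtain b2 where b2: "dotp l1 b2 = 0" "dotp l2 b2 \<noteq> 0"
    using square_parallel[OF l1 l2 _ l0(1)] np(2) by blast
  define a1 where "a1 = inverse (dotp l1 b1) *s b1"
  define a2 where "a2 = inverse (dotp l2 b2) *s b2"
  have a: "dotp l1 a1 = 1" "dotp l2 a1 = 0" "dotp l1 a2 = 0" "dotp l2 a2 = 1"
    using b1 b2 by (simp_all add: a1_def a2_def dotp_simps)
  have two: "H (\<psi> x) *v z = 0" if "dotp l1 z = 0" "dotp l2 z = 0" for x z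
    by (rule kernel_map_two_forms[OF n \<psi>(1) l1 l2 a that])
  have pT: "polyfun (\<lambda>x. dotp (H (\<psi> x) *v u) u)" for u
    by (rule polyfun_T[OF kernel_mapD(1)[OF \<psi>(1)] polymap_const])
  have nz: "dotp (H (\<psi> x1) *v a1) a1 \<noteq> 0" "dotp (H (\<psi> x2) *v a2) a2 \<noteq> 0"
    by (simp_all add: l1 l2 a)
  obtain x3 where x3: "dotp (H (\<psi> x3) *v a1) a1 \<noteq> 0" "dotp (H (\<psi> x3) *v a2) a2 \<noteq> 0"
    using polyfun_common_nonzero[OF pT pT nz] by blast
  obtain l where l: "\<And>y z. dotp (H (\<psi> x3) *v y) z = dotp l y * dotp l z"
    using kernel_map_square[OF \<psi>(1)] by blast
  define \<alpha> \<beta> where "\<alpha> = dotp l a1" and "\<beta> = dotp l a2"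
  have ab: "\<alpha> \<noteq> 0" "\<beta> \<noteq> 0" using x3 by (auto simp: l \<alpha>_def \<beta>_def)
  have lin: "dotp l y = \<alpha> * dotp l1 y + \<beta> * dotp l2 y" for y
  proof -
    have "H (\<psi> x3) *v (y - dotp l1 y *s a1 - dotp l2 y *s a2) = 0"
      by (rule two) (simp_all add: dotp_simps a)
    then have "dotp l (y - dotp l1 y *s a1 - dotp l2 y *s a2) * dotp l a1 = 0"
      using l[of "y - dotp l1 y *s a1 - dotp l2 y *s a2" a1] by simp
    then have "dotp l (y - dotp l1 y *s a1 - dotp l2 y *s a2) = 0"
      using ab(1) unfolding \<alpha>_def by simp
    then show ?thesis by (simp add: dotp_simps \<alpha>_def \<beta>_def algebra_simps)
  qed
  \<comment> \<open>Polarization of the square of \<open>\<alpha> l1 + \<beta> l2\<close> isolates the product \<open>l1 l2\<close>.\<close>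
  define e1 where "e1 = inverse (2 * \<alpha> * \<beta>) *s (\<psi> x3 - \<alpha>\<^sup>2 *s \<psi> x1 - \<beta>\<^sup>2 *s \<psi> x2)"
  have T1: "dotp (H e1 *v y) z = (dotp l1 y * dotp l2 z + dotp l2 y * dotp l1 z) / 2" for y z
  proof -
    have "dotp (H e1 *v y) z = inverse (2 * \<alpha> * \<beta>) *
       (dotp l y * dotp l z - \<alpha>\<^sup>2 * (dotp l1 y * dotp l1 z) - \<beta>\<^sup>2 * (dotp l2 y * dotp l2 z))"
      unfolding e1_def H_scale_v H_diff_v dotp_scale_left dotp_diff_left l l1 l2 ..
    also have "\<dots> = inverse (2 * \<alpha> * \<beta>) * (\<alpha> * \<beta> * (dotp l1 y * dotp l2 z + dotp l2 y * dotp l1 z))"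
      by (simp add: lin power2_eq_square algebra_simps)
    also have "\<dots> = (dotp l1 y * dotp l2 z + dotp l2 y * dotp l1 z) / 2"
    proof -
      have "inverse (2 * \<alpha> * \<beta>) * (\<alpha> * \<beta> * t) = t / 2" for t
        using ab by (simp add: field_simps)
      then show ?thesis .
    qed
    finally show ?thesis .
  qed
  have z1: "dotp l1 (\<psi> x) = 0" for x
    using kernel_map_square_zero[OF \<psi>(1) l1, of a1 x] a by simp
  have z2: "dotp l2 (\<psi> x) = 0" for x
    using kernel_map_square_zero[OF \<psi>(1) l2, of a2 x] a by simp
  have ze: "dotp l1 e1 = 0" "dotp l2 e1 = 0"
    by (simp_all add: e1_def dotp_simps z1 z2)
  have fib: "H v *v z = 0" if p: "mrank (H p) = generic_rank" and v: "H p *v v = 0" and z: "dotp l1 z = 0" "dotp l2 z = 0"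
    for p v z
  proof -
    obtain \<phi> where \<phi>: "kernel_map \<phi>" "\<phi> p = v" using kernel_map_exists[OF p v] by blast
    obtain D where D: "polyfun D" "D p \<noteq> 0" "\<And>x. D x \<noteq> 0 \<Longrightarrow> mrank (H x) = generic_rank"
      by (rule generic_rank_open[OF p]) (rule that)
    obtain k where k: "\<psi> x1 $ k \<noteq> 0" using v1 by (auto simp: vec_eq_iff)
    obtain q where q: "D q * \<psi> q $ k \<noteq> 0"
      using polyfun_common_nonzero[OF D(1) kernel_map_nth[OF \<psi>(1)] D(2) k] by auto
    have pD: "polyfun (\<lambda>x. D x * \<psi> x $ k)" by (intro polyfun_mult D kernel_map_nth[OF \<psi>(1)])
    have pH: "polyfun (\<lambda>x. (H (\<phi> x) *v z) $ j)" for j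
      using polymap_Hv[OF kernel_mapD(1)[OF \<phi>(1)] polymap_const] by (simp add: polymap_def)
    have "(H (\<phi> p) *v z) $ j = 0" for j
    proof (rule polyfun_zero_generic[OF pH pD q])
      fix x assume x: "D x * \<psi> x $ k \<noteq> 0"
      then have "mrank (H x) = generic_rank" "\<psi> x \<noteq> 0" using D(3) by auto
      then obtain c where "\<phi> x = c *s \<psi> x"
        using kernel_one_dimensional[OF _ kernel_mapD(2)[OF \<psi>(1)] _ kernel_mapD(2)[OF \<phi>(1)]] by blast
      then show "(H (\<phi> x) *v z) $ j = 0" using two[OF z, of x] by (simp add: H_scale_v)
    qed
    then show ?thesis using \<phi>(2) by (simp add: vec_eq_iff)
  qed
  show thesis
    by (rule that[OF a l1 T1 l2 z1 ze(1) z1 z2 ze(2) z2]) (rule fib)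
qed

end


section \<open>The normal form\<close>

lemma UNIV_7: "(UNIV :: 7 set) = {0, 1, 2, 3, 4, 5, 6}"
proof -
  have "card {0, 1, 2, 3, 4, 5, 6 :: 7} = 7" by simp
  then show ?thesis by (intro card_subset_eq[symmetric]) auto
qed

lemma sum_7: "(\<Sum>i\<in>UNIV. g i) = g 0 + g 1 + g 2 + g 3 + g 4 + g 5 + g (6 :: 7)"
  unfolding UNIV_7 by (simp add: add.assoc)

lemma all_7: "(\<forall>i :: 7. P i) \<longleftrightarrow> P 0 \<and> P 1 \<and> P 2 \<and> P 3 \<and> P 4 \<and> P 5 \<and> P 6"
proof -
  have "(\<forall>i :: 7. P i) \<longleftrightarrow> (\<forall>i\<in>{0, 1, 2, 3, 4, 5, 6}. P i)"
    using UNIV_7 by (metis UNIV_I)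
  then show ?thesis by simp
qed

text \<open>The space of common zeros of two independent linear forms has codimension two.\<close>

lemma dim_kernel_two_forms:
  fixes l1 l2 :: "'k::field ^ 'n::finite"
  assumes "dotp l1 a1 = 1" "dotp l2 a1 = 0" "dotp l1 a2 = 0" "dotp l2 a2 = 1"
  shows "vec.dim {z. dotp l1 z = 0 \<and> dotp l2 z = 0} + 2 = CARD('n)"
proof -
  define L :: "'k ^ 'n ^ 2" where "L = vector [l1, l2]"
  have Lv: "(L *v y) $ 1 = dotp l1 y" "(L *v y) $ 2 = dotp l2 y" for y
    by (simp_all add: L_def matrix_vector_mult_def dotp_def)
  have sect: "L *v (w $ 1 *s a1 + w $ 2 *s a2) = w" for w
    by (simp add: vec_eq_iff forall_2 Lv dotp_simps assms)
  have "range ((*v) L) = UNIV"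
    using sect by (rule surjI[where f = "\<lambda>w. w $ 1 *s a1 + w $ 2 *s a2"])
  then have "mrank L = 2" unfolding mrank_def by (simp only: vec_dim_card) simp
  moreover have "{z. L *v z = 0} = {z. dotp l1 z = 0 \<and> dotp l2 z = 0}"
    by (simp add: vec_eq_iff forall_2 Lv)
  ultimately show ?thesis using rank_nullity[of L] by simp
qed

text \<open>Polarization of a cubic form.\<close>

lemma peval_polarize:
  fixes f :: "('n::finite, 'k::field_char_0) mpoly"
  assumes "form 3 f"
  shows "dotp (hess f x *v x) y = peval f (x + y) - peval f (x - y) - 2 * peval f y"
proof -
  note H = hess_props[OF assms]
  have sym: "dotp (hess f a *v b) c = dotp (hess f a *v c) b" for a b c
    by (rule dotp_symmetric_matrix) (rule H(3))
  have diff: "hess f (x - y) *v z = hess f x *v z - hess f y *v z" for z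
    unfolding H(4)[of _ z] matrix_vector_mult_diff_distrib ..
  have sum: "hess f (x + y) *v z = hess f x *v z + hess f y *v z" for z
    unfolding H(4)[of _ z] matrix_vector_right_distrib ..
  have "6 * (peval f (x + y) - peval f (x - y) - 2 * peval f y) =
    dotp (hess f (x + y) *v (x + y)) (x + y) - dotp (hess f (x - y) *v (x - y)) (x - y)
      - 2 * dotp (hess f y *v y) y"
    by (simp only: peval_hess[OF assms]) (simp add: algebra_simps)
  also have "\<dots> = 6 * dotp (hess f x *v x) y"
    unfolding sum diff matrix_vector_right_distrib matrix_vector_mult_diff_distrib dotp_simps
      H(4)[of y x] sym[of x y x]
    using sym[of y y x] H(4)[of x y] by (simp add: algebra_simps)
  finally have eq: "6 * (peval f (x + y) - peval f (x - y) - 2 * peval f y) = 6 * dotp (hess f x *v x) y" .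
  have "(6 :: 'k) \<noteq> 0" by simp
  from mult_left_cancel[THEN iffD1, OF this eq] show ?thesis by simp
qed

lemma pvars_sum_subset:
  fixes g :: "'i \<Rightarrow> ('n, 'k::comm_semiring_1) mpoly"
  assumes "\<And>i. i \<in> I \<Longrightarrow> pvars (g i) \<subseteq> V" shows "pvars (sum g I) \<subseteq> V"
  using assms
proof (induction I rule: infinite_finite_induct)
  case (insert i I)
  have "pvars (g i + sum g I) \<subseteq> pvars (g i) \<union> pvars (sum g I)"
    unfolding pvars_def using Poly_Mapping.keys_add[of "g i" "sum g I"] by blast
  then show ?case using insert by fastforce
qed (auto simp: pvars_def)

text \<open>The case of projective six-space.\<close>

locale curve_dual_cubic7 = curve_dual_cubic f
  for f :: "(7, 'k::{alg_closed_field, field_char_0}) mpoly"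
begin

lemma H_sum_v: "H (sum g I) *v y = (\<Sum>i\<in>I. H (g i) *v y)"
  by (induction I rule: infinite_finite_induct) (auto simp: H_add_v)

lemma dotp_sum_left: "dotp (sum g I) y = (\<Sum>i\<in>I. dotp (g i) y)"
  by (induction I rule: infinite_finite_induct) (auto simp: dotp_add_left)

lemma dotp_sum_right: "dotp y (sum g I) = (\<Sum>i\<in>I. dotp y (g i))"
  by (induction I rule: infinite_finite_induct) (auto simp: dotp_add_right)

text \<open>The first three columns of the change of coordinates come from the conic, the next two
  complete them to a basis of the common kernel of \<open>l1\<close> and \<open>l2\<close>, and the last two are dual
  to \<open>l1\<close> and \<open>l2\<close>.\<close>

lemma normal_form:
  "\<exists>D :: (7, 'k) mpoly. form 3 D \<and> pvars D \<subseteq> {3, 4, 5, 6} \<and>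
       proj_equivalent (hypersurface f)
         (hypersurface (Var 0 * Var 5 ^ 2 + 2 * Var 1 * Var 5 * Var 6 + Var 2 * Var 6 ^ 2 + D)) \<and>
       \<not> proj_zeros {Var 0, Var 1, Var 2, Var 5, Var 6} \<subseteq> singular_locus {D, Var 0, Var 1, Var 2}"
proof -
  obtain l1 l2 a1 a2 e0 e1 e2 where
    a: "dotp l1 a1 = 1" "dotp l2 a1 = 0" "dotp l1 a2 = 0" "dotp l2 a2 = 1"
    and E0: "\<And>y z. dotp (H e0 *v y) z = dotp l1 y * dotp l1 z"
    and E1: "\<And>y z. dotp (H e1 *v y) z = (dotp l1 y * dotp l2 z + dotp l2 y * dotp l1 z) / 2"
    and E2: "\<And>y z. dotp (H e2 *v y) z = dotp l2 y * dotp l2 z"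
    and le: "dotp l1 e0 = 0" "dotp l1 e1 = 0" "dotp l1 e2 = 0" "dotp l2 e0 = 0" "dotp l2 e1 = 0" "dotp l2 e2 = 0"
    by (rule conic_structure) (simp, rule that)
  let ?K = "{z. dotp l1 z = 0 \<and> dotp l2 z = 0}"
  have dimK: "vec.dim ?K = 5" using dim_kernel_two_forms[OF a] by simp
  have eK: "H e0 *v z = 0" "H e1 *v z = 0" "H e2 *v z = 0" if "z \<in> ?K" for z
    using that by (auto intro!: dotp_eq_0D simp: E0 E1 E2)
  have rel_e: "c0 = 0 \<and> c1 = 0 \<and> c2 = 0" if "c0 *s e0 + (c1 *s e1 + c2 *s e2) = 0" for c0 c1 c2
  proof -
    have "c0 * dotp (H e0 *v y) z + (c1 * dotp (H e1 *v y) z + c2 * dotp (H e2 *v y) z) = 0" for y z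
    proof -
      have "dotp (H (c0 *s e0 + (c1 *s e1 + c2 *s e2)) *v y) z = 0" unfolding that by simp
      then show ?thesis unfolding H_add_v H_scale_v dotp_add_left dotp_scale_left .
    qed
    from this[of a1 a1] this[of a1 a2] this[of a2 a2] show ?thesis
      by (simp add: E0 E1 E2 a)
  qed
  have dist_e: "e0 \<noteq> e1" "e0 \<noteq> e2" "e1 \<noteq> e2"
    using E0[of a1 a1] E1[of a1 a1] E1[of a2 a2] E2[of a1 a1] E2[of a2 a2] a by auto
  have ind_e: "vec.independent {e0, e1, e2}"
  proof
    assume "vec.dependent {e0, e1, e2}"
    then obtain c where c: "\<exists>v\<in>{e0, e1, e2}. c v \<noteq> 0" "(\<Sum>v\<in>{e0, e1, e2}. c v *s v) = 0"
      by (subst (asm) vec.dependent_finite) (simp, elim exE conjE)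
    then have "c e0 *s e0 + (c e1 *s e1 + c e2 *s e2) = 0" using dist_e by simp
    then show False using rel_e c(1) by blast
  qed
  obtain B where B: "{e0, e1, e2} \<subseteq> B" "B \<subseteq> ?K" "vec.independent B" "?K \<subseteq> vec.span B"
  proof (rule vec.maximal_independent_subset_extend[of "{e0, e1, e2}" ?K])
    show "{e0, e1, e2} \<subseteq> ?K" using le by simp
  qed (use ind_e in auto)
  have finB: "finite B" using B(3) by (rule vec.finiteI_independent)
  have cardB: "card B = 5"
    using vec.basis_card_eq_dim[OF B(2,4,3)] dimK by simp
  have "card (B - {e0, e1, e2}) = 2"
    using card_Diff_subset[of "{e0, e1, e2}" B] B(1) cardB dist_e by simp
  then obtain b3 b4 where b: "B - {e0, e1, e2} = {b3, b4}" "b3 \<noteq> b4"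
    unfolding card_2_iff by blast
  have Beq: "B = {e0, e1, e2, b3, b4}" using b B(1) by blast
  have distB: "b3 \<notin> {e0, e1, e2}" "b4 \<notin> {e0, e1, e2}" using b by auto
  have lb: "dotp l1 b3 = 0" "dotp l2 b3 = 0" "dotp l1 b4 = 0" "dotp l2 b4 = 0"
    using B(2) Beq by auto
  \<comment> \<open>The factors \<open>2\<close>, \<open>4\<close>, \<open>2\<close> come from \<open>6 f x = dotp (H x *v x) x\<close>, the three mixed terms in
    \<open>x = s + u\<close> with \<open>s\<close> in the span of the conic, and the factor \<open>1/2\<close> in the product \<open>l1 l2\<close>.\<close>
  define col :: "7 \<Rightarrow> 'k ^ 7" where "col j = (if j = 0 then 2 *s e0 else if j = 1 then 4 *s e1 else if j = 2 then 2 *s e2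
      else if j = 3 then b3 else if j = 4 then b4 else if j = 5 then a1 else a2)" for j
  have col: "col 0 = 2 *s e0" "col 1 = 4 *s e1" "col 2 = 2 *s e2" "col 3 = b3" "col 4 = b4" "col 5 = a1" "col 6 = a2"
    by (simp_all add: col_def)
  define A :: "'k ^ 7 ^ 7" where "A = (\<chi> i j. col j $ i)"
  have Av: "A *v x = (\<Sum>j\<in>UNIV. x $ j *s col j)" for x
    by (simp add: A_def vec_eq_iff matrix_vector_mult_def mult.commute)
  have inj: "x = 0" if x: "A *v x = 0" for x
  proof -
    have s: "x $ 0 *s (2 *s e0) + x $ 1 *s (4 *s e1) + x $ 2 *s (2 *s e2) + x $ 3 *s b3 + x $ 4 *s b4 + x $ 5 *s a1 + x $ 6 *s a2 = 0"
      using x unfolding Av sum_7 col .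
    have x56: "x $ 5 = 0" "x $ 6 = 0"
      using arg_cong[OF s, of "dotp l1"] arg_cong[OF s, of "dotp l2"]
      by (simp_all add: dotp_simps le lb a)
    define c where "c v = (if v = e0 then 2 * x $ 0 else if v = e1 then 4 * x $ 1 else if v = e2 then 2 * x $ 2
        else if v = b3 then x $ 3 else x $ 4)" for v
    have cv: "c e0 = 2 * x $ 0" "c e1 = 4 * x $ 1" "c e2 = 2 * x $ 2" "c b3 = x $ 3" "c b4 = x $ 4"
      using dist_e distB b(2) by (auto simp: c_def)
    have "e0 \<noteq> b3" "e1 \<noteq> b3" "e2 \<noteq> b3" "e0 \<noteq> b4" "e1 \<noteq> b4" "e2 \<noteq> b4" using distB by auto
    then have "(\<Sum>v\<in>B. c v *s v) = c e0 *s e0 + (c e1 *s e1 + (c e2 *s e2 + (c b3 *s b3 + c b4 *s b4)))"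
      unfolding Beq using dist_e b(2) by simp
    also have "\<dots> = 0" using s x56 by (simp add: cv add.assoc mult.commute)
    finally have "(\<Sum>v\<in>B. c v *s v) = 0" .
    then have "\<forall>v\<in>B. c v = 0"
      using B(3) vec.independent_explicit by blast
    then have "x $ 0 = 0" "x $ 1 = 0" "x $ 2 = 0" "x $ 3 = 0" "x $ 4 = 0"
      unfolding Beq by (simp_all add: cv)
    then show ?thesis using x56 by (simp add: vec_eq_iff all_7)
  qed
  have "inj ((*v) A)"
    using inj by (intro injI) (metis eq_iff_diff_eq_0 matrix_vector_mult_diff_distrib)
  then have invA: "invertible A"
    using matrix_left_invertible_injective invertible_left_inverse by blast
  then obtain A' where A': "A ** A' = mat 1" "A' ** A = mat 1" unfolding invertible_def by blast
  have surj: "\<exists>x. y = A *v x" for y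
    by (rule exI[of _ "A' *v y"]) (simp add: matrix_vector_mul_assoc A')
  have zero_col: "v = 0" if "\<And>j. dotp v (col j) = 0" for v
  proof (rule dotp_eq_0D)
    fix y
    obtain x where x: "y = A *v x" using surj by blast
    show "dotp v y = 0"
      unfolding x Av dotp_sum_right dotp_scale_right by (simp add: that)
  qed

  let ?I = "{3, 4, 5, 6} :: 7 set"
  \<comment> \<open>\<open>D\<close> is the restriction of \<open>f\<close> to the span of the last four columns.\<close>
  define \<tau> where "\<tau> x = (\<Sum>i\<in>?I. x $ i *s col i)" for x :: "'k ^ 7"
  define t where "t i j k = dotp (H (col i) *v col j) (col k) / 6" for i j k
  define D :: "(7, 'k) mpoly" where "D = (\<Sum>i\<in>?I. \<Sum>j\<in>?I. \<Sum>k\<in>?I.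
      Poly_Mapping.single (Poly_Mapping.single i 1 + Poly_Mapping.single j 1 + Poly_Mapping.single k 1) (t i j k))"
  have deg: "mon_deg (Poly_Mapping.single i 1 + Poly_Mapping.single j 1 + Poly_Mapping.single k 1) = 3" for i j k :: 7
    by (simp add: mon_deg_def lookup_add sum.distrib lookup_single when_def)
  have D3: "form 3 D"
    unfolding D_def by (intro form_sum form_single deg)
  have vars: "pvars D \<subseteq> ?I"
    unfolding D_def
  proof (intro pvars_sum_subset)
    fix i j k assume "i \<in> ?I" "j \<in> ?I" "k \<in> ?I"
    then have "Poly_Mapping.keys (Poly_Mapping.single i 1 + Poly_Mapping.single j 1 + Poly_Mapping.single k (1 :: nat)) \<subseteq> ?I"
      using Poly_Mapping.keys_add[of "Poly_Mapping.single i 1 + Poly_Mapping.single j 1" "Poly_Mapping.single k (1 :: nat)"]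
        Poly_Mapping.keys_add[of "Poly_Mapping.single i 1" "Poly_Mapping.single j (1 :: nat)"] by auto
    then show "pvars (Poly_Mapping.single (Poly_Mapping.single i 1 + Poly_Mapping.single j 1 + Poly_Mapping.single k 1) (t i j k)) \<subseteq> ?I"
      by (auto simp: pvars_def split: if_splits)
  qed
  have \<tau>_add: "\<tau> (x + y) = \<tau> x + \<tau> y" for x y
    by (simp add: \<tau>_def vec.scale_left_distrib sum.distrib)
  have \<tau>_diff: "\<tau> (x - y) = \<tau> x - \<tau> y" for x y
    by (simp add: \<tau>_def vec.scale_left_diff_distrib sum_subtractf)
  have evD: "peval D x = peval f (\<tau> x)" for x
  proof -
    have "6 * peval D x = (\<Sum>i\<in>?I. \<Sum>j\<in>?I. \<Sum>k\<in>?I. x $ i * x $ j * x $ k * dotp (H (col i) *v col j) (col k))"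
      unfolding D_def peval_sum sum_distrib_left
      by (intro sum.cong refl) (simp add: mon_eval_add mon_eval_single t_def)
    also have "\<dots> = dotp (H (\<tau> x) *v \<tau> x) (\<tau> x)"
    proof -
      have 3: "(\<Sum>k\<in>?I. x $ k * dotp v (col k)) = dotp v (\<tau> x)" for v
        unfolding \<tau>_def dotp_sum_right dotp_scale_right ..
      have 2: "(\<Sum>j\<in>?I. x $ j * dotp (H u *v col j) w) = dotp (H u *v \<tau> x) w" for u w
        using 3[of "H u *v w"] unfolding T_sym(1)[of u _ w] .
      have 1: "(\<Sum>i\<in>?I. x $ i * dotp (H (col i) *v u) w) = dotp (H (\<tau> x) *v u) w" for u w
        unfolding \<tau>_def H_sum_v H_scale_v dotp_sum_left dotp_scale_left ..
      have "(\<Sum>i\<in>?I. \<Sum>j\<in>?I. \<Sum>k\<in>?I. x $ i * x $ j * x $ k * dotp (H (col i) *v col j) (col k))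
         = (\<Sum>i\<in>?I. x $ i * (\<Sum>j\<in>?I. x $ j * (\<Sum>k\<in>?I. x $ k * dotp (H (col i) *v col j) (col k))))"
        unfolding sum_distrib_left by (simp only: mult.assoc)
      then show ?thesis unfolding 3 2 1 .
    qed
    also have "\<dots> = 6 * peval f (\<tau> x)" by (rule peval_hess[OF form3])
    finally show ?thesis by simp
  qed
  let ?G = "Var 0 * Var 5 ^ 2 + 2 * Var 1 * Var 5 * Var 6 + Var 2 * Var 6 ^ 2 + D :: (7, 'k) mpoly"
  have evG: "peval f (A *v x) = peval ?G x" for x
  proof -
    define s where "s = x $ 0 *s (2 *s e0) + x $ 1 *s (4 *s e1) + x $ 2 *s (2 *s e2)"
    have Ax: "A *v x = s + \<tau> x"
      unfolding Av sum_7 s_def \<tau>_def by (simp add: col add.assoc)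
    have ls: "s \<in> ?K" by (simp add: s_def dotp_simps le)
    have l\<tau>: "dotp l1 (\<tau> x) = x $ 5" "dotp l2 (\<tau> x) = x $ 6"
      by (simp_all add: \<tau>_def col dotp_simps a lb)
    have Hs: "H s *v y = (2 * x $ 0) *s (H e0 *v y) + (4 * x $ 1) *s (H e1 *v y) + (2 * x $ 2) *s (H e2 *v y)" for y
      unfolding s_def H_add_v H_scale_v vec.scale_scale by (simp add: mult.commute)
    have ss: "H s *v s = 0" using eK[OF ls] by (simp add: Hs)
    have T\<tau>: "dotp (H s *v \<tau> x) (\<tau> x) = 2 * x $ 0 * (x $ 5)\<^sup>2 + 4 * x $ 1 * x $ 5 * x $ 6 + 2 * x $ 2 * (x $ 6)\<^sup>2"
      unfolding Hs by (simp add: dotp_simps E0 E1 E2 l\<tau> power2_eq_square)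
    have "6 * peval f (A *v x) = dotp (H (A *v x) *v (A *v x)) (A *v x)"
      by (rule peval_hess[OF form3, symmetric])
    also have "\<dots> = 3 * dotp (H s *v \<tau> x) (\<tau> x) + dotp (H (\<tau> x) *v \<tau> x) (\<tau> x)"
    proof -
      have 1: "dotp (H s *v \<tau> x) s = 0" using T_sym(1)[of s "\<tau> x" s] ss by simp
      have 2: "dotp (H (\<tau> x) *v \<tau> x) s = dotp (H s *v \<tau> x) (\<tau> x)"
        using T_sym(1)[of "\<tau> x" "\<tau> x" s] H_swap[of s "\<tau> x"] by simp
      show ?thesis
        unfolding Ax H_add_v matrix_vector_right_distrib dotp_simps ss H_swap[of "\<tau> x" s] 1 2
        by simp
    qed
    also have "\<dots> = 6 * (x $ 0 * (x $ 5)\<^sup>2 + 2 * x $ 1 * x $ 5 * x $ 6 + x $ 2 * (x $ 6)\<^sup>2 + peval D x)"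
      unfolding T\<tau> peval_hess[OF form3] evD by (simp add: algebra_simps)
    also have "x $ 0 * (x $ 5)\<^sup>2 + 2 * x $ 1 * x $ 5 * x $ 6 + x $ 2 * (x $ 6)\<^sup>2 + peval D x = peval ?G x"
    proof -
      have "peval (2 :: (7, 'k) mpoly) x = 2"
        unfolding one_add_one[symmetric] peval_add by simp
      then show ?thesis by (simp add: peval_add peval_mult power2_eq_square)
    qed
    finally show ?thesis by simp
  qed
  have equiv: "proj_equivalent (hypersurface f) (hypersurface ?G)"
    unfolding proj_equivalent_def
  proof (intro exI conjI)
    show "invertible A" by (rule invA)
    show "hypersurface f = (*v) A ` hypersurface ?G"
    proof
      show "hypersurface f \<subseteq> (*v) A ` hypersurface ?G"
      proof
        fix y assume y: "y \<in> hypersurface f"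
        obtain x where x: "y = A *v x" using surj by blast
        have "x \<noteq> 0" using y x by (auto simp: hypersurface_def proj_zeros_def)
        moreover have "peval ?G x = 0" using y x evG[of x] by (simp add: hypersurface_def proj_zeros_def)
        ultimately show "y \<in> (*v) A ` hypersurface ?G" using x by (auto simp: hypersurface_def proj_zeros_def)
      qed
      show "(*v) A ` hypersurface ?G \<subseteq> hypersurface f"
        using inj by (auto simp: hypersurface_def proj_zeros_def evG)
    qed
  qed
  have "\<not> proj_zeros {Var 0, Var 1, Var 2, Var 5, Var 6} \<subseteq> singular_locus {D, Var 0, Var 1, Var 2}"
  proof
    assume sing: "proj_zeros {Var 0, Var 1, Var 2, Var 5, Var 6} \<subseteq> singular_locus {D, Var 0, Var 1, Var 2}"
    have gradVar: "grad (Var i) p = axis i 1" for i :: 7 and p :: "'k ^ 7"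
    proof -
      have "pdiff j (Var i :: (7, 'k) mpoly) = (if j = i then 1 else 0)" for j
        unfolding Var_def pdiff_single by (auto simp: lookup_single when_def)
      then show ?thesis by (simp add: grad_def vec_eq_iff axis_def)
    qed
    \<comment> \<open>Singular points on the line make the partial derivatives of \<open>D\<close> vanish there.\<close>
    have gradD: "grad D p $ i = 0"
      if p: "p \<noteq> 0" "p $ 0 = 0" "p $ 1 = 0" "p $ 2 = 0" "p $ 5 = 0" "p $ 6 = 0" and i: "i \<in> ?I" for p i
    proof (rule ccontr)
      assume nz: "grad D p $ i \<noteq> 0"
      have "p \<in> proj_zeros {Var 0, Var 1, Var 2, Var 5, Var 6}" using p by (simp add: proj_zeros_def)
      then have "vec.dim ((\<lambda>F. grad F p) ` {D, Var 0, Var 1, Var 2}) < card {D, Var 0, Var 1, Var 2}"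
        using sing unfolding singular_locus_def by blast
      also have "\<dots> \<le> 4"
        by (simp add: card_insert_if)
      finally have dim: "vec.dim {grad D p, axis 0 1, axis 1 1, axis 2 1} < 4" by (simp add: gradVar)
      let ?S = "{grad D p, axis 0 1, axis 1 1, axis 2 (1 :: 'k)}"
      have ne: "grad D p \<noteq> axis j 1" if "j \<in> {0, 1, 2}" for j
        using nz i that by (auto simp: axis_def)
      have dist: "axis 0 (1 :: 'k) \<noteq> axis (1 :: 7) 1" "axis 0 (1 :: 'k) \<noteq> axis (2 :: 7) 1" "axis 1 (1 :: 'k) \<noteq> axis (2 :: 7) 1"
        by (simp_all add: axis_eq_axis)
      have card: "card ?S = 4" using ne dist by simp
      have "vec.independent ?S"
      proof
        assume "vec.dependent ?S"
        then obtain c where c: "\<exists>v\<in>?S. c v \<noteq> 0" "(\<Sum>v\<in>?S. c v *s v) = 0"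
          by (subst (asm) vec.dependent_finite) (simp, elim exE conjE)
        then have s: "c (grad D p) *s grad D p + (c (axis 0 1) *s axis 0 1 + (c (axis 1 1) *s axis 1 1 + c (axis 2 1) *s axis 2 1)) = 0"
          using ne dist by simp
        have "c (grad D p) = 0"
          using arg_cong[OF s, of "\<lambda>v. v $ i"] i nz by (auto simp: axis_def)
        then have "c (axis 0 1) = 0 \<and> c (axis 1 1) = 0 \<and> c (axis 2 1) = 0"
          using arg_cong[OF s, of "\<lambda>v. v $ 0"] arg_cong[OF s, of "\<lambda>v. v $ 1"] arg_cong[OF s, of "\<lambda>v. v $ 2"]
          by (simp add: axis_def)
        then show False using c(1) \<open>c (grad D p) = 0\<close> by blast
      qed
      then have "card ?S \<le> vec.dim ?S" by (intro vec.independent_card_le_dim) auto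
      then show False using dim card by simp
    qed
    have TD: "dotp (H (\<tau> p) *v \<tau> p) (col i) = 0"
      if p: "p \<noteq> 0" "p $ 0 = 0" "p $ 1 = 0" "p $ 2 = 0" "p $ 5 = 0" "p $ 6 = 0" for p i
    proof (cases "i \<in> ?I")
      case True
      have \<tau>i: "\<tau> (axis i 1) = col i" using True by (auto simp: \<tau>_def axis_def)
      have "0 = dotp (hess D p *v p) (axis i 1)"
        using gradD[OF p True] by (simp add: hess_v_grad[OF D3] dotp_axis)
      also have "\<dots> = dotp (H (\<tau> p) *v \<tau> p) (\<tau> (axis i 1))"
        unfolding peval_polarize[OF D3] peval_polarize[OF form3] evD \<tau>_add \<tau>_diff ..
      finally show ?thesis by (simp add: \<tau>i)
    next
      case False
      have "i \<in> {0, 1, 2, 3, 4, 5, 6}" using UNIV_I[of i] unfolding UNIV_7 .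
      then have i: "i = 0 \<or> i = 1 \<or> i = 2" using False by blast
      have "\<tau> p \<in> ?K" using p by (simp add: \<tau>_def col dotp_simps lb)
      note e = eK[OF this]
      have "H (col i) *v \<tau> p = 0"
        using i by (auto simp: col H_scale_v e)
      then show ?thesis using T_sym(1)[of "\<tau> p" "\<tau> p" "col i"] H_swap[of "\<tau> p" "col i"] by simp
    qed
    have tau_ax: "\<tau> (axis 3 1) = b3" "\<tau> (axis 4 1) = b4"
      by (simp_all add: \<tau>_def axis_def col)
    have axn: "axis i (1 :: 'k) \<noteq> 0" for i :: 7 by (simp add: axis_eq_0_iff)
    have 33: "H b3 *v b3 = 0"
      by (rule zero_col) (use TD[of "axis 3 1", OF axn] tau_ax in \<open>simp add: axis_def\<close>)
    have 44: "H b4 *v b4 = 0"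
      by (rule zero_col) (use TD[of "axis 4 1", OF axn] tau_ax in \<open>simp add: axis_def\<close>)
    have "H (b3 + b4) *v (b3 + b4) = 0"
    proof (rule zero_col)
      fix j
      have "axis 3 1 + axis 4 1 \<noteq> (0 :: 'k ^ 7)"
        using dotp_axis[of "axis 3 1 + axis 4 (1 :: 'k) :: 'k ^ 7" 3] by (auto simp: axis_def vec_eq_iff)
      then have "dotp (H (\<tau> (axis 3 1 + axis 4 1)) *v \<tau> (axis 3 1 + axis 4 1)) (col j) = 0"
        by (rule TD) (simp_all add: axis_def)
      then show "dotp (H (b3 + b4) *v (b3 + b4)) (col j) = 0"
        by (simp only: \<tau>_add tau_ax)
    qed
    then have "2 *s (H b3 *v b4) = 0"
      unfolding H_add_v matrix_vector_right_distrib 33 44 H_swap[of b4 b3] by (simp add: vec_eq_iff)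
    then have 34: "H b3 *v b4 = 0" by simp
    \<comment> \<open>The only nonzero products with \<open>b3\<close> now involve \<open>a1\<close> and \<open>a2\<close> and are cancelled by the conic,
      so the corrected vector \<open>q\<close> would be a vertex.\<close>
    define q where "q = b3 - (dotp (H b3 *v a1) a1 *s e0 + (2 * dotp (H b3 *v a1) a2) *s e1 + dotp (H b3 *v a2) a2 *s e2)"
    have Hq: "H q *v y = H b3 *v y - (dotp (H b3 *v a1) a1 *s (H e0 *v y) + (2 * dotp (H b3 *v a1) a2) *s (H e1 *v y)
        + dotp (H b3 *v a2) a2 *s (H e2 *v y))" for y
      unfolding q_def H_diff_v H_add_v H_scale_v ..
    have qK: "q \<in> ?K" by (simp add: q_def dotp_simps le lb)
    have b34: "b3 \<in> ?K" "b4 \<in> ?K" using lb by auto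
    have q0: "H q *v col i = 0" if "i \<in> {0, 1, 2, 3, 4}" for i
    proof -
      have "H q *v e0 = 0" "H q *v e1 = 0" "H q *v e2 = 0"
        using eK[OF qK] H_swap by metis+
      moreover have "H q *v b3 = 0" "H q *v b4 = 0"
        unfolding Hq by (simp_all add: 33 34 eK[OF b34(1)] eK[OF b34(2)])
      ultimately show ?thesis using that by (auto simp: col vector_scalar_commute)
    qed
    have qa: "dotp (H q *v a1) a1 = 0" "dotp (H q *v a1) a2 = 0" "dotp (H q *v a2) a2 = 0" "dotp (H q *v a2) a1 = 0"
      unfolding Hq by (simp_all add: dotp_simps E0 E1 E2 a T_sym(1)[of b3 a2 a1])
    have cases7: "i \<in> {0, 1, 2, 3, 4} \<or> i = 5 \<or> i = 6" for i :: 7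
      using UNIV_I[of i] unfolding UNIV_7 by blast
    have qcol: "H q *v col i = 0" for i
    proof (rule zero_col)
      fix j
      note i = cases7[of i] and j = cases7[of j]
      show "dotp (H q *v col i) (col j) = 0"
      proof (cases "i \<in> {0, 1, 2, 3, 4} \<or> j \<in> {0, 1, 2, 3, 4}")
        case True
        then show ?thesis using q0[of i] q0[of j] T_sym(1)[of q "col i" "col j"] by auto
      next
        case False
        then show ?thesis using i j qa by (auto simp: col)
      qed
    qed
    have "H q *v y = 0" for y
    proof -
      obtain x where x: "y = A *v x" using surj by blast
      have "H q *v y = (\<Sum>j\<in>UNIV. x $ j *s (H q *v col j))"
        unfolding x Av H_swap[of q] H_sum_v H_scale_v ..
      then show ?thesis by (simp add: qcol)
    qed
    then have "q = 0" using H_eq_0_iff by blast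
    then have "b3 = dotp (H b3 *v a1) a1 *s e0 + (2 * dotp (H b3 *v a1) a2) *s e1 + dotp (H b3 *v a2) a2 *s e2"
      by (simp add: q_def)
    also have "\<dots> \<in> vec.span {e0, e1, e2}"
      by (intro vec.span_add vec.span_scale vec.span_base) auto
    finally have "b3 \<in> vec.span (B - {b3})"
      using vec.span_mono[of "{e0, e1, e2}" "B - {b3}"] B(1) distB(1) by blast
    then show False
      using B(3) Beq unfolding vec.dependent_def by blast
  qed
  then show ?thesis using D3 vars equiv by blast
qed

end


section \<open>Linear embeddings\<close>

text \<open>Linear maps are given here as homogeneous polynomial maps of degree one.\<close>

lemma pullback_form:
  fixes h :: "'k::field_char_0 ^ 'm::finite \<Rightarrow> 'k ^ 'n::finite"
  assumes h: "polymap h" "\<And>t x. h (t *s x) = t *s h x" and F: "form d F"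
  obtains G where "form d G" "\<And>x. peval G x = peval F (h x)"
proof -
  have pf: "polyfun (\<lambda>x. peval F (h x))" by (rule polyfun_compose[OF polyfun_peval h(1)])
  have hom: "peval F (h (t *s x)) = t ^ d * peval F (h x)" for t x
    by (simp add: h(2) peval_form_scale[OF F])
  obtain G where G: "form d G" "peval G = (\<lambda>x. peval F (h x))"
    by (rule homogeneous_polyfun_form[OF pf hom]) (rule that)
  show thesis by (rule that[OF G(1)]) (simp add: G(2))
qed

lemma closedin_linear_preimage:
  fixes h :: "'k::field_char_0 ^ 'm::finite \<Rightarrow> 'k ^ 'n::finite"
  assumes h: "polymap h" "\<And>t x. h (t *s x) = t *s h x" "\<And>x. x \<noteq> 0 \<Longrightarrow> h x \<noteq> 0"
    and C: "closedin zariski C"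
  shows "closedin zariski {x. h x \<in> C}"
proof -
  obtain S where S: "\<forall>F\<in>S. \<exists>d. form d F" "C = proj_zeros S"
    using C closedin_zariski by blast
  have h0: "h 0 = 0" using h(2)[of 0 0] by simp
  let ?T = "{G. (\<exists>d. form d G) \<and> (\<exists>F\<in>S. \<forall>x. peval G x = peval F (h x))}"
  have "{x. h x \<in> C} = proj_zeros ?T"
  proof (intro set_eqI iffI)
    fix x assume "x \<in> {x. h x \<in> C}"
    then show "x \<in> proj_zeros ?T"
      using h0 by (auto simp: S(2) proj_zeros_def)
  next
    fix x assume x: "x \<in> proj_zeros ?T"
    have "peval F (h x) = 0" if F: "F \<in> S" for F
    proof -
      obtain d where d: "form d F" using S(1) F by blast
      obtain G where G: "form d G" "\<And>x. peval G x = peval F (h x)"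
        by (rule pullback_form[OF h(1,2) d]) (rule that)
      then have "peval G x = 0" using x F unfolding proj_zeros_def by blast
      then show ?thesis by (simp add: G(2))
    qed
    then show "x \<in> {x. h x \<in> C}"
      using x h(3) by (auto simp: S(2) proj_zeros_def)
  qed
  then show ?thesis
    unfolding closedin_zariski by (intro exI[of _ ?T] conjI) blast+
qed

text \<open>The image of a linear embedding \<open>h\<close> with left inverse \<open>g\<close> is cut out by \<open>h (g y) = y\<close>.\<close>

lemma closedin_linear_image:
  fixes h :: "'k::field_char_0 ^ 'm::finite \<Rightarrow> 'k ^ 'n::finite" and g :: "'k ^ 'n \<Rightarrow> 'k ^ 'm"
  assumes h: "polymap h" "\<And>t x. h (t *s x) = t *s h x"
    and g: "polymap g" "\<And>t x. g (t *s x) = t *s g x" "\<And>x. g (h x) = x"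
    and C: "closedin zariski C"
  shows "closedin zariski (h ` C)"
proof -
  obtain S where S: "\<forall>F\<in>S. \<exists>d. form d F" "C = proj_zeros S"
    using C closedin_zariski by blast
  let ?T1 = "{G. (\<exists>d. form d G) \<and> (\<exists>F\<in>S. \<forall>y. peval G y = peval F (g y))}"
  let ?T2 = "{G. form 1 G \<and> (\<exists>i. \<forall>y. peval G y = (h (g y) - y) $ i)}"
  have "h ` C = proj_zeros (?T1 \<union> ?T2)"
  proof (intro set_eqI iffI)
    fix y assume "y \<in> h ` C"
    then obtain x where x: "x \<in> C" "y = h x" by blast
    have "y \<noteq> 0" using x g(3)[of x] g(2)[of 0 0] by (auto simp: S(2) proj_zeros_def)
    moreover have "g y = x" "h (g y) = y" using x g(3) by auto
    ultimately show "y \<in> proj_zeros (?T1 \<union> ?T2)"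
      using x(1) by (auto simp: S(2) proj_zeros_def)
  next
    fix y assume y: "y \<in> proj_zeros (?T1 \<union> ?T2)"
    have "(h (g y) - y) $ i = 0" for i
    proof -
      have "polyfun (\<lambda>x. h x $ i)" using h(1) by (simp add: polymap_def)
      from polyfun_compose[OF this g(1)] have pf: "polyfun (\<lambda>y. (h (g y) - y) $ i)" by (simp add: polyfun_sub)
      have hom: "(h (g (t *s y)) - t *s y) $ i = t ^ 1 * (h (g y) - y) $ i" for t y
        by (simp add: h(2) g(2) right_diff_distrib)
      obtain G where G: "form 1 G" "peval G = (\<lambda>y. (h (g y) - y) $ i)"
        by (rule homogeneous_polyfun_form[OF pf hom]) (rule that)
      then have "G \<in> ?T2" by auto
      then have "peval G y = 0" using y unfolding proj_zeros_def by blast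
      then show ?thesis by (simp add: G(2))
    qed
    then have hg: "h (g y) = y" by (simp add: vec_eq_iff)
    have y0: "y \<noteq> 0" using y by (simp add: proj_zeros_def)
    have "peval F (g y) = 0" if F: "F \<in> S" for F
    proof -
      obtain d where d: "form d F" using S(1) F by blast
      obtain G where G: "form d G" "\<And>x. peval G x = peval F (g x)"
        by (rule pullback_form[OF g(1,2) d]) (rule that)
      then have "G \<in> ?T1" using F by blast
      then have "peval G y = 0" using y unfolding proj_zeros_def by blast
      then show ?thesis by (simp add: G(2))
    qed
    moreover have "g y \<noteq> 0" using hg y0 h(2)[of 0 0] by auto
    ultimately have "g y \<in> C" by (simp add: S(2) proj_zeros_def)
    then show "y \<in> h ` C" using hg by force
  qed
  moreover have "\<forall>G\<in>?T1 \<union> ?T2. \<exists>d. form d G" by blast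
  ultimately show ?thesis
    unfolding closedin_zariski by (intro exI[of _ "?T1 \<union> ?T2"] conjI)
qed

text \<open>Chains of irreducible closed sets in the image pull back to chains in \<open>Y\<close>.\<close>

lemma zdim_linear_image_le:
  fixes h :: "'k::field_char_0 ^ 'm::finite \<Rightarrow> 'k ^ 'n::finite" and g :: "'k ^ 'n \<Rightarrow> 'k ^ 'm"
  assumes h: "polymap h" "\<And>t x. h (t *s x) = t *s h x"
    and g: "polymap g" "\<And>t x. g (t *s x) = t *s g x" "\<And>x. g (h x) = x"
    and Y: "closedin zariski Y" and W: "W \<subseteq> h ` Y"
  shows "zdim W \<le> zdim Y"
proof (rule zdim_le)
  fix d and C :: "nat \<Rightarrow> ('k ^ 'n) set"
  assume C: "\<And>i. i \<le> d \<Longrightarrow> irreducible_closed (C i) \<and> C i \<subseteq> W" "\<And>i. i < d \<Longrightarrow> C i \<subset> C (Suc i)"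
  have h0: "x \<noteq> 0 \<Longrightarrow> h x \<noteq> 0" for x using g(3)[of x] g(2)[of 0 0] by auto
  define P where "P i = {x. h x \<in> C i}" for i
  have CP: "C i = h ` P i" if "i \<le> d" for i
    using C(1)[OF that] W by (auto simp: P_def)
  have inj: "h ` A = h ` B \<Longrightarrow> A = B" for A B :: "('k ^ 'm) set"
    by (metis g(3) inj_image_eq_iff inj_on_inverseI)
  show "enat d \<le> zdim Y"
  proof (rule zdim_ge[of d P])
    fix i assume i: "i \<le> d"
    have irr: "irreducible_closed (C i)" using C(1)[OF i] by blast
    have "irreducible_closed (P i)"
      unfolding irreducible_closed_def
    proof (intro conjI allI impI)
      show "closedin zariski (P i)"
        unfolding P_def using irr by (intro closedin_linear_preimage h h0) (auto simp: irreducible_closed_def)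
      show "P i \<noteq> {}" using CP[OF i] irr by (auto simp: irreducible_closed_def)
      fix A B assume AB: "closedin zariski A \<and> closedin zariski B \<and> P i = A \<union> B"
      then have "C i = h ` A \<union> h ` B" using CP[OF i] by (simp add: image_Un)
      moreover have "closedin zariski (h ` A)" "closedin zariski (h ` B)"
        using AB by (auto intro: closedin_linear_image[OF h g])
      ultimately have "C i = h ` A \<or> C i = h ` B"
        using irr unfolding irreducible_closed_def by blast
      then show "P i = A \<or> P i = B" using CP[OF i] inj by metis
    qed
    moreover have "P i \<subseteq> Y"
    proof
      fix x assume "x \<in> P i"
      then have "h x \<in> h ` Y" using C(1)[OF i] W by (auto simp: P_def)
      then show "x \<in> Y" using g(3) by (metis imageE)
    qed
    ultimately show "irreducible_closed (P i) \<and> P i \<subseteq> Y" by blast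
  next
    fix i assume i: "i < d"
    then have "h ` P i \<subset> h ` P (Suc i)" using C(2)[OF i] CP[of i] CP[of "Suc i"] by simp
    then show "P i \<subset> P (Suc i)"
      using C(2)[OF i] by (auto simp: P_def)
  qed
qed

section \<open>Special Perazzo cubics\<close>

text \<open>Pluecker coordinates of a one-dimensional subspace: the coordinates of a spanning vector, indexed by
  singletons; all other coordinates are zero.\<close>

definition singleton_coords :: "'k::field ^ 'n::{finite, linorder} \<Rightarrow> 'k ^ ('n set)" where
  "singleton_coords w = (\<chi> I. if card I = 1 then w $ (the_elem I) else 0)"

lemma pluecker_singleton: "pluecker [w] = singleton_coords w"
proof -
  have "pluecker [w] $ I = singleton_coords w $ I" for I
  proof (cases "card I = 1")
    case True
    then obtain i where "I = {i}" by (rule card_1_singletonE)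
    then show ?thesis
      by (simp add: pluecker_def singleton_coords_def lessThan_Suc sign_id)
  qed (simp add: pluecker_def singleton_coords_def)
  then show ?thesis by (simp add: vec_eq_iff)
qed

lemma pluecker_point_line:
  assumes "w \<noteq> 0" shows "pluecker_point (vec.span {w}) = {singleton_coords v |v. v \<noteq> 0 \<and> v \<in> vec.span {w}}"
proof (intro set_eqI iffI)
  fix y assume "y \<in> pluecker_point (vec.span {w})"
  then obtain ws where ws: "y = pluecker ws" "distinct ws" "vec.independent (set ws)" "vec.span (set ws) = vec.span {w}"
    unfolding pluecker_point_def by blast
  have "length ws = vec.dim (vec.span {w})"
    using vec.dim_span_eq_card_independent[OF ws(3)] ws(4) distinct_card[OF ws(2)] by simp
  also have "\<dots> = 1" using assms by simp
  finally obtain v where v: "ws = [v]" by (auto simp: length_Suc_conv)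
  have "v \<noteq> 0" using ws(3) v vec.dependent_zero[of "{v}"] by auto
  moreover have "v \<in> vec.span {w}" using ws(4) v vec.span_base[of v "{v}"] by auto
  ultimately show "y \<in> {singleton_coords v |v. v \<noteq> 0 \<and> v \<in> vec.span {w}}"
    using ws(1) v pluecker_singleton by blast
next
  fix y assume "y \<in> {singleton_coords v |v. v \<noteq> 0 \<and> v \<in> vec.span {w}}"
  then obtain v where v: "y = singleton_coords v" "v \<noteq> 0" "v \<in> vec.span {w}" by blast
  then obtain c where c: "v = c *s w" by (auto simp: vec.span_singleton)
  then have "c \<noteq> 0" using v(2) by auto
  then have "w = inverse c *s v" using c by simp
  then have "w \<in> vec.span {v}" by (auto simp: vec.span_singleton)
  then have "vec.span {v} = vec.span {w}"
    using v(3) by (simp add: vec.span_eq)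
  then show "y \<in> pluecker_point (vec.span {w})"
    unfolding pluecker_point_def using v(1,2) pluecker_singleton[of v]
    by (intro CollectI exI[of _ "[v]"]) auto
qed

context curve_dual_cubic
begin

lemma zdim_polar: "zdim Z + 1 = enat generic_rank"
  by (rule generic_regular(1)) (simp add: dual_curve)

lemma perazzo_domain_tangent:
  assumes "p \<in> perazzo_domain f"
  shows "vec.dim (tangent_space Z (grad f p)) + 1 = CARD('n)"
  using assms zdim_polar generic_rank_eq by (simp add: perazzo_domain_def reg_locus_def)

lemma perazzo_domain_equation:
  assumes "p \<in> perazzo_domain f"
  obtains G i where "G \<in> vanishing_forms Z" "grad G (grad f p) $ i \<noteq> 0"
proof -
  have "\<exists>G\<in>vanishing_forms Z. grad G (grad f p) \<noteq> 0"
  proof (rule ccontr)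
    assume "\<not> ?thesis"
    then have "tangent_space Z (grad f p) = UNIV" by (auto simp: tangent_space_eq)
    then show False
      using perazzo_domain_tangent[OF assms] vec_dim_card[where 'a = 'k and 'n = 'n] by simp
  qed
  then show thesis using that by (auto simp: vec_eq_iff)
qed

text \<open>The Perazzo map sends every point of its domain to a one-dimensional subspace.\<close>

lemma perazzo_map_line:
  assumes p: "p \<in> perazzo_domain f"
  obtains w where "w \<noteq> 0" "perazzo_map f p = vec.span {w}"
proof -
  obtain G i where G: "G \<in> vanishing_forms Z" "grad G (grad f p) $ i \<noteq> 0"
    using perazzo_domain_equation[OF p] by blast
  let ?T = "tangent_space Z (grad f p)"
  define w where "w = grad G (grad f p)"
  have w: "w \<noteq> 0" using G(2) by (auto simp: w_def)
  have mem: "v \<in> perazzo_map f p \<longleftrightarrow> (\<forall>y\<in>?T. dotp y v = 0)" for v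
    by (simp add: perazzo_map_def dual_space_def dotp_def)
  have wm: "w \<in> perazzo_map f p"
    unfolding mem using G(1) by (auto simp: tangent_space_eq w_def dotp_commute)
  have sub: "vec.subspace {y. dotp w y = 0}" by (auto simp: vec.subspace_def dotp_simps)
  have ne: "{y. dotp w y = 0} \<noteq> UNIV" using w dotp_eq_0D[of w] by blast
  have "vec.dim {y. dotp w y = 0} < CARD('n)"
    using vec.dim_psubset[of "{y. dotp w y = 0}" UNIV] sub ne vec_dim_card[where 'a = 'k and 'n = 'n]
    by (simp add: vec.span_eq_iff[THEN iffD2, OF sub] psubset_eq)
  moreover have "?T \<subseteq> {y. dotp w y = 0}" using wm unfolding mem by (auto simp: dotp_commute)
  ultimately have T: "?T = {y. dotp w y = 0}"
    using vec.subspace_dim_equal[OF subspace_tangent_space sub] perazzo_domain_tangent[OF p] by simp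
  have "perazzo_map f p = vec.span {w}"
  proof
    show "perazzo_map f p \<subseteq> vec.span {w}"
    proof
      fix v assume "v \<in> perazzo_map f p"
      then have "dotp v y = 0" if "dotp w y = 0" for y
        using that unfolding mem T by (metis (full_types) dotp_commute mem_Collect_eq)
      then obtain c where "v = c *s w" using dotp_parallel[OF w] by blast
      then show "v \<in> vec.span {w}" by (auto simp: vec.span_singleton)
    qed
    show "vec.span {w} \<subseteq> perazzo_map f p"
      using wm unfolding vec.span_singleton mem[abs_def] by (auto simp: mem dotp_simps)
  qed
  then show thesis using w that by blast
qed

lemma perazzo_map_kernel:
  assumes p: "p \<in> perazzo_domain f" and r: "mrank (H p) = generic_rank"
  shows "perazzo_map f p = {v. H p *v v = 0}"
proof -
  have "range ((*v) (H p)) = tangent_space Z (grad f p)"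
    using vec.subspace_dim_equal[OF subspace_range subspace_tangent_space range_hess_tangent]
      perazzo_domain_tangent[OF p] generic_rank_eq r by (simp add: mrank_def)
  then show ?thesis using dual_space_range[of p] by (simp add: perazzo_map_def)
qed

text \<open>Points near a point of the domain belong to the domain as well.\<close>

lemma perazzo_domain_open:
  assumes p: "p \<in> perazzo_domain f" and r: "mrank (H p) = generic_rank"
  obtains E where "polyfun E" "E p \<noteq> 0" "\<And>q. E q \<noteq> 0 \<Longrightarrow> q \<in> perazzo_domain f \<and> mrank (H q) = generic_rank"
proof -
  obtain D where D: "polyfun D" "D p \<noteq> 0" "\<And>x. D x \<noteq> 0 \<Longrightarrow> mrank (H x) = generic_rank"
    by (rule generic_rank_open[OF r]) (rule that)
  obtain G i where G: "G \<in> vanishing_forms Z" "grad G (grad f p) $ i \<noteq> 0"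
    using perazzo_domain_equation[OF p] by blast
  obtain k where k: "grad f p $ k \<noteq> 0" using p by (auto simp: perazzo_domain_def vec_eq_iff)
  define E where "E x = D x * grad G (grad f x) $ i * grad f x $ k" for x
  show thesis
  proof (rule that[of E])
    show "polyfun E"
      unfolding E_def grad_def[of G] vec_lambda_beta using polymap_grad
      by (intro polyfun_mult D(1) polyfun_compose[OF polyfun_peval polymap_grad]) (simp add: polymap_def)
    show "E p \<noteq> 0" using D(2) G(2) k by (simp add: E_def)
    fix q assume q: "E q \<noteq> 0"
    then have rq: "mrank (H q) = generic_rank" and Gq: "grad G (grad f q) \<noteq> 0" and g0: "grad f q \<noteq> 0"
      using D(3) by (auto simp: E_def)
    have "q \<noteq> 0" using g0 grad_scale[of 0 q] by auto
    have "tangent_space Z (grad f q) \<noteq> UNIV"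
      using G(1) dotp_eq_0D[OF _, of "grad G (grad f q)"] Gq unfolding tangent_space_eq by blast
    then have "vec.dim (tangent_space Z (grad f q)) < CARD('n)"
      using vec.dim_psubset[of "tangent_space Z (grad f q)" UNIV] vec_dim_card[where 'a = 'k and 'n = 'n]
      by (simp add: vec.span_eq_iff[THEN iffD2, OF subspace_tangent_space] psubset_eq)
    then have "vec.dim (tangent_space Z (grad f q)) = generic_rank"
      using mrank_le_tangent[of q] rq generic_rank_eq by simp
    then show "q \<in> perazzo_domain f \<and> mrank (H q) = generic_rank"
      using rq g0 \<open>q \<noteq> 0\<close> grad_in_polar_image[OF g0] zdim_polar
      by (simp add: perazzo_domain_def reg_locus_def)
  qed
qed

text \<open>All points \<open>p + s z\<close> with \<open>z\<close> a common zero of \<open>l1\<close>, \<open>l2\<close> and general \<open>s\<close> lie in the fiber through \<open>p\<close>,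
  because \<open>H z\<close> kills the kernel of \<open>H p\<close>. Letting \<open>s\<close> tend to infinity, \<open>z\<close> lies in the closure.\<close>

lemma generic_perazzo_fiber:
  assumes n: "CARD('n) \<le> 7"
  obtains L U where "vec.subspace L" "vec.dim L + 2 = CARD('n)" "openin zariski U" "U \<noteq> {}"
    "\<And>p. p \<in> U \<inter> perazzo_domain f \<Longrightarrow> L - {0} \<subseteq> zariski closure_of (perazzo_fiber f p)"
proof -
  obtain l1 l2 a1 a2 where
    a: "dotp l1 a1 = 1" "dotp l2 a1 = 0" "dotp l1 a2 = 0" "dotp l2 a2 = 1"
    and ker: "\<And>p v z. mrank (H p) = generic_rank \<Longrightarrow> H p *v v = 0 \<Longrightarrow> dotp l1 z = 0 \<Longrightarrow> dotp l2 z = 0 \<Longrightarrow> H v *v z = 0"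
    by (rule conic_structure[OF n]) (rule that)
  let ?L = "{z. dotp l1 z = 0 \<and> dotp l2 z = 0}"
  obtain p0 where p0: "mrank (H p0) = generic_rank" using generic_rank_attained by blast
  obtain D where D: "polyfun D" "\<And>t x. D (t *s x) = t ^ CARD('n) * D x" "D p0 \<noteq> 0"
    "\<And>x. D x \<noteq> 0 \<Longrightarrow> mrank (H x) = generic_rank"
    by (rule generic_rank_open[OF p0]) (rule that)
  obtain F where F: "form CARD('n) F" "peval F = D"
    by (rule homogeneous_polyfun_form[OF D(1,2)]) (rule that)
  let ?U = "- {0} - proj_zeros {F}"
  have "openin zariski ?U"
    unfolding openin_zariski zariski_open_def by (rule exI[of _ "{F}"]) (use F(1) in auto)
  moreover have "p0 \<noteq> 0" using D(2)[of 0 p0] D(3) by (auto simp: zero_power)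
  then have "p0 \<in> ?U" using D(3) F(2) by (simp add: proj_zeros_def)
  then have "?U \<noteq> {}" by blast
  moreover have "?L - {0} \<subseteq> zariski closure_of (perazzo_fiber f p)" if pU: "p \<in> ?U \<inter> perazzo_domain f" for p
  proof
    fix z assume z: "z \<in> ?L - {0}"
    have p: "p \<in> perazzo_domain f" and rp: "mrank (H p) = generic_rank"
      using pU D(4)[of p] F(2) by (auto simp: proj_zeros_def)
    obtain E where E: "polyfun E" "E p \<noteq> 0" "\<And>q. E q \<noteq> 0 \<Longrightarrow> q \<in> perazzo_domain f \<and> mrank (H q) = generic_rank"
      by (rule perazzo_domain_open[OF p rp]) (rule that)
    obtain v where v: "v \<noteq> 0" "H p *v v = 0" using kernel_nonzero by blast
    have fib: "p + s *s z \<in> perazzo_fiber f p" if s: "E (p + s *s z) \<noteq> 0" for s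
    proof -
      let ?q = "p + s *s z"
      have q: "?q \<in> perazzo_domain f" "mrank (H ?q) = generic_rank" using E(3)[OF s] by auto
      have "H z *v v = 0" using ker[OF rp v(2)] z H_swap[of z v] by simp
      then have vq: "H ?q *v v = 0" by (simp add: H_add_v H_scale_v v(2))
      have "{u. H ?q *v u = 0} = vec.span {v}" "{u. H p *v u = 0} = vec.span {v}"
        using kernel_span[OF q(2) v(1) vq] kernel_span[OF rp v] by auto
      then show ?thesis
        using q(1) perazzo_map_kernel[OF q] perazzo_map_kernel[OF p rp] by (simp add: perazzo_fiber_def)
    qed
    have "peval G z = 0" if G: "form d G" "\<forall>y\<in>perazzo_fiber f p - {0}. peval G y = 0" for d G
    proof -
      obtain e where e: "\<And>s. E (p + s *s z) = poly e s" using polyfun_line[OF E(1)] by blast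
      obtain g where g: "\<And>s. peval G (p + s *s z) = poly g s" using polyfun_line[OF polyfun_peval] by blast
      have "poly (e * g) s = 0" for s
      proof (cases "E (p + s *s z) = 0")
        case True
        then show ?thesis by (simp add: e)
      next
        case False
        have "p + s *s z \<noteq> 0" using E(3)[OF False] by (auto simp: perazzo_domain_def)
        then have "peval G (p + s *s z) = 0" using G(2) fib[OF False] by blast
        then show ?thesis by (simp add: g)
      qed
      then have "e * g = 0" by (intro poly_zero_cofinite[of "{}"]) auto
      moreover have "e \<noteq> 0" using e[of 0] E(2) by auto
      ultimately have g0: "peval G (p + s *s z) = 0" for s by (simp add: g)
      obtain g' where g': "\<And>t. peval G (z + t *s p) = poly g' t" using polyfun_line[OF polyfun_peval] by blast
      have "poly g' t = 0" if "t \<notin> {0}" for t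
      proof -
        have eq: "z + t *s p = t *s (p + inverse t *s z)"
          using that by (simp add: vec.scale_right_distrib add.commute)
        show ?thesis
          unfolding g'[symmetric] eq peval_form_scale[OF G(1)] g0 by simp
      qed
      then have "g' = 0" by (intro poly_zero_cofinite[of "{0}"]) auto
      then show ?thesis using g'[of 0] by simp
    qed
    then show "z \<in> zariski closure_of (perazzo_fiber f p)"
      using z unfolding zariski_closure by blast
  qed
  moreover have "vec.subspace ?L" by (auto simp: vec.subspace_def dotp_simps)
  ultimately show thesis
    using that[of ?L ?U] dim_kernel_two_forms[OF a] by blast
qed

end

text \<open>Pluecker coordinates require an order on the index type.\<close>

locale curve_dual_cubic_linorder = curve_dual_cubic f
  for f :: "('n::{finite, linorder}, 'k::{alg_closed_field, field_char_0}) mpoly"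
begin

text \<open>In Pluecker coordinates the image of the Perazzo map is contained in a linear embedding of the dual of the
  polar image. The upper bound is inherited from the dual; a point and the closure of the values of a kernel map give the
  lower bound.\<close>

lemma perazzo_rank_eq: "perazzo_rank f = 1"
proof -
  let ?S = "\<Union>p\<in>perazzo_domain f. pluecker_point (perazzo_map f p)"
  let ?h = "singleton_coords :: ('k, 'n) vec \<Rightarrow> ('k, 'n set) vec"
  define g :: "('k, 'n set) vec \<Rightarrow> ('k, 'n) vec" where "g y = (\<chi> i. y $ {i})" for y
  have h: "polymap ?h" "\<And>t x. ?h (t *s x) = t *s ?h x"
  proof -
    have "polyfun (\<lambda>w :: ('k, 'n) vec. ?h w $ I)" for I
      by (cases "card I = 1") (simp_all add: singleton_coords_def)
    then show "polymap ?h" by (simp add: polymap_def)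
    show "?h (t *s x) = t *s ?h x" for t x by (simp add: singleton_coords_def vec_eq_iff)
  qed
  have g: "polymap g" "\<And>t x. g (t *s x) = t *s g x" "\<And>x. g (?h x) = x"
    by (simp_all add: polymap_def g_def vec_eq_iff singleton_coords_def)
  have h0: "?h x = 0 \<longleftrightarrow> x = 0" for x using g(3)[of x] g(2)[of 0 0] h(2)[of 0 0] by auto
  have S: "?S \<subseteq> ?h ` dual_variety Z"
  proof
    fix y assume "y \<in> ?S"
    then obtain p where p: "p \<in> perazzo_domain f" "y \<in> pluecker_point (perazzo_map f p)" by blast
    obtain w where w: "w \<noteq> 0" "perazzo_map f p = vec.span {w}" using perazzo_map_line[OF p(1)] by blast
    then obtain v where v: "y = ?h v" "v \<noteq> 0" "v \<in> perazzo_map f p"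
      using p(2) pluecker_point_line[OF w(1)] by auto
    have "v \<in> (\<Union>z\<in>reg_locus Z. dual_space (tangent_space Z z)) - {0}"
      using v p(1) by (auto simp: perazzo_map_def perazzo_domain_def)
    then have "v \<in> dual_variety Z"
      unfolding dual_variety_def using v(2) by (rule zariski_closure_superset)
    then show "y \<in> ?h ` dual_variety Z" using v(1) by blast
  qed
  have "closedin zariski (?h ` dual_variety Z)"
    by (rule closedin_linear_image[OF h g closedin_dual])
  then have "zariski closure_of ?S \<subseteq> ?h ` dual_variety Z"
    using S by (intro closure_of_minimal)
  then have le: "perazzo_rank f \<le> 1"
    using zdim_linear_image_le[OF h g closedin_dual] dual_curve by (simp add: perazzo_rank_def)

  obtain x1 where x1: "mrank (H x1) = generic_rank" using generic_rank_attained by blast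
  obtain v where v: "v \<noteq> 0" "H x1 *v v = 0" using kernel_nonzero by blast
  obtain \<psi> where \<psi>: "kernel_map \<psi>" "\<psi> x1 = v" using kernel_map_exists[OF x1 v(2)] by blast
  have v1: "\<psi> x1 \<noteq> 0" using \<psi>(2) v(1) by simp
  obtain k where k: "\<psi> x1 $ k \<noteq> 0" using v1 by (auto simp: vec_eq_iff)
  obtain x2 i j where x2: "\<psi> x1 $ i * \<psi> x2 $ j - \<psi> x1 $ j * \<psi> x2 $ i \<noteq> 0"
    using kernel_map_not_parallel[OF \<psi>(1) v1] by blast
  have v2: "\<psi> x2 \<noteq> 0" using x2 by auto
  obtain R q where R: "polyfun R" "R q \<noteq> 0" "\<And>x. R x \<noteq> 0 \<Longrightarrow> mrank (H x) = generic_rank"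
    "\<And>x. R x \<noteq> 0 \<Longrightarrow> x \<in> perazzo_domain f"
    by (rule regular_points) (rule that)
  have ph\<psi>: "polymap (\<lambda>x. ?h (\<psi> x))"
    unfolding polymap_def
    using h(1) by (intro allI polyfun_compose[OF _ kernel_mapD(1)[OF \<psi>(1)]]) (simp add: polymap_def)
  let ?C0 = "zariski closure_of range (\<lambda>x :: ('k, 'n) vec. ?h (\<psi> x1))"
  let ?C1 = "zariski closure_of range (\<lambda>x. ?h (\<psi> x))"
  have sub: "?C1 \<subseteq> zariski closure_of ?S"
  proof
    fix y assume y: "y \<in> ?C1"
    have "peval F y = 0" if F: "form d F" "\<forall>y\<in>?S - {0}. peval F y = 0" for d F
    proof -
      have pF: "polyfun (\<lambda>x. peval F (?h (\<psi> x)) * \<psi> x $ l)" for l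
        by (intro polyfun_mult polyfun_compose[OF polyfun_peval ph\<psi>] kernel_map_nth[OF \<psi>(1)])
      have "peval F (?h (\<psi> x)) * \<psi> x $ l = 0" for x l
      proof (rule polyfun_zero_generic[OF pF R(1,2)])
        fix x assume x: "R x \<noteq> 0"
        show "peval F (?h (\<psi> x)) * \<psi> x $ l = 0"
        proof (cases "\<psi> x = 0")
          case False
          have "perazzo_map f x = {u. H x *v u = 0}"
            by (rule perazzo_map_kernel[OF R(4)[OF x] R(3)[OF x]])
          also have "\<dots> = vec.span {\<psi> x}"
            by (rule kernel_span[OF R(3)[OF x] False kernel_mapD(2)[OF \<psi>(1)]])
          finally have "?h (\<psi> x) \<in> pluecker_point (perazzo_map f x)"
            using pluecker_point_line[OF False] False vec.span_base[of "\<psi> x" "{\<psi> x}"] by auto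
          then have "?h (\<psi> x) \<in> ?S - {0}" using R(4)[OF x] False h0 by auto
          then show ?thesis using F(2) by simp
        qed simp
      qed
      then have van: "\<psi> x \<noteq> 0 \<Longrightarrow> peval F (?h (\<psi> x)) = 0" for x
        by (metis mult_eq_0_iff vec_eq_iff zero_index)
      have "\<forall>y\<in>range (\<lambda>x. ?h (\<psi> x)) - {0}. peval F y = 0"
      proof
        fix y assume "y \<in> range (\<lambda>x. ?h (\<psi> x)) - {0}"
        then obtain x where "y = ?h (\<psi> x)" "\<psi> x \<noteq> 0" using h0 by blast
        then show "peval F y = 0" by (simp add: van)
      qed
      then show ?thesis using y F(1) unfolding zariski_closure by blast
    qed
    moreover have "y \<noteq> 0" using y unfolding zariski_closure by blast
    ultimately show "y \<in> zariski closure_of ?S" unfolding zariski_closure by blast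
  qed
  have irr: "irreducible_closed ?C0" "irreducible_closed ?C1"
    using irreducible_closed_image[OF polymap_const, of "?h (\<psi> x1)"] irreducible_closed_image[OF ph\<psi>, of x1] v1
    by (simp_all add: h0)
  have "range (\<lambda>x :: ('k, 'n) vec. ?h (\<psi> x1)) \<subseteq> range (\<lambda>x. ?h (\<psi> x))" by auto
  then have sub01: "?C0 \<subseteq> ?C1" by (rule closure_of_mono)
  have ne: "?C0 \<noteq> ?C1"
  proof
    assume eq: "?C0 = ?C1"
    have pG: "polyfun (\<lambda>y :: ('k, 'n set) vec. \<psi> x1 $ i * y $ {j} - \<psi> x1 $ j * y $ {i})"
      by (intro polyfun_sub polyfun_mult polyfun_const polyfun_nth)
    have hom: "\<psi> x1 $ i * (t *s y) $ {j} - \<psi> x1 $ j * (t *s y) $ {i} = t ^ 1 * (\<psi> x1 $ i * y $ {j} - \<psi> x1 $ j * y $ {i})"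
      for t and y :: "('k, 'n set) vec" by (simp add: algebra_simps)
    obtain G where G: "form 1 G" "peval G = (\<lambda>y. \<psi> x1 $ i * y $ {j} - \<psi> x1 $ j * y $ {i})"
      by (rule homogeneous_polyfun_form[OF pG hom]) (rule that)
    have "?h (\<psi> x2) \<in> ?C1" using v2 by (intro zariski_closure_superset) (auto simp: h0)
    then have "?h (\<psi> x2) \<in> ?C0" using eq by simp
    moreover have "\<forall>y\<in>range (\<lambda>x :: ('k, 'n) vec. ?h (\<psi> x1)) - {0}. peval G y = 0"
      by (simp add: G(2) singleton_coords_def)
    ultimately have "peval G (?h (\<psi> x2)) = 0" using G(1) unfolding zariski_closure by blast
    then show False using x2 by (simp add: G(2) singleton_coords_def)
  qed
  define C where "C n = (if n = 0 then ?C0 else ?C1)" for n :: nat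
  have "enat 1 \<le> perazzo_rank f"
    unfolding perazzo_rank_def
  proof (rule zdim_ge[of 1 C])
    show "irreducible_closed (C n) \<and> C n \<subseteq> zariski closure_of ?S" for n
      using irr sub sub01 by (auto simp: C_def)
    show "C n \<subset> C (Suc n)" if "n < 1" for n
      using that ne sub01 by (auto simp: C_def)
  qed
  then show ?thesis using le by (intro antisym) (simp_all add: one_enat_def)
qed

end

lemma special_perazzo_of_curve_dual:
  fixes f :: "('n::{finite, linorder}, 'k::{alg_closed_field, field_char_0}) mpoly"
  assumes f: "irreducible_cubic f" "vanishing_hessian f" "\<not> is_cone (hypersurface f)"
    and curve: "zdim (dual_variety (polar_image f)) = 1" and n: "CARD('n) \<le> 7"
  shows "special_perazzo_cubic f"
proof -
  have form3: "form 3 f" using f(1) by (simp add: irreducible_cubic_def)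
  interpret curve_dual_cubic_linorder f
    by unfold_locales (use form3 f curve in auto)
  obtain L U where L: "vec.subspace L" "vec.dim L + 2 = CARD('n)" and U: "openin zariski U" "U \<noteq> {}"
    "\<And>p. p \<in> U \<inter> perazzo_domain f \<Longrightarrow> L - {0} \<subseteq> zariski closure_of (perazzo_fiber f p)"
    by (rule generic_perazzo_fiber[OF n]) (rule that)
  have "enat (vec.dim L) + perazzo_rank f = enat (CARD('n) - 1)"
    using L(2) by (simp add: perazzo_rank_eq one_enat_def flip: L(2))
  then show ?thesis
    unfolding special_perazzo_cubic_def using f L(1) U by blast
qed

theorem theorem4p4:
  fixes f :: "(7, 'k::{alg_closed_field, field_char_0}) mpoly"
  assumes "irreducible_cubic f"
    and "vanishing_hessian f"
    and "\<not> is_cone (hypersurface f)"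
    and "zdim (dual_variety (polar_image f)) = 1"
  shows "special_perazzo_cubic f \<and>
    (\<exists>D :: (7, 'k) mpoly. form 3 D \<and> pvars D \<subseteq> {3, 4, 5, 6} \<and>
       proj_equivalent (hypersurface f)
         (hypersurface (Var 0 * Var 5 ^ 2 + 2 * Var 1 * Var 5 * Var 6 + Var 2 * Var 6 ^ 2 + D)) \<and>
       \<not> proj_zeros {Var 0, Var 1, Var 2, Var 5, Var 6} \<subseteq> singular_locus {D, Var 0, Var 1, Var 2})"
proof -
  have form3: "form 3 f" using assms(1) by (simp add: irreducible_cubic_def)
  interpret curve_dual_cubic7 f
    by unfold_locales (use form3 assms in auto)
  have "special_perazzo_cubic f"
    using assms by (rule special_perazzo_of_curve_dual) simp
  then show ?thesis using normal_form by blast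
qed

end
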